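(* Let $u:\mathbb{A}\to\mathbb{R}$ be the generating function of a continuous foliation of $\mathbb{A}$ into graphs, and assume that $u$ is $C^1$. Then the following two assertions are equivalent: (1) the foliation is Lipschitz; (2) all of the following hold: - $\frac{\partial u}{\partial\theta}$ is locally Lipschitz continuous; - $\frac{\partial u}{\partial c}$ is uniformly Lipschitz continuous in the variable $\theta$ on any compact set of $c$'s; - for every compact subset $\mathcal{K}\subset\mathbb{A}$ there exist two constants $k_+>k_->-1$ such that $k_+\ge\frac{\partial^2u}{\partial\theta\partial c}\ge k_-$ Lebesgue almost everywhere in $\mathcal{K}$. In this case, $u$ is the generating function of an exact symplectic homeomorphism $\Phi:\mathbb{A}\to\mathbb{A}$ that maps the standard foliation onto the given foliation.
   Context: $\mathbb{T}=\mathbb{R}/\mathbb{Z}$, $\mathbb{A}=\mathbb{T}\times\mathbb{R}$ with symplectic form $-d(r\,d\theta)$. A continuous ($C^0$) foliation of $\mathbb{A}$ into graphs is a partition of $\mathbb{A}$ into graphs of continuous functions $\eta_c:\mathbb{T}\to\mathbb{R}$, $c\in\mathbb{R}$, normalized by $\int_{\mathbb{T}}\eta_c=c$, such that $(\theta,c)\mapsto(\theta,\eta_c(\theta))$ is a homeomorphism of $\mathbb{A}$. Its generating function is the unique continuous $u:\mathbb{A}\to\mathbb{R}$ that is $C^1$ in the $\mathbb{T}$ variable with $u(0,c)=0$ for all $c$ and such that, for all $c$, the graph of $c+\frac{\partial u}{\partial\theta}(\cdot,c)$ is a leaf; thus $\eta_c=c+\frac{\partial u}{\partial\theta}(\cdot,c)$.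 The foliation is Lipschitz if $(\theta,c)\mapsto(\theta,\eta_c(\theta))$ is a homeomorphism that is locally biLipschitz. The standard foliation of $\mathbb{A}$ has leaves $\mathbb{T}\times\{c\}$, $c\in\mathbb{R}$. A diffeomorphism $\phi:\mathbb{A}\to\mathbb{A}$ is exact symplectic if $\phi^*(r\,d\theta)-r\,d\theta$ is exact; an exact symplectic homeomorphism is a homeomorphism that is a limit, for the $C^0$ compact-open topology, of a sequence of exact symplectic diffeomorphisms. A $C^1$ function $u$ is a generating function of $\Phi$ if $$\Phi(x,c)=(\theta,r)\iff x=\theta+\frac{\partial u}{\partial c}(\theta,c)\ \text{ and }\ r=c+\frac{\partial u}{\partial\theta}(\theta,c).$$ *)

theory Defs
  imports "HOL-Analysis.Analysis"
begin

section \<open>The circle $\mathbb{R}/\mathbb{Z}$\<close>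

quotient_type circle = real / "\<lambda>x y. x - y \<in> \<int>"
proof (rule equivpI)
  show "reflp (\<lambda>x y::real. x - y \<in> \<int>)"
    by (simp add: reflp_def)
  show "symp (\<lambda>x y::real. x - y \<in> \<int>)"
    by (auto simp: symp_def intro: iffD1[OF minus_in_Ints_iff])
  show "transp (\<lambda>x y::real. x - y \<in> \<int>)"
  proof (rule transpI)
    fix x y z :: real
    assume "x - y \<in> \<int>" "y - z \<in> \<int>"
    then have "(x - y) + (y - z) \<in> \<int>" by (rule Ints_add)
    then show "x - z \<in> \<int>" by simp
  qed
qed

lift_definition to_circle :: "real \<Rightarrow> circle" is "\<lambda>t. t" .

instantiation circle :: ab_group_add
begin

lift_definition zero_circle :: circle is 0 .

lift_definition plus_circle :: "circle \<Rightarrow> circle \<Rightarrow> circle" is "(+)"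
  by (metis Ints_add add_diff_add)

lift_definition uminus_circle :: "circle \<Rightarrow> circle" is uminus
  by (metis minus_diff_commute minus_in_Ints_iff diff_minus_eq_add minus_diff_eq
      uminus_add_conv_diff)

lift_definition minus_circle :: "circle \<Rightarrow> circle \<Rightarrow> circle" is "(-)"
proof -
  fix a b c d :: real
  assume "a - b \<in> \<int>" "c - d \<in> \<int>"
  then have "(a - b) - (c - d) \<in> \<int>" by (rule Ints_diff)
  then show "(a - c) - (b - d) \<in> \<int>" by (simp add: algebra_simps)
qed

instance
  by standard (transfer; simp)+

end

text \<open>The distance is the quotient distance: \<open>t - round t\<close> is the signed distance from \<open>t\<close>
  to the nearest integer.\<close>

lemma abs_minus_round_cong:
  fixes s t :: real
  assumes "s - t \<in> \<int>"
  shows "\<bar>s - of_int (round s)\<bar> = \<bar>t - of_int (round t)\<bar>"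
proof -
  obtain k where k: "s = t + of_int k"
    using assms by (metis Ints_cases add.commute diff_add_cancel)
  show ?thesis
    using round_diff_minimal[of s "round t + k"] round_diff_minimal[of t "round s - k"] k
    by (simp add: algebra_simps)
qed

instantiation circle :: metric_space
begin

lift_definition dist_circle :: "circle \<Rightarrow> circle \<Rightarrow> real"
  is "\<lambda>x y. \<bar>(x - y) - of_int (round (x - y))\<bar>"
proof -
  fix a b c d :: real
  assume "a - b \<in> \<int>" "c - d \<in> \<int>"
  then have "(a - b) - (c - d) \<in> \<int>" by (rule Ints_diff)
  then have "(a - c) - (b - d) \<in> \<int>" by (simp add: algebra_simps)
  then show "\<bar>(a - c) - of_int (round (a - c))\<bar> = \<bar>(b - d) - of_int (round (b - d))\<bar>"
    by (rule abs_minus_round_cong)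
qed

definition uniformity_circle :: "(circle \<times> circle) filter"
  where "uniformity_circle = (INF e\<in>{0 <..}. principal {(x, y). dist x y < e})"

definition open_circle :: "circle set \<Rightarrow> bool"
  where "open_circle U \<longleftrightarrow> (\<forall>x\<in>U. \<forall>\<^sub>F (x', y) in uniformity. x' = x \<longrightarrow> y \<in> U)"

instance
proof
  show "uniformity = (INF e\<in>{0 <..}. principal {(x, y :: circle). dist x y < e})"
    by (rule uniformity_circle_def)
next
  fix U :: "circle set"
  show "open U \<longleftrightarrow> (\<forall>x\<in>U. \<forall>\<^sub>F (x', y) in uniformity. x' = x \<longrightarrow> y \<in> U)"
    by (rule open_circle_def)
next
  fix x y :: circle
  show "dist x y = 0 \<longleftrightarrow> x = y"
    by transfer (metis Ints_of_int abs_0_eq cancel_comm_monoid_add_class.diff_cancel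
        eq_iff_diff_eq_0 Ints_cases round_of_int)
next
  fix x y z :: circle
  show "dist x y \<le> dist x z + dist y z"
  proof transfer
    fix x y z :: real
    have "\<bar>(x - y) - of_int (round (x - y))\<bar>
        \<le> \<bar>(x - y) - of_int (round (x - z) - round (y - z))\<bar>"
      by (rule round_diff_minimal)
    then show "\<bar>(x - y) - of_int (round (x - y))\<bar>
        \<le> \<bar>(x - z) - of_int (round (x - z))\<bar> + \<bar>(y - z) - of_int (round (y - z))\<bar>"
      by simp
  qed
qed

end

lemma to_circle_eq_iff: "to_circle s = to_circle t \<longleftrightarrow> s - t \<in> \<int>"
  by transfer simp

lemma to_circle_add: "to_circle (s + t) = to_circle s + to_circle t"
  by transfer simp

lemma surj_to_circle: "surj to_circle"
proof (rule surjI)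
  show "to_circle (rep_circle x) = x" for x
    by (metis Quotient3_abs_rep Quotient3_circle to_circle.abs_eq)
qed

lemma dist_to_circle:
  "dist (to_circle s) (to_circle t) = \<bar>(s - t) - of_int (round (s - t))\<bar>"
  by transfer simp

lemma continuous_on_to_circle: "continuous_on UNIV to_circle"
proof (rule continuous_on_iff[THEN iffD2], intro ballI allI impI)
  fix x e :: real
  assume "0 < e"
  moreover have "dist (to_circle y) (to_circle x) \<le> dist y x" for y
    using round_diff_minimal[of "y - x" 0] by (simp add: dist_to_circle dist_real_def)
  ultimately show "\<exists>d>0. \<forall>y\<in>UNIV. dist y x < d \<longrightarrow> dist (to_circle y) (to_circle x) < e"
    by (meson le_less_trans)
qed

definition circle_lebesgue :: "circle measure"
  where "circle_lebesgue = distr (restrict_space lborel {0..<1}) borel to_circle"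

lemma measurable_to_circle [measurable]: "to_circle \<in> borel_measurable borel"
  by (rule borel_measurable_continuous_onI[OF continuous_on_to_circle])

lemma integral_circle_lebesgue:
  fixes f :: "circle \<Rightarrow> real"
  assumes [measurable]: "f \<in> borel_measurable borel"
  shows "(\<integral>x. f x \<partial>circle_lebesgue) = (LINT t:{0..<1}|lborel. f (to_circle t))"
proof -
  have "to_circle \<in> measurable (restrict_space lborel {0..<1}) borel"
    by (rule measurable_restrict_space1) simp
  then have "(\<integral>x. f x \<partial>circle_lebesgue)
      = (\<integral>t. f (to_circle t) \<partial>restrict_space lborel {0..<1})"
    unfolding circle_lebesgue_def by (rule integral_distr) fact
  also have "\<dots> = (LINT t:{0..<1}|lborel. f (to_circle t))"
    by (simp add: integral_restrict_space set_lebesgue_integral_def)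
  finally show ?thesis .
qed


section \<open>The annulus\<close>

type_synonym annulus = "circle \<times> real"

definition annulus_cover :: "real \<times> real \<Rightarrow> annulus"
  where "annulus_cover p = (to_circle (fst p), snd p)"

definition annulus_lebesgue :: "annulus measure"
  where "annulus_lebesgue = circle_lebesgue \<Otimes>\<^sub>M lborel"

definition d_theta :: "(annulus \<Rightarrow> real) \<Rightarrow> annulus \<Rightarrow> real"
  where "d_theta u p = deriv (\<lambda>t. u (fst p + to_circle t, snd p)) 0"

definition d_c :: "(annulus \<Rightarrow> real) \<Rightarrow> annulus \<Rightarrow> real"
  where "d_c u p = deriv (\<lambda>c. u (fst p, c)) (snd p)"


section \<open>Regularity\<close>

text \<open>On a finite-dimensional space, \<open>C_k\<close> is the usual class of \<open>k\<close> times continuously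
  differentiable maps, as the directional derivatives in all fixed directions determine the
  derivative continuously.\<close>

primrec C_k :: "nat \<Rightarrow> ('a::euclidean_space \<Rightarrow> 'b::real_normed_vector) \<Rightarrow> bool"
  where
    "C_k 0 f \<longleftrightarrow> continuous_on UNIV f"
  | "C_k (Suc k) f \<longleftrightarrow>
      (\<exists>f'. (\<forall>p. (f has_derivative f' p) (at p)) \<and> (\<forall>v. C_k k (\<lambda>p. f' p v)))"

definition annulus_C1 :: "(annulus \<Rightarrow> real) \<Rightarrow> bool"
  where "annulus_C1 u \<longleftrightarrow> C_k 1 (u \<circ> annulus_cover)"

definition locally_lipschitz :: "('a::metric_space \<Rightarrow> 'b::metric_space) \<Rightarrow> bool"
  where "locally_lipschitz f \<longleftrightarrow> (\<forall>p. \<exists>U L. open U \<and> p \<in> U \<and> L-lipschitz_on U f)"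

definition locally_bilipschitz :: "('a::metric_space \<Rightarrow> 'b::metric_space) \<Rightarrow> bool"
  where "locally_bilipschitz f \<longleftrightarrow>
    (\<forall>p. \<exists>U L. open U \<and> p \<in> U \<and> 0 < L \<and>
      (\<forall>x\<in>U. \<forall>y\<in>U. dist x y / L \<le> dist (f x) (f y) \<and> dist (f x) (f y) \<le> L * dist x y))"


section \<open>Foliations into graphs\<close>

definition fun_graph :: "(circle \<Rightarrow> real) \<Rightarrow> annulus set"
  where "fun_graph f = range (\<lambda>\<theta>. (\<theta>, f \<theta>))"

definition leaves :: "(real \<Rightarrow> circle \<Rightarrow> real) \<Rightarrow> annulus set set"
  where "leaves \<eta> = range (\<lambda>c. fun_graph (\<eta> c))"

definition foliation_map :: "(real \<Rightarrow> circle \<Rightarrow> real) \<Rightarrow> annulus \<Rightarrow> annulus"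
  where "foliation_map \<eta> = (\<lambda>(\<theta>, c). (\<theta>, \<eta> c \<theta>))"

definition continuous_foliation :: "(real \<Rightarrow> circle \<Rightarrow> real) \<Rightarrow> bool"
  where "continuous_foliation \<eta> \<longleftrightarrow>
    (\<forall>c. continuous_on UNIV (\<eta> c)) \<and>
    (\<forall>c. (\<integral>\<theta>. \<eta> c \<theta> \<partial>circle_lebesgue) = c) \<and>
    partition_on UNIV (leaves \<eta>) \<and>
    (\<exists>g. homeomorphism UNIV UNIV (foliation_map \<eta>) g)"

definition lipschitz_foliation :: "(real \<Rightarrow> circle \<Rightarrow> real) \<Rightarrow> bool"
  where "lipschitz_foliation \<eta> \<longleftrightarrow>
    continuous_foliation \<eta> \<and> locally_bilipschitz (foliation_map \<eta>)"

definition foliation_generating_function ::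
    "(real \<Rightarrow> circle \<Rightarrow> real) \<Rightarrow> (annulus \<Rightarrow> real) \<Rightarrow> bool"
  where "foliation_generating_function \<eta> u \<longleftrightarrow>
    continuous_on UNIV u \<and>
    (\<forall>c. (\<lambda>t. u (to_circle t, c)) C1_differentiable_on UNIV) \<and>
    (\<forall>c. u (0, c) = 0) \<and>
    (\<forall>c. fun_graph (\<lambda>\<theta>. c + d_theta u (\<theta>, c)) \<in> leaves \<eta>)"

definition standard_foliation :: "annulus set set"
  where "standard_foliation = range (\<lambda>c. UNIV \<times> {c})"


section \<open>Exact symplectic maps\<close>

text \<open>A map \<open>F\<close> of the plane is a lift of a self-map \<open>\<phi>\<close> of the annulus. Every continuous \<open>\<phi>\<close>
  has continuous lifts, any two of which differ by a constant \<open>(m, 0)\<close> with \<open>m\<close> an integer, so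
  that smoothness of \<open>\<phi>\<close> and the form $\phi^*(r\,d\theta)$ can be read off any one of them.\<close>

definition is_lift :: "(real \<times> real \<Rightarrow> real \<times> real) \<Rightarrow> (annulus \<Rightarrow> annulus) \<Rightarrow> bool"
  where "is_lift F \<phi> \<longleftrightarrow> annulus_cover \<circ> F = \<phi> \<circ> annulus_cover"

definition annulus_smooth :: "(annulus \<Rightarrow> annulus) \<Rightarrow> bool"
  where "annulus_smooth \<phi> \<longleftrightarrow> (\<exists>F. is_lift F \<phi> \<and> (\<forall>k. C_k k F))"

definition annulus_diffeomorphism :: "(annulus \<Rightarrow> annulus) \<Rightarrow> bool"
  where "annulus_diffeomorphism \<phi> \<longleftrightarrow> bij \<phi> \<and> annulus_smooth \<phi> \<and> annulus_smooth (inv \<phi>)"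

text \<open>The one-form $r\,d\theta$ at the point \<open>p\<close>, applied to the tangent vector \<open>v\<close>.\<close>

definition r_dtheta :: "real \<times> real \<Rightarrow> real \<times> real \<Rightarrow> real"
  where "r_dtheta p v = snd p * fst v"

text \<open>$\phi^*(r\,d\theta) - r\,d\theta = dS$ for a function \<open>S\<close> on the annulus itself, and not merely
  on its universal cover.\<close>

definition exact_symplectic_diffeomorphism :: "(annulus \<Rightarrow> annulus) \<Rightarrow> bool"
  where "exact_symplectic_diffeomorphism \<phi> \<longleftrightarrow>
    annulus_diffeomorphism \<phi> \<and>
    (\<exists>F F' S. is_lift F \<phi> \<and>
      (\<forall>p. (F has_derivative F' p) (at p)) \<and>
      (\<forall>p. (S \<circ> annulus_cover has_derivative
              (\<lambda>v. r_dtheta (F p) (F' p v) - r_dtheta p v)) (at p)))"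

text \<open>On maps between metric spaces, convergence in the compact-open topology is uniform
  convergence on compact sets.\<close>

definition exact_symplectic_homeomorphism :: "(annulus \<Rightarrow> annulus) \<Rightarrow> bool"
  where "exact_symplectic_homeomorphism \<Phi> \<longleftrightarrow>
    (\<exists>g. homeomorphism UNIV UNIV \<Phi> g) \<and>
    (\<exists>\<phi> :: nat \<Rightarrow> annulus \<Rightarrow> annulus.
      (\<forall>n. exact_symplectic_diffeomorphism (\<phi> n)) \<and>
      (\<forall>K. compact K \<longrightarrow> uniform_limit K \<phi> \<Phi> sequentially))"

definition map_generating_function :: "(annulus \<Rightarrow> real) \<Rightarrow> (annulus \<Rightarrow> annulus) \<Rightarrow> bool"
  where "map_generating_function u \<Phi> \<longleftrightarrow>
    annulus_C1 u \<and>
    (\<forall>x c \<theta> r. \<Phi> (x, c) = (\<theta>, r) \<longleftrightarrow>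
      x = \<theta> + to_circle (d_c u (\<theta>, c)) \<and> r = c + d_theta u (\<theta>, c))"

end

theory Submission
  imports Defs
begin

text \<open>
  Everything is computed on the universal cover: \<open>W (t, c)\<close> is the lift of \<open>u\<close>, of period one in \<open>t\<close>,
  with partial derivatives \<open>W1\<close> in \<open>t\<close> and \<open>W2\<close> in \<open>c\<close>. The leaf with mean value \<open>c\<close> is the graph of
  \<open>c + W1 (t, c)\<close>, and leaves with larger \<open>c\<close> lie strictly higher (\<open>leaves_increasing\<close>).

  The equivalence. A Lipschitz foliation is one whose leaves separate at a rate bounded above and
  away from zero, with a Lipschitz dependence on \<open>t\<close>; in other words, \<open>W1\<close> is locally Lipschitz, and
  the difference quotients of \<open>W1\<close> in \<open>c\<close> lie locally in a compact subset of \<open>{-1<..}\<close>. The numbers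
  \<open>W (t', c') - W (t, c') - W (t', c) + W (t, c)\<close> are integrals of increments of \<open>W1\<close> in \<open>c\<close>, and
  equally of increments of \<open>W2\<close> in \<open>t\<close>. Hence bounds for the former increments are bounds for the
  latter (\<open>mixed_slope_lower_bound\<close>). So \<open>t + W2 (t, c)\<close> is biLipschitz in \<open>t\<close>, and Lebesgue's theorem
  turns the bounds for its increments into bounds for its derivative almost everywhere. The form of
  Lebesgue's theorem needed here is proved from Vitali's covering theorem
  (\<open>oscillating_slopes_negligible\<close>). Conversely, a Lipschitz function whose derivative is almost
  everywhere at least \<open>k\<close> has all its slopes at least \<open>k\<close> (\<open>slope_ge_of_ae_derivative_ge\<close>).

  The homeomorphism. For a Lipschitz foliation both \<open>(t, c) \<mapsto> (t + W2 (t, c), c)\<close> and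
  \<open>(t, c) \<mapsto> (t, c + W1 (t, c))\<close> descend to homeomorphisms of the annulus, and \<open>\<Phi>\<close> is the second one
  composed with the inverse of the first. If \<open>W\<close> is smooth with \<open>1 + W12 > 0\<close> and \<open>W1\<close> bounded, the
  same formula gives an exact symplectic diffeomorphism (\<open>exact_symplectic_generated_map\<close>). It
  remains to approximate \<open>W\<close> by such functions, together with its first derivatives and uniformly on
  compact sets. Averaging \<open>W\<close> over \<open>{c..c + \<delta>}\<close> produces the continuous mixed derivative
  \<open>(W1 (t, c + \<delta>) - W1 (t, c)) / \<delta>\<close>, which is larger than \<open>-1\<close> because the leaves are ordered. On a
  compact strip it is uniformly close to a smooth function, by the Stone-Weierstrass theorem, and
  integrating that function in both variables gives the approximation
  (\<open>smooth_approximation_on_strip\<close>). A reparametrisation of \<open>c\<close> extends it from the strip to the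
  whole annulus (\<open>smooth_twist_approximation\<close>).
\<close>

section \<open>Topology of the circle and of the annulus\<close>

lemma to_circle_add_int: "to_circle (t + of_int k) = to_circle t"
  by (simp add: to_circle_eq_iff)

lemma to_circle_0: "to_circle 0 = 0"
  by transfer simp

lemma dist_to_circle_le: "dist (to_circle s) (to_circle t) \<le> dist s t"
  using round_diff_minimal[of "s - t" 0] by (simp add: dist_to_circle dist_real_def)

lemma to_circle_lift_near:
  obtains t where "to_circle t = \<theta>" "dist t s = dist \<theta> (to_circle s)"
proof -
  obtain t0 where t0: "\<theta> = to_circle t0"
    using surj_to_circle by (metis surjD)
  show ?thesis
  proof
    show "to_circle (t0 - of_int (round (t0 - s))) = \<theta>"
      by (simp add: t0 to_circle_eq_iff)
    show "dist (t0 - of_int (round (t0 - s))) s = dist \<theta> (to_circle s)"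
      by (simp add: t0 dist_to_circle dist_real_def algebra_simps)
  qed
qed

lemma to_circle_lift_unit:
  obtains t where "to_circle t = \<theta>" "0 \<le> t" "t < 1"
proof -
  obtain t0 where t0: "\<theta> = to_circle t0"
    using surj_to_circle by (metis surjD)
  show ?thesis
  proof
    show "to_circle (frac t0) = \<theta>"
      by (simp add: t0 to_circle_eq_iff frac_def)
  qed (auto simp: frac_lt_1)
qed

lemma annulus_cover_simp: "annulus_cover (t, c) = (to_circle t, c)"
  by (simp add: annulus_cover_def)

lemma dist_annulus_cover_le: "dist (annulus_cover p) (annulus_cover q) \<le> dist p q"
  using dist_to_circle_le[of "fst p" "fst q"]
  by (auto simp: annulus_cover_def dist_prod_def intro!: real_sqrt_le_mono add_mono power_mono)

lemma annulus_cover_lift_near: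
  obtains q' where "annulus_cover q' = q" "dist q' p = dist q (annulus_cover p)"
proof -
  obtain t where "to_circle t = fst q" "dist t (fst p) = dist (fst q) (to_circle (fst p))"
    by (rule to_circle_lift_near)
  then show ?thesis
    by (intro that[of "(t, snd q)"]) (auto simp: annulus_cover_def dist_prod_def)
qed

lemma surj_annulus_cover: "surj annulus_cover"
  by (metis annulus_cover_lift_near surjI)

lemma continuous_annulus_cover: "continuous_on UNIV annulus_cover"
  unfolding continuous_on_iff by (meson dist_annulus_cover_le le_less_trans)

text \<open>The covering map is a local isometry, so continuity downstairs can be tested upstairs.\<close>

lemma continuous_on_annulus_iff:
  fixes f :: "annulus \<Rightarrow> 'a::metric_space"
  shows "continuous_on UNIV f \<longleftrightarrow> continuous_on UNIV (f \<circ> annulus_cover)"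
proof
  assume "continuous_on UNIV f"
  then show "continuous_on UNIV (f \<circ> annulus_cover)"
    by (intro continuous_on_compose continuous_annulus_cover) (auto elim: continuous_on_subset)
next
  assume c: "continuous_on UNIV (f \<circ> annulus_cover)"
  show "continuous_on UNIV f"
    unfolding continuous_on_iff
  proof (intro ballI allI impI)
    fix x :: annulus and e :: real assume "0 < e"
    obtain p where p: "x = annulus_cover p"
      using surj_annulus_cover by (metis surjD)
    from c \<open>0 < e\<close> obtain d where d: "d > 0"
      "\<And>q. dist q p < d \<Longrightarrow> dist (f (annulus_cover q)) (f (annulus_cover p)) < e"
      unfolding continuous_on_iff o_def by (metis UNIV_I)
    show "\<exists>d>0. \<forall>x'\<in>UNIV. dist x' x < d \<longrightarrow> dist (f x') (f x) < e"
    proof (intro exI[of _ d] conjI ballI impI d(1))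
      fix y assume "dist y x < d"
      moreover obtain q where "annulus_cover q = y" "dist q p = dist y (annulus_cover p)"
        by (rule annulus_cover_lift_near)
      ultimately show "dist (f y) (f x) < e" using d(2)[of q] p by simp
    qed
  qed
qed

lemma compact_circle: "compact (UNIV :: circle set)"
proof -
  have "to_circle ` {0..1} = UNIV"
    by (auto intro: to_circle_lift_unit) (metis to_circle_lift_unit atLeastAtMost_iff imageI less_imp_le)
  then show ?thesis
    by (metis compact_continuous_image compact_Icc continuous_on_subset continuous_on_to_circle
        subset_UNIV)
qed

text \<open>Second countability makes the Borel sets of the annulus those of the product \<open>\<sigma>\<close>-algebra, on
  which the product measure lives.\<close>

instance circle :: second_countable_topology
proof
  let ?B = "(\<lambda>(q, r). ball (to_circle q) r) ` (\<rat> \<times> \<rat>) :: circle set set"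
  have "topological_basis ?B"
  proof (rule topological_basisI)
    show "open b" if "b \<in> ?B" for b using that by auto
  next
    fix U :: "circle set" and x assume "open U" "x \<in> U"
    then obtain e where e: "e > 0" "ball x e \<subseteq> U" using openE by blast
    obtain t where t: "x = to_circle t" using surj_to_circle by (metis surjD)
    obtain r where r: "r \<in> \<rat>" "0 < r" "r < e / 2"
      using Rats_dense_in_real[of 0 "e/2"] e by auto
    obtain q where q: "q \<in> \<rat>" "t - r < q" "q < t + r"
      using Rats_dense_in_real[of "t - r" "t + r"] r by auto
    have "dist (to_circle q) x < r"
      using dist_to_circle_le[of q t] q by (auto simp: t dist_real_def)
    moreover have "ball (to_circle q) r \<subseteq> ball x e"
    proof
      fix y assume "y \<in> ball (to_circle q) r"
      with \<open>dist (to_circle q) x < r\<close> r show "y \<in> ball x e"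
        using dist_triangle[of x y "to_circle q"] by (simp add: dist_commute)
    qed
    ultimately show "\<exists>b\<in>?B. x \<in> b \<and> b \<subseteq> U"
      using q r e by (intro bexI[of _ "ball (to_circle q) r"]) auto
  qed
  moreover have "countable ?B"
    by (intro countable_image countable_SIGMA countable_rat)
  ultimately show "\<exists>B::circle set set. countable B \<and> open = generate_topology B"
    by (metis topological_basis_imp_subbasis)
qed

section \<open>Calculus of smooth maps\<close>

lemma C_k_SucI:
  assumes "\<And>p. (f has_derivative f' p) (at p)" "\<And>v. C_k k (\<lambda>p. f' p v)"
  shows "C_k (Suc k) f"
  using assms by auto

lemma C_k_Suc_imp: "C_k (Suc k) f \<Longrightarrow> C_k k f"
proof (induction k arbitrary: f)
  case 0
  then show ?case
    by simp (meson continuous_at_imp_continuous_on has_derivative_continuous)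
next
  case (Suc k)
  from Suc.prems obtain f' where f': "\<And>p. (f has_derivative f' p) (at p)" "\<And>v. C_k (Suc k) (\<lambda>p. f' p v)"
    unfolding C_k.simps by blast
  show ?case
    by (rule C_k_SucI[OF f'(1)]) (use Suc.IH f'(2) in blast)
qed

lemma C_k_imp_continuous: "C_k k f \<Longrightarrow> continuous_on UNIV f"
  by (induction k) (simp, blast intro: C_k_Suc_imp)

lemma C_k_const: "C_k k (\<lambda>_. c)"
proof (induction k arbitrary: c)
  case (Suc k)
  show ?case by (rule C_k_SucI[of _ "\<lambda>_ _. 0"]) (auto simp: Suc)
qed auto

lemma C_k_bounded_linear: "bounded_linear f \<Longrightarrow> C_k k f"
proof (cases k)
  case (Suc m)
  assume "bounded_linear f"
  then show ?thesis
    unfolding Suc by (intro C_k_SucI[of f "\<lambda>_. f"] C_k_const bounded_linear_imp_has_derivative)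
qed (auto simp: linear_continuous_on)

lemma C_k_bounded_linear_compose:
  assumes "bounded_linear h" shows "C_k k f \<Longrightarrow> C_k k (\<lambda>x. h (f x))"
proof (induction k arbitrary: f)
  case 0
  then show ?case
    using bounded_linear.continuous_on[OF assms] by auto
next
  case (Suc k)
  from Suc.prems obtain f' where f': "\<And>p. (f has_derivative f' p) (at p)" "\<And>v. C_k k (\<lambda>p. f' p v)"
    unfolding C_k.simps by blast
  show ?case
    by (rule C_k_SucI[of _ "\<lambda>p v. h (f' p v)"])
       (auto intro: bounded_linear.has_derivative[OF assms] f' Suc.IH)
qed

lemma C_k_add: "C_k k f \<Longrightarrow> C_k k g \<Longrightarrow> C_k k (\<lambda>x. f x + g x)"
proof (induction k arbitrary: f g)
  case 0
  then show ?case by (auto intro: continuous_on_add)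
next
  case (Suc k)
  from Suc.prems obtain f' where f': "\<And>p. (f has_derivative f' p) (at p)" "\<And>v. C_k k (\<lambda>p. f' p v)"
    unfolding C_k.simps by blast
  from Suc.prems obtain g' where g': "\<And>p. (g has_derivative g' p) (at p)" "\<And>v. C_k k (\<lambda>p. g' p v)"
    unfolding C_k.simps by blast
  show ?case
    by (rule C_k_SucI[of _ "\<lambda>p v. f' p v + g' p v"])
       (auto intro: has_derivative_add f' g' Suc.IH)
qed

lemma C_k_bilinear:
  assumes "bounded_bilinear pr"
  shows "C_k k f \<Longrightarrow> C_k k g \<Longrightarrow> C_k k (\<lambda>x. pr (f x) (g x))"
proof (induction k arbitrary: f g)
  case 0
  then show ?case by (auto intro: bounded_bilinear.continuous_on[OF assms])
next
  case (Suc k)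
  from Suc.prems obtain f' where f': "\<And>p. (f has_derivative f' p) (at p)" "\<And>v. C_k k (\<lambda>p. f' p v)"
    unfolding C_k.simps by blast
  from Suc.prems obtain g' where g': "\<And>p. (g has_derivative g' p) (at p)" "\<And>v. C_k k (\<lambda>p. g' p v)"
    unfolding C_k.simps by blast
  show ?case
    by (rule C_k_SucI[of _ "\<lambda>p v. pr (f p) (g' p v) + pr (f' p v) (g p)"])
       (intro bounded_bilinear.FDERIV[OF assms] f' g' Suc.IH C_k_add
          C_k_Suc_imp[OF Suc.prems(1)] C_k_Suc_imp[OF Suc.prems(2)])+
qed

lemmas C_k_mult = C_k_bilinear[OF bounded_bilinear_mult]
lemmas C_k_scaleR = C_k_bilinear[OF bounded_bilinear_scaleR]
lemmas C_k_fst = C_k_bounded_linear_compose[OF bounded_linear_fst]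
lemmas C_k_snd = C_k_bounded_linear_compose[OF bounded_linear_snd]
lemmas C_k_minus = C_k_bounded_linear_compose[OF bounded_linear_minus[OF bounded_linear_ident]]
lemmas C_k_id = C_k_bounded_linear[OF bounded_linear_ident]

lemma C_k_diff: "C_k k f \<Longrightarrow> C_k k g \<Longrightarrow> C_k k (\<lambda>x. f x - g x)"
  using C_k_add[OF _ C_k_minus, of k f g] by simp

lemma C_k_sum: "(\<And>i. i \<in> I \<Longrightarrow> C_k k (f i)) \<Longrightarrow> C_k k (\<lambda>x. \<Sum>i\<in>I. f i x)"
  by (induction I rule: infinite_finite_induct) (auto intro: C_k_const C_k_add)

lemma C_k_power: "C_k k f \<Longrightarrow> C_k k (\<lambda>x. f x ^ n :: real)"
  by (induction n) (auto intro: C_k_const C_k_mult)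

lemma C_k_Pair: 
  fixes f :: "'a::euclidean_space \<Rightarrow> 'b::real_normed_vector" and g :: "'a \<Rightarrow> 'c::real_normed_vector"
  assumes "C_k k f" "C_k k g" shows "C_k k (\<lambda>x. (f x, g x))"
proof -
  have l: "bounded_linear (\<lambda>x::'b. (x, 0::'c))" "bounded_linear (\<lambda>x::'c. (0::'b, x))"
    by (intro bounded_linear_Pair bounded_linear_ident bounded_linear_zero)+
  have "C_k k (\<lambda>x. (f x, 0) + (0, g x))"
    by (intro C_k_add C_k_bounded_linear_compose[OF l(1)] C_k_bounded_linear_compose[OF l(2)] assms)
  then show ?thesis by simp
qed

lemma C_k_compose: 
  fixes f :: "'b::euclidean_space \<Rightarrow> 'c::real_normed_vector" and g :: "'a::euclidean_space \<Rightarrow> 'b"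
  shows "C_k k f \<Longrightarrow> C_k k g \<Longrightarrow> C_k k (\<lambda>x. f (g x))"
proof (induction k arbitrary: f)
  case 0
  then show ?case 
    by (auto intro: continuous_on_compose2)
next
  case (Suc k)
  from Suc.prems obtain f' where f': "\<And>p. (f has_derivative f' p) (at p)" "\<And>v. C_k k (\<lambda>p. f' p v)"
    unfolding C_k.simps by blast
  from Suc.prems obtain g' where g': "\<And>p. (g has_derivative g' p) (at p)" "\<And>v. C_k k (\<lambda>p. g' p v)"
    unfolding C_k.simps by blast
  have gk: "C_k k g" using Suc.prems C_k_Suc_imp by blast
  show ?case
  proof (rule C_k_SucI)
    show "((\<lambda>x. f (g x)) has_derivative (\<lambda>v. f' (g p) (g' p v))) (at p)" for p
      by (rule has_derivative_compose[OF g'(1) f'(1)])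
    have lin: "linear (f' q)" for q
      using f'(1) has_derivative_linear by blast
    have "f' (g p) (g' p v) = (\<Sum>b\<in>Basis. (g' p v \<bullet> b) *\<^sub>R f' (g p) b)" for p v
      using linear_sum[OF lin, of _ "\<lambda>b. (g' p v \<bullet> b) *\<^sub>R b" Basis]
      by (subst (1) euclidean_representation[symmetric, of "g' p v"]) (simp add: linear_cmul[OF lin])
    then show "C_k k (\<lambda>p. f' (g p) (g' p v))" for v
      using Suc.IH[OF f'(2) gk]
      by (auto intro!: C_k_sum C_k_scaleR C_k_bounded_linear_compose[OF bounded_linear_inner_left] g')
  qed
qed

lemma C_k_inverse:
  fixes f :: "'a::euclidean_space \<Rightarrow> real"
  assumes "\<And>x. f x \<noteq> 0"
  shows "C_k k f \<Longrightarrow> C_k k (\<lambda>x. inverse (f x))"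
proof (induction k)
  case 0
  then show ?case by (auto intro!: continuous_intros simp: assms)
next
  case (Suc k)
  from Suc.prems obtain f' where f': "\<And>p. (f has_derivative f' p) (at p)" "\<And>v. C_k k (\<lambda>p. f' p v)"
    unfolding C_k.simps by blast
  have i: "C_k k (\<lambda>x. inverse (f x))" using Suc C_k_Suc_imp by blast
  show ?case
    by (rule C_k_SucI[of _ "\<lambda>p v. - (inverse (f p) * f' p v * inverse (f p))"])
       (intro Deriv.has_derivative_inverse assms f' C_k_minus C_k_mult i)+
qed

lemma C_k_antiderivative:
  fixes f :: "real \<Rightarrow> real"
  assumes "\<And>x. (f has_real_derivative f' x) (at x)" "C_k k f'"
  shows "C_k (Suc k) f"
  by (rule C_k_SucI[of _ "\<lambda>p v. f' p * v"])
     (use assms in \<open>auto simp: has_field_derivative_def intro: C_k_mult C_k_const\<close>)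

lemma C_k_sin_cos: "C_k k (sin :: real \<Rightarrow> real) \<and> C_k k (cos :: real \<Rightarrow> real)"
proof (induction k)
  case 0
  then show ?case by (auto intro: continuous_intros)
next
  case (Suc k)
  show ?case
    using C_k_antiderivative[of sin cos k] C_k_antiderivative[of cos "\<lambda>x. - sin x" k] Suc
      C_k_minus[of k sin] DERIV_sin DERIV_cos by blast
qed

definition fibre_map :: "(real \<times> real \<Rightarrow> real) \<Rightarrow> real \<times> real \<Rightarrow> real \<times> real"
  where "fibre_map h p = (h p, snd p)"

text \<open>The derivative of the inverse \<open>g\<close> is the inverse of a triangular matrix with entries \<open>h1\<close> and
  \<open>h2\<close>, taken at \<open>g q\<close>. It is therefore as smooth as \<open>g\<close>, which makes \<open>g\<close> smoother by one degree.\<close>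

lemma fibre_map_inverse_smooth:
  fixes h :: "real \<times> real \<Rightarrow> real"
  assumes h: "\<And>p. (h has_derivative (\<lambda>v. h1 p * fst v + h2 p * snd v)) (at p)"
    and smooth: "\<And>k. C_k k h1" "\<And>k. C_k k h2"
    and pos: "\<And>p. h1 p > 0"
    and g: "\<And>p. g (fibre_map h p) = p" "\<And>p. fibre_map h (g p) = p"
  shows "C_k k g" "\<exists>g'. \<forall>p. (g has_derivative g' p) (at p)"
proof -
  define g' where "g' q v = ((fst v - h2 (g q) * snd v) * inverse (h1 (g q)), snd v)" for q v
  have cont: "continuous_on UNIV (fibre_map h)"
    unfolding fibre_map_def
    by (intro continuous_intros continuous_at_imp_continuous_on ballI has_derivative_continuous[OF h])
  have der: "(g has_derivative g' q) (at q)" for q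
  proof (rule has_derivative_inverse_strong_x[of UNIV g q "fibre_map h"])
    show "(fibre_map h has_derivative (\<lambda>v. (h1 (g q) * fst v + h2 (g q) * snd v, snd v))) (at (g q))"
      unfolding fibre_map_def by (intro has_derivative_Pair h has_derivative_snd has_derivative_ident)
    show "(\<lambda>v. (h1 (g q) * fst v + h2 (g q) * snd v, snd v)) \<circ> g' q = id"
      using pos[of "g q"] by (auto simp: g'_def fun_eq_iff field_simps)
  qed (use cont g in auto)
  then show "\<exists>g'. \<forall>p. (g has_derivative g' p) (at p)" by blast
  have ne: "h1 q \<noteq> 0" for q using pos[of q] by simp
  show "C_k k g"
  proof (induction k)
    case 0
    then show ?case
      using der by (auto intro!: continuous_at_imp_continuous_on has_derivative_continuous)
  next
    case (Suc k)
    show ?case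
      unfolding C_k.simps
    proof (intro exI[of _ g'] conjI allI der)
      show "C_k k (\<lambda>q. g' q v)" for v
        unfolding g'_def
        by (intro C_k_Pair C_k_mult C_k_diff C_k_const C_k_inverse
            C_k_compose[OF smooth(1) Suc] C_k_compose[OF smooth(2) Suc] ne)
    qed
  qed
qed

section \<open>Almost everywhere differentiability of biLipschitz functions\<close>

text \<open>Cover \<open>E\<close>, up to a null set, by disjoint intervals that \<open>f\<close> stretches by a factor less
  than \<open>p\<close> and that stay inside an open set of almost the same measure as \<open>E\<close>. Adding up the lengths
  of the images gives the estimate, as \<open>f\<close> maps the null set left over to a null set.\<close>

lemma emeasure_image_le_of_small_slopes:
  fixes f :: "real \<Rightarrow> real"
  assumes mono: "strict_mono f" and lip: "\<And>x y. \<bar>f x - f y\<bar> \<le> L * \<bar>x - y\<bar>" and p: "p > 0"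
    and E: "E \<in> sets lebesgue"
    and slope: "\<And>x \<delta>. x \<in> E \<Longrightarrow> \<delta> > 0 \<Longrightarrow> \<exists>y. 0 < \<bar>y - x\<bar> \<and> \<bar>y - x\<bar> < \<delta> \<and> (f y - f x) / (y - x) < p"
  shows "emeasure lebesgue (f ` E) \<le> ennreal p * emeasure lebesgue E"
proof (rule ennreal_le_epsilon)
  fix e :: real assume "0 < e"
  then have "0 < e / p" using p by simp
  then obtain T where T: "open T" "E \<subseteq> T" "emeasure lebesgue (T - E) < ennreal (e / p)"
    using sets_lebesgue_outer_open[OF E] by metis
  define K where "K = {(x, y). x < y \<and> {x..y} \<subseteq> T \<and> f y - f x < p * (y - x)}"
  let ?a = "\<lambda>(x, y). (x + y) / 2 :: real" and ?r = "\<lambda>(x, y). (y - x) / 2 :: real"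
  have ball: "cball ((x + y) / 2) ((y - x) / 2) = {x..y}" for x y :: real
    by (auto simp: cball_def dist_real_def abs_le_iff field_simps)
  obtain C where C: "countable C" "C \<subseteq> K"
     "pairwise (\<lambda>i j. disjnt (cball (?a i) (?r i)) (cball (?a j) (?r j))) C"
     "negligible (E - (\<Union>i\<in>C. cball (?a i) (?r i)))"
  proof (rule Vitali_covering_theorem_cballs[of K ?r E ?a])
    show "0 < ?r i" if "i \<in> K" for i using that by (auto simp: K_def)
    fix x d :: real assume x: "x \<in> E" "0 < d"
    obtain \<epsilon> where \<epsilon>: "\<epsilon> > 0" "ball x \<epsilon> \<subseteq> T" using T x openE by blast
    obtain y where y: "0 < \<bar>y - x\<bar>" "\<bar>y - x\<bar> < min d \<epsilon>" "(f y - f x) / (y - x) < p"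
      using slope[OF x(1), of "min d \<epsilon>"] \<epsilon> x by auto
    have "(min x y, max x y) \<in> K"
    proof -
      have "{min x y..max x y} \<subseteq> ball x \<epsilon>"
        using y by (auto simp: dist_real_def min_def max_def split: if_splits)
      moreover have "f (max x y) - f (min x y) < p * (max x y - min x y)"
        using y(1,3) by (cases "x < y") (auto simp: field_simps min_def max_def split: if_splits)
      moreover have "min x y < max x y" using y(1) by (auto simp: min_def max_def)
      ultimately show ?thesis using \<epsilon> unfolding K_def by auto
    qed
    then show "\<exists>i. i \<in> K \<and> x \<in> cball (?a i) (?r i) \<and> ?r i < d"
      using y(1,2) x(2)
      by (intro exI[of _ "(min x y, max x y)"])
        (auto simp: ball min_def max_def abs_if split: if_splits)
  qed
  define I where "I = (\<lambda>(x, y). {x..y} :: real set)"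
  define J where "J = (\<lambda>(x, y). {f x..f y} :: real set)"
  have CI: "(\<Union>i\<in>C. cball (?a i) (?r i)) = (\<Union>i\<in>C. I i)"
    by (intro SUP_cong) (auto simp: I_def ball split: prod.splits)
  have dI: "disjoint_family_on I C"
  proof -
    have "cball (?a i) (?r i) = I i" for i by (auto simp: I_def ball split: prod.splits)
    then show ?thesis using C(3) unfolding disjoint_family_on_def pairwise_def disjnt_def by simp
  qed
  have fle: "f x \<le> f y \<longleftrightarrow> x \<le> y" for x y using mono strict_mono_less_eq by blast
  have cf: "continuous_on UNIV f"
  proof (rule lipschitz_on_continuous_on)
    show "(max L 0)-lipschitz_on UNIV f"
      by (rule lipschitz_onI)
        (auto simp: dist_real_def intro!: order_trans[OF lip] mult_right_mono)
  qed
  have JI: "J i = f ` I i" if "i \<in> C" for i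
  proof -
    obtain x y where i: "i = (x, y)" by fastforce
    have "x < y" using that C(2) i by (auto simp: K_def)
    have "f ` {x..y} = {f x..f y}"
    proof
      show "f ` {x..y} \<subseteq> {f x..f y}" by (auto simp: fle)
      show "{f x..f y} \<subseteq> f ` {x..y}"
      proof
        fix z assume "z \<in> {f x..f y}"
        then show "z \<in> f ` {x..y}"
          using IVT'[of f x z y] \<open>x < y\<close> continuous_on_subset[OF cf] by auto
      qed
    qed
    then show ?thesis by (simp add: i I_def J_def)
  qed
  have inj: "inj f" using mono strict_mono_imp_inj_on by blast
  have dJ: "disjoint_family_on J C"
    using dI JI inj unfolding disjoint_family_on_def
    by (metis image_Int image_empty)
  let ?N = "f ` (E - (\<Union>i\<in>C. I i))"
  have N: "?N \<in> null_sets lebesgue"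
    unfolding negligible_iff_null_sets[symmetric]
    by (rule negligible_locally_Lipschitz_image)
       (use C(4) lip in \<open>auto simp: CI intro!: exI[of _ UNIV] exI[of _ L]\<close>)
  have sI: "I i \<in> sets lebesgue" "J i \<in> sets lebesgue" for i
    by (auto simp: I_def J_def split: prod.splits)
  have UJ: "(\<Union>i\<in>C. J i) \<in> sets lebesgue" and UI: "(\<Union>i\<in>C. I i) \<in> sets lebesgue"
    by (intro sets.countable_UN'' C(1) sI)+
  have "f ` E \<subseteq> ?N \<union> f ` (\<Union>i\<in>C. I i)" by blast
  also have "f ` (\<Union>i\<in>C. I i) = (\<Union>i\<in>C. J i)" using JI by (simp add: image_UN)
  finally have "f ` E \<subseteq> ?N \<union> (\<Union>i\<in>C. J i)" .
  then have "emeasure lebesgue (f ` E) \<le> emeasure lebesgue (?N \<union> (\<Union>i\<in>C. J i))"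
    by (intro emeasure_mono) (use N UJ in auto)
  also have "\<dots> = emeasure lebesgue (\<Union>i\<in>C. J i)"
    by (simp add: emeasure_Un_null_set Un_commute N UJ)
  also have "\<dots> = (\<integral>\<^sup>+i. emeasure lebesgue (J i) \<partial>count_space C)"
    by (rule emeasure_UN_countable[OF sI(2) C(1) dJ])
  also have "\<dots> \<le> (\<integral>\<^sup>+i. ennreal p * emeasure lebesgue (I i) \<partial>count_space C)"
  proof (rule nn_integral_mono)
    fix i assume "i \<in> space (count_space C)"
    moreover obtain x y where xy: "i = (x, y)" by fastforce
    ultimately have "(x, y) \<in> K" using C(2) by auto
    with xy have i: "i = (x, y)" "x < y" "f y - f x < p * (y - x)" by (auto simp: K_def)
    have "f x \<le> f y" using i fle by simp
    then show "emeasure lebesgue (J i) \<le> ennreal p * emeasure lebesgue (I i)"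
      using i p by (simp add: I_def J_def ennreal_mult'[symmetric] ennreal_leI)
  qed
  also have "\<dots> = ennreal p * (\<integral>\<^sup>+i. emeasure lebesgue (I i) \<partial>count_space C)"
    by (rule nn_integral_cmult) simp
  also have "\<dots> = ennreal p * emeasure lebesgue (\<Union>i\<in>C. I i)"
    by (subst emeasure_UN_countable[OF sI(1) C(1) dI]) simp
  also have "\<dots> \<le> ennreal p * emeasure lebesgue T"
    by (intro mult_left_mono emeasure_mono) (use C(2) T in \<open>auto simp: K_def I_def\<close>)
  also have "emeasure lebesgue T = emeasure lebesgue E + emeasure lebesgue (T - E)"
  proof -
    have "T - E \<in> sets lebesgue" using E T(1) by auto
    then have "emeasure lebesgue E + emeasure lebesgue (T - E) = emeasure lebesgue (E \<union> (T - E))"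
      by (intro plus_emeasure E) auto
    then show ?thesis using T(2) by (metis Un_Diff_cancel Un_absorb1)
  qed
  also have "\<dots> \<le> emeasure lebesgue E + ennreal (e / p)"
    using T(3) by (intro add_left_mono) simp
  also have "ennreal p * \<dots> = ennreal p * emeasure lebesgue E + ennreal e"
    using p \<open>0 < e\<close> by (simp add: distrib_left ennreal_mult'[symmetric])
  finally show "emeasure lebesgue (f ` E) \<le> ennreal p * emeasure lebesgue E + ennreal e"
    by (simp add: mult_left_mono)
qed

text \<open>Only rational increments are used, which keeps the predicates measurable.\<close>

definition lower_slopes_below :: "(real \<Rightarrow> real) \<Rightarrow> real \<Rightarrow> real \<Rightarrow> bool"
  where "lower_slopes_below f p x \<longleftrightarrow>
    (\<forall>n::nat. \<exists>h\<in>\<rat>. 0 < \<bar>h\<bar> \<and> \<bar>h\<bar> < 1 / real (Suc n) \<and> (f (x + h) - f x) / h < p)"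

definition upper_slopes_above :: "(real \<Rightarrow> real) \<Rightarrow> real \<Rightarrow> real \<Rightarrow> bool"
  where "upper_slopes_above f q x \<longleftrightarrow>
    (\<forall>n::nat. \<exists>h\<in>\<rat>. 0 < \<bar>h\<bar> \<and> \<bar>h\<bar> < 1 / real (Suc n) \<and> (f (x + h) - f x) / h > q)"

lemma upper_slopes_above_iff: "upper_slopes_above f q x \<longleftrightarrow> lower_slopes_below (\<lambda>x. - f x) (- q) x"
  unfolding upper_slopes_above_def lower_slopes_below_def
proof -
  have "q < (f (x + h) - f x) / h \<longleftrightarrow> (- f (x + h) - - f x) / h < - q" for h
    using minus_divide_left[of "f (x + h) - f x" h] by (smt (verit))
  then show "(\<forall>n. \<exists>h\<in>\<rat>. 0 < \<bar>h\<bar> \<and> \<bar>h\<bar> < 1 / real (Suc n) \<and> q < (f (x + h) - f x) / h) =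
    (\<forall>n. \<exists>h\<in>\<rat>. 0 < \<bar>h\<bar> \<and> \<bar>h\<bar> < 1 / real (Suc n) \<and> (- f (x + h) - - f x) / h < - q)"
    by simp
qed

lemma lower_slopes_belowI:
  assumes cont: "continuous_on UNIV f"
    and "\<And>\<delta>. \<delta> > 0 \<Longrightarrow> \<exists>h. 0 < \<bar>h\<bar> \<and> \<bar>h\<bar> < \<delta> \<and> (f (x + h) - f x) / h < p"
  shows "lower_slopes_below f p x"
  unfolding lower_slopes_below_def
proof
  fix n :: nat
  obtain h where h: "0 < \<bar>h\<bar>" "\<bar>h\<bar> < 1 / real (Suc n)" "(f (x + h) - f x) / h < p"
    using assms(2)[of "1 / real (Suc n)"] by auto
  have c: "isCont (\<lambda>h. f (x + h)) h"
    by (rule continuous_on_interior[of UNIV])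
      (auto intro!: continuous_on_compose2[OF cont] continuous_intros)
  have "((\<lambda>h. f (x + h)) \<longlongrightarrow> f (x + h)) (nhds h)"
    using c unfolding isCont_def by (subst (asm) tendsto_at_iff_tendsto_nhds)
  then have "((\<lambda>h. (f (x + h) - f x) / h) \<longlongrightarrow> (f (x + h) - f x) / h) (nhds h)"
    using h(1) by (intro tendsto_intros) (auto simp: filterlim_ident)
  then have "\<forall>\<^sub>F k in nhds h. (f (x + k) - f x) / k < p"
    using h(3) order_tendstoD(2) by blast
  moreover have "\<forall>\<^sub>F k in nhds h. 0 < \<bar>k\<bar>" "\<forall>\<^sub>F k in nhds h. \<bar>k\<bar> < 1 / real (Suc n)"
    by (rule order_tendstoD[where y = "\<bar>h\<bar>"]; use h in \<open>auto intro!: tendsto_intros simp: filterlim_ident\<close>)+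
  ultimately have "\<forall>\<^sub>F k in nhds h. 0 < \<bar>k\<bar> \<and> \<bar>k\<bar> < 1 / real (Suc n) \<and> (f (x + k) - f x) / k < p"
    by eventually_elim auto
  then obtain d where d: "d > 0"
    "\<And>k. dist k h < d \<Longrightarrow> 0 < \<bar>k\<bar> \<and> \<bar>k\<bar> < 1 / real (Suc n) \<and> (f (x + k) - f x) / k < p"
    unfolding eventually_nhds_metric by blast
  obtain k where "k \<in> \<rat>" "h < k" "k < h + d"
    using Rats_dense_in_real[of h "h + d"] d(1) by auto
  then show "\<exists>h\<in>\<rat>. 0 < \<bar>h\<bar> \<and> \<bar>h\<bar> < 1 / real (Suc n) \<and> (f (x + h) - f x) / h < p"
    using d(2)[of k] by (auto simp: dist_real_def)
qed

lemma upper_slopes_aboveI: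
  assumes cont: "continuous_on UNIV f"
    and "\<And>\<delta>. \<delta> > 0 \<Longrightarrow> \<exists>h. 0 < \<bar>h\<bar> \<and> \<bar>h\<bar> < \<delta> \<and> (f (x + h) - f x) / h > q"
  shows "upper_slopes_above f q x"
  unfolding upper_slopes_above_iff
proof (rule lower_slopes_belowI)
  fix \<delta> :: real assume "\<delta> > 0"
  then obtain h where "0 < \<bar>h\<bar> \<and> \<bar>h\<bar> < \<delta> \<and> (f (x + h) - f x) / h > q"
    using assms(2) by blast
  then show "\<exists>h. 0 < \<bar>h\<bar> \<and> \<bar>h\<bar> < \<delta> \<and> (- f (x + h) - - f x) / h < - q"
    using minus_divide_left[of "f (x + h) - f x" h] by (intro exI[of _ h]) (smt (verit))
qed (intro continuous_intros cont)

lemma lower_slopes_belowD: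
  assumes "lower_slopes_below f p x" "\<delta> > 0"
  shows "\<exists>h. 0 < \<bar>h\<bar> \<and> \<bar>h\<bar> < \<delta> \<and> (f (x + h) - f x) / h < p"
proof -
  obtain n where "1 / real (Suc n) < \<delta>" 
    using \<open>\<delta> > 0\<close> nat_approx_posE by metis
  then show ?thesis using assms unfolding lower_slopes_below_def by (meson less_trans)
qed

lemma upper_slopes_aboveD:
  assumes "upper_slopes_above f q x" "\<delta> > 0"
  shows "\<exists>h. 0 < \<bar>h\<bar> \<and> \<bar>h\<bar> < \<delta> \<and> (f (x + h) - f x) / h > q"
proof -
  obtain n where "1 / real (Suc n) < \<delta>" 
    using \<open>\<delta> > 0\<close> nat_approx_posE by metis
  then show ?thesis using assms unfolding upper_slopes_above_def by (meson less_trans)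
qed

definition oscillating_slopes :: "(real \<Rightarrow> real) \<Rightarrow> real \<Rightarrow> bool"
  where "oscillating_slopes f x \<longleftrightarrow>
    (\<exists>p\<in>\<rat>. \<exists>q\<in>\<rat>. 0 < p \<and> p < q \<and> lower_slopes_below f p x \<and> upper_slopes_above f q x)"

text \<open>The derivative is the lower limit of the difference quotients. If they exceeded it by a fixed
  amount at all small scales, rationals \<open>p < q\<close> in the gap would witness oscillation; the lower
  limit is at least \<open>a\<close>, so these rationals are positive.\<close>

lemma differentiable_if_not_oscillating:
  fixes f :: "real \<Rightarrow> real"
  assumes cont: "continuous_on UNIV f" and a: "0 < a"
    and lo: "\<And>x y. x < y \<Longrightarrow> a * (y - x) \<le> f y - f x"
    and up: "\<And>x y. x < y \<Longrightarrow> f y - f x \<le> b * (y - x)"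
    and no: "\<not> oscillating_slopes f x"
  shows "\<exists>d. (f has_real_derivative d) (at x) \<and> a \<le> d \<and> d \<le> b"
proof -
  define s where "s h = (f (x + h) - f x) / h" for h
  have s: "a \<le> s h \<and> s h \<le> b" if "h \<noteq> 0" for h
    using lo[of x "x + h"] lo[of "x + h" x] up[of x "x + h"] up[of "x + h" x] that
    by (cases "h > 0") (auto simp: s_def field_simps)
  define A where "A = {r. \<exists>\<delta>>0. \<forall>h. 0 < \<bar>h\<bar> \<and> \<bar>h\<bar> < \<delta> \<longrightarrow> r \<le> s h}"
  have aA: "a \<in> A" unfolding A_def using s by (auto intro!: exI[of _ 1])
  have Ab: "r \<le> b" if rA: "r \<in> A" for r
  proof -
    obtain \<delta> where "\<delta> > 0" "\<forall>h. 0 < \<bar>h\<bar> \<and> \<bar>h\<bar> < \<delta> \<longrightarrow> r \<le> s h" using rA by (auto simp: A_def)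
    then have "r \<le> s (\<delta> / 2)" by auto
    then show ?thesis using s[of "\<delta> / 2"] \<open>\<delta> > 0\<close> by simp
  qed
  have bdd: "bdd_above A" using Ab by (rule bdd_aboveI)
  define l where "l = Sup A"
  have "a \<le> l" using aA bdd by (auto simp: l_def intro: cSup_upper)
  have "l \<le> b" unfolding l_def using aA Ab by (intro cSup_least) auto
  have low: "\<forall>\<^sub>F h in at 0. r < s h" if r: "r < l" for r
  proof -
    obtain r' where r': "r' \<in> A" "r < r'" using r aA less_cSupD[of A r] unfolding l_def by blast
    then obtain \<delta> where "\<delta> > 0" "\<And>h. 0 < \<bar>h\<bar> \<Longrightarrow> \<bar>h\<bar> < \<delta> \<Longrightarrow> r' \<le> s h" by (auto simp: A_def)
    then show ?thesis
      unfolding eventually_at using r'(2) by (intro exI[of _ \<delta>]) (auto simp: dist_real_def intro: less_le_trans)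
  qed
  have up: "\<forall>\<^sub>F h in at 0. s h < r" if r: "l < r" for r
  proof (rule ccontr)
    assume neg: "\<not> (\<forall>\<^sub>F h in at 0. s h < r)"
    obtain p where p: "p \<in> \<rat>" "l < p" "p < r" using Rats_dense_in_real[OF r] by auto
    obtain q where q: "q \<in> \<rat>" "p < q" "q < r" using Rats_dense_in_real[OF p(3)] by auto
    have "p \<notin> A" using p(2) cSup_upper[OF _ bdd] by (force simp: l_def)
    then have "lower_slopes_below f p x"
      by (intro lower_slopes_belowI cont) (auto simp: A_def s_def not_le)
    moreover have "upper_slopes_above f q x"
    proof (intro upper_slopes_aboveI cont)
      fix \<delta> :: real assume "\<delta> > 0"
      then obtain h where "h \<noteq> 0" "dist h 0 < \<delta>" "\<not> s h < r"
        using neg unfolding eventually_at by blast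
      then show "\<exists>h. 0 < \<bar>h\<bar> \<and> \<bar>h\<bar> < \<delta> \<and> q < (f (x + h) - f x) / h"
        using q by (intro exI[of _ h]) (auto simp: s_def)
    qed
    moreover have "0 < p" using a \<open>a \<le> l\<close> p by simp
    ultimately have "oscillating_slopes f x"
      unfolding oscillating_slopes_def by (intro bexI[of _ p] bexI[of _ q] conjI p q)
    then show False using no by contradiction
  qed
  have "(s \<longlongrightarrow> l) (at 0)" by (intro order_tendstoI low up)
  then have "(f has_real_derivative l) (at x)" by (simp add: DERIV_def s_def[abs_def])
  then show ?thesis using \<open>a \<le> l\<close> \<open>l \<le> b\<close> by blast
qed

text \<open>On the set where \<open>f\<close> has slopes below \<open>p\<close> and slopes above \<open>q\<close> at all small scales, \<open>f\<close>
  multiplies the measure by at most \<open>p\<close>, and its inverse by at most \<open>1 / q\<close>. As \<open>p < q\<close>, the set is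
  null.\<close>

lemma oscillating_slopes_negligible:
  fixes f :: "real \<Rightarrow> real"
  assumes a: "0 < a"
    and lo: "\<And>x y. x < y \<Longrightarrow> a * (y - x) \<le> f y - f x"
    and up: "\<And>x y. x < y \<Longrightarrow> f y - f x \<le> b * (y - x)"
  shows "negligible {x. oscillating_slopes f x}"
proof -
  have "a \<le> b" using lo[of 0 1] up[of 0 1] by simp
  have mono: "strict_mono f"
    using lo a by (intro strict_monoI) (smt (verit) mult_pos_pos)
  have lipf: "\<bar>f x - f y\<bar> \<le> b * \<bar>x - y\<bar>" for x y
    using up[of x y] up[of y x] strict_mono_less[OF mono, of x y] strict_mono_less[OF mono, of y x]
    by (cases x y rule: linorder_cases) auto
  have lipg: "a * \<bar>x - y\<bar> \<le> \<bar>f x - f y\<bar>" for x y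
    using lo[of x y] lo[of y x] strict_mono_less[OF mono, of x y] strict_mono_less[OF mono, of y x]
    by (cases x y rule: linorder_cases) auto
  have cf: "continuous_on UNIV f"
  proof (rule lipschitz_on_continuous_on)
    show "b-lipschitz_on UNIV f"
      by (rule lipschitz_onI) (use lipf a \<open>a \<le> b\<close> in \<open>auto simp: dist_real_def\<close>)
  qed
  have surj: "\<exists>x. f x = y" for y
  proof -
    define M where "M = \<bar>y - f 0\<bar> / a + 1"
    have M: "M > 0" "a * M \<ge> \<bar>y - f 0\<bar>" using a by (auto simp: M_def field_simps add_pos_nonneg)
    have "f (- M) \<le> y" "y \<le> f M"
      using lo[of 0 M] lo[of "- M" 0] M by auto
    then show ?thesis
      using IVT'[of f "- M" y M] M continuous_on_subset[OF cf] by auto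
  qed
  define g where "g = inv f"
  have inj: "inj f" using mono strict_mono_imp_inj_on by blast
  have gf: "g (f x) = x" for x by (simp add: g_def inj)
  have fg: "f (g y) = y" for y using surj[of y] by (auto simp: g_def f_inv_into_f)
  have monog: "strict_mono g"
    using mono fg by (intro strict_monoI) (metis not_less_iff_gr_or_eq strict_mono_less)
  have lg: "\<bar>g x - g y\<bar> \<le> (1 / a) * \<bar>x - y\<bar>" for x y
    using lipg[of "g x" "g y"] a by (simp add: fg field_simps)
  have cg: "continuous_on UNIV g"
  proof (rule lipschitz_on_continuous_on)
    show "(1/a)-lipschitz_on UNIV g"
      by (rule lipschitz_onI) (use lg a in \<open>auto simp: dist_real_def\<close>)
  qed
  have fim: "f ` E = g -` E" for E using fg gf by (auto simp: image_iff) metis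
  have null: "negligible ({x. lower_slopes_below f p x \<and> upper_slopes_above f q x} \<inter> {-real n..real n})"
    (is "negligible ?E") if pq: "0 < p" "p < q" for p q n
  proof -
    have [measurable]: "f \<in> borel_measurable borel" using cf by (rule borel_measurable_continuous_onI)
    have gm: "g \<in> borel_measurable borel" using cg by (rule borel_measurable_continuous_onI)
    have E: "?E \<in> sets borel"
      unfolding lower_slopes_below_def upper_slopes_above_def
      using countable_rat by measurable
    have fE: "f ` ?E \<in> sets borel"
      unfolding fim using measurable_sets[OF gm E] by simp
    have 1: "emeasure lebesgue (f ` ?E) \<le> ennreal p * emeasure lebesgue ?E"
    proof (rule emeasure_image_le_of_small_slopes[OF mono lipf \<open>0 < p\<close>])
      fix x \<delta> :: real assume "x \<in> ?E" "0 < \<delta>"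
      then obtain h where "0 < \<bar>h\<bar> \<and> \<bar>h\<bar> < \<delta> \<and> (f (x + h) - f x) / h < p"
        using lower_slopes_belowD by blast
      then show "\<exists>y. 0 < \<bar>y - x\<bar> \<and> \<bar>y - x\<bar> < \<delta> \<and> (f y - f x) / (y - x) < p"
        by (intro exI[of _ "x + h"]) auto
    qed (use E in auto)
    have "emeasure lebesgue (g ` f ` ?E) \<le> ennreal (1 / q) * emeasure lebesgue (f ` ?E)"
    proof (rule emeasure_image_le_of_small_slopes[OF monog lg])
      fix z \<delta> :: real assume "z \<in> f ` ?E" "0 < \<delta>"
      then obtain x where x: "z = f x" "x \<in> ?E" by auto
      have "0 < \<delta> / b" "upper_slopes_above f q x" using x \<open>0 < \<delta>\<close> a \<open>a \<le> b\<close> by auto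
      then obtain h where h: "0 < \<bar>h\<bar>" "\<bar>h\<bar> < \<delta> / b" "(f (x + h) - f x) / h > q"
        using upper_slopes_aboveD by blast
      have "\<bar>f (x + h) - f x\<bar> < \<delta>"
      proof -
        have "b * \<bar>h\<bar> < \<delta>"
          using h(2) a \<open>a \<le> b\<close> by (metis less_le_trans mult.commute pos_less_divide_eq)
        then show ?thesis using lipf[of "x + h" x] by simp
      qed
      moreover have "f (x + h) \<noteq> f x" using h(1) injD[OF inj, of "x + h" x] by auto
      moreover have "h / (f (x + h) - f x) < 1 / q"
      proof -
        have "0 < q" using pq by linarith
        then have "inverse ((f (x + h) - f x) / h) < inverse q"
          by (rule less_imp_inverse_less[OF h(3)])
        also have "inverse ((f (x + h) - f x) / h) = h / (f (x + h) - f x)"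
          by (rule inverse_divide)
        finally show ?thesis by (simp only: inverse_eq_divide)
      qed
      ultimately show "\<exists>y. 0 < \<bar>y - z\<bar> \<and> \<bar>y - z\<bar> < \<delta> \<and> (g y - g z) / (y - z) < 1 / q"
        using gf by (intro exI[of _ "f (x + h)"]) (auto simp: x(1))
    qed (use fE pq in auto)
    also have "g ` f ` ?E = ?E" by (simp add: image_image gf)
    finally have 2: "emeasure lebesgue ?E \<le> ennreal (1 / q) * emeasure lebesgue (f ` ?E)" .
    have "emeasure lebesgue ?E \<le> emeasure lebesgue {-real n..real n}"
      by (intro emeasure_mono) auto
    also have "\<dots> = ennreal (2 * real n)"
      by (simp add: emeasure_completion)
    finally have fin: "emeasure lebesgue ?E < \<infinity>"
      by (simp add: le_less_trans)
    define m where "m = measure lebesgue ?E"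
    have m: "emeasure lebesgue ?E = ennreal m" "m \<ge> 0"
      using fin by (auto simp: m_def emeasure_eq_ennreal_measure)
    have "ennreal m \<le> ennreal (1 / q) * (ennreal p * ennreal m)"
      using 2 1 m by (metis mult_left_mono order_trans zero_le)
    also have "\<dots> = ennreal (p / q * m)"
      using pq m by (simp add: ennreal_mult'[symmetric])
    finally have "m \<le> p / q * m" using pq m by (subst (asm) ennreal_le_iff) auto
    moreover have "p / q < 1" using pq by simp
    ultimately have "m = 0" using m(2) by (smt (verit) mult_less_cancel_right2)
    then show ?thesis using m E by (simp add: negligible_iff_emeasure0)
  qed
  define Q where "Q = {(p, q). p \<in> \<rat> \<and> q \<in> \<rat> \<and> 0 < p \<and> p < (q::real)}"
  have "countable Q"
    by (rule countable_subset[of _ "\<rat> \<times> \<rat>"]) (auto simp: Q_def countable_rat)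
  then have "(\<Union>i\<in>Q. \<Union>n::nat. {x. lower_slopes_below f (fst i) x \<and> upper_slopes_above f (snd i) x}
      \<inter> {-real n..real n}) \<in> null_sets lebesgue" (is "?U \<in> _")
    using null by (intro null_sets_UN' null_sets_UN) (auto simp: Q_def negligible_iff_null_sets[symmetric])
  then have "negligible ?U" by (simp add: negligible_iff_null_sets)
  moreover have "{x. oscillating_slopes f x} \<subseteq> ?U"
  proof
    fix x assume "x \<in> {x. oscillating_slopes f x}"
    then obtain p q where pq: "p \<in> \<rat>" "q \<in> \<rat>" "0 < p" "p < q" "lower_slopes_below f p x" "upper_slopes_above f q x"
      by (auto simp: oscillating_slopes_def)
    obtain n :: nat where "\<bar>x\<bar> \<le> real n" using real_arch_simple by blast
    then have "x \<in> {-real n..real n}" by auto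
    moreover have "(p, q) \<in> Q" using pq by (simp add: Q_def)
    ultimately show "x \<in> ?U" using pq by fastforce
  qed
  ultimately show ?thesis using negligible_subset by blast
qed

text \<open>Were \<open>f\<close> to grow too slowly, \<open>f x - k' x\<close> would decrease somewhere for some \<open>k' < k\<close> and so take
  a whole interval of values for a last time. The values taken on the null set \<open>N\<close> do not exhaust
  the interval, and at a last point outside \<open>N\<close> the derivative cannot be positive.\<close>

lemma slope_ge_of_ae_derivative_ge:
  fixes f :: "real \<Rightarrow> real"
  assumes N: "negligible N" and st: "s \<le> t"
    and lip: "\<And>x y. x \<in> {s..t} \<Longrightarrow> y \<in> {s..t} \<Longrightarrow> \<bar>f x - f y\<bar> \<le> L * \<bar>x - y\<bar>"
    and der: "\<And>x. x \<in> {s..<t} \<Longrightarrow> x \<notin> N \<Longrightarrow> \<exists>d\<ge>k. (f has_real_derivative d) (at x)"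
  shows "k * (t - s) \<le> f t - f s"
proof -
  have main: "k' * (t - s) \<le> f t - f s" if k': "k' < k" for k'
  proof (rule ccontr)
    assume neg: "\<not> ?thesis"
    define g where "g x = f x - k' * x" for x
    have gts: "g t < g s" using neg by (simp add: g_def algebra_simps)
    have lipg: "\<bar>g x - g y\<bar> \<le> (L + \<bar>k'\<bar>) * \<bar>x - y\<bar>" if "x \<in> {s..t}" "y \<in> {s..t}" for x y
    proof -
      have "g x - g y = (f x - f y) - k' * (x - y)" by (simp add: g_def algebra_simps)
      then have "\<bar>g x - g y\<bar> \<le> \<bar>f x - f y\<bar> + \<bar>k' * (x - y)\<bar>" by linarith
      then show ?thesis using lip[OF that] by (simp add: abs_mult distrib_right)
    qed
    have cg: "continuous_on {s..t} g"
    proof (rule lipschitz_on_continuous_on)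
      show "(max 0 (L + \<bar>k'\<bar>))-lipschitz_on {s..t} g"
        by (rule lipschitz_onI)
          (auto simp: dist_real_def intro!: order_trans[OF lipg] mult_right_mono)
    qed
    have "negligible (g ` (N \<inter> {s..t}))"
      by (rule negligible_locally_Lipschitz_image)
         (use lipg N in \<open>auto intro!: exI[of _ UNIV] exI[of _ "L + \<bar>k'\<bar>"] negligible_Int\<close>)
    moreover have "\<not> negligible {g t..g s}"
      using gts by (simp add: negligible_interval(1)[of "g t" "g s", unfolded cbox_interval])
    ultimately have "\<not> {g t..g s} \<subseteq> g ` (N \<inter> {s..t}) \<union> {g t, g s}"
      by (meson negligible_Un negligible_subset negligible_finite finite.emptyI finite.insertI)
    then obtain y where "y \<in> {g t..g s}" "y \<notin> g ` (N \<inter> {s..t}) \<union> {g t, g s}"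
      by blast
    then have y: "g t < y" "y < g s" "y \<notin> g ` (N \<inter> {s..t})"
      by (simp_all add: less_le)
    define S where "S = {x \<in> {s..t}. y \<le> g x}"
    have "S = {s..t} \<inter> g -` {y..}" by (auto simp: S_def)
    then have "compact S"
      unfolding compact_eq_bounded_closed
      by (auto intro!: continuous_closed_preimage cg bounded_Int)
    moreover have "S \<noteq> {}" using y st by (auto simp: S_def)
    ultimately obtain x where x: "x \<in> S" "\<And>z. z \<in> S \<Longrightarrow> z \<le> x"
      by (metis compact_attains_sup)
    have "x < t" using x(1) y(1) by (auto simp: S_def less_le)
    have "g x = y"
    proof (rule ccontr)
      assume "g x \<noteq> y"
      then have "y < g x" using x(1) by (simp add: S_def)
      have "continuous_on {x..t} g"
        using continuous_on_subset[OF cg, of "{x..t}"] x(1) by (simp add: S_def)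
      with \<open>y < g x\<close> obtain z where "x \<le> z" "z \<le> t" "g z = y"
        using IVT2'[of g t y x] y(1) \<open>x < t\<close> by auto
      then have "z \<in> S" using x(1) by (auto simp: S_def)
      then have "z = x" using x(2) \<open>x \<le> z\<close> by fastforce
      then show False using \<open>g z = y\<close> \<open>g x \<noteq> y\<close> by simp
    qed
    then have "x \<notin> N" using y(3) x(1) by (auto simp: S_def)
    then obtain d where d: "d \<ge> k" "(f has_real_derivative d) (at x)"
      using der[of x] x(1) \<open>x < t\<close> by (auto simp: S_def)
    have "(g has_real_derivative (d - k')) (at x)"
      unfolding g_def by (auto intro!: derivative_eq_intros d(2))
    from DERIV_pos_inc_right[OF this] d(1) k'
    obtain e where e: "e > 0" "\<And>h. h > 0 \<Longrightarrow> h < e \<Longrightarrow> g x < g (x + h)" by auto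
    define h where "h = min (e / 2) (t - x)"
    have h: "0 < h" "h < e" "x + h \<le> t" using e(1) \<open>x < t\<close> by (auto simp: h_def)
    then have "x + h \<in> S" using e(2)[OF h(1,2)] \<open>g x = y\<close> x(1) by (auto simp: S_def)
    then show False using x(2) h(1) by fastforce
  qed
  show ?thesis
  proof (cases "s = t")
    case False
    then have "s < t" using st by simp
    have "k \<le> (f t - f s) / (t - s)"
    proof (rule dense_le)
      show "k' \<le> (f t - f s) / (t - s)" if "k' < k" for k'
        using main[OF that] \<open>s < t\<close> by (simp add: pos_le_divide_eq)
    qed
    then show ?thesis using \<open>s < t\<close> by (simp add: pos_le_divide_eq)
  qed simp
qed

section \<open>Maps of the annulus given by their lifts\<close>

definition shift_equivariant :: "(real \<times> real \<Rightarrow> real \<times> real) \<Rightarrow> bool"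
  where "shift_equivariant P \<longleftrightarrow> (\<forall>t c. P (t + 1, c) = P (t, c) + (1, 0))"

text \<open>An arbitrary lift is chosen, so this is of use for functions of period one in the first
  coordinate.\<close>

definition descend :: "(real \<times> real \<Rightarrow> 'a) \<Rightarrow> annulus \<Rightarrow> 'a"
  where "descend W q = W (SOME p. annulus_cover p = q)"

lemma periodic_add_int:
  fixes W :: "real \<Rightarrow> 'a"
  assumes "\<And>t. W (t + 1) = W t"
  shows "W (t + of_int k) = W t"
proof -
  have nat: "W (t + of_nat n) = W t" for t n
    using assms[of "t + of_nat n" for n] by (induction n) (auto simp: add_ac)
  show ?thesis
    using nat[of t "nat k"] nat[of "t + of_int k" "nat (- k)"] by (cases "k \<ge> 0") auto
qed

lemma descend_cover:
  assumes "\<And>t c. W (t + 1, c) = W (t, c)"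
  shows "descend W (annulus_cover p) = W p"
proof -
  have "annulus_cover (SOME p'. annulus_cover p' = annulus_cover p) = annulus_cover p"
    by (rule someI_ex) blast
  moreover have eq: "W p' = W p" if "annulus_cover p' = annulus_cover p" for p'
  proof -
    from that have "fst p' - fst p \<in> \<int>" "snd p' = snd p"
      by (auto simp: annulus_cover_def to_circle_eq_iff)
    then obtain k where "p' = (fst p + of_int k, snd p)"
      by (metis Ints_cases add.commute diff_add_cancel prod.collapse)
    then show ?thesis
      using periodic_add_int[of "\<lambda>t. W (t, snd p)" "fst p" k] assms by simp
  qed
  ultimately show ?thesis unfolding descend_def by blast
qed

definition descend_map :: "(real \<times> real \<Rightarrow> real \<times> real) \<Rightarrow> annulus \<Rightarrow> annulus"
  where "descend_map P = descend (annulus_cover \<circ> P)"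

lemma descend_map_cover:
  assumes "shift_equivariant P"
  shows "descend_map P (annulus_cover p) = annulus_cover (P p)"
proof -
  have "annulus_cover (q + (1, 0)) = annulus_cover q" for q
    using to_circle_add_int[of "fst q" 1] by (simp add: annulus_cover_def)
  then show ?thesis
    using descend_cover[of "annulus_cover \<circ> P"] assms
    by (simp add: descend_map_def shift_equivariant_def)
qed

lemma is_lift_descend_map: "shift_equivariant P \<Longrightarrow> is_lift P (descend_map P)"
  by (auto simp: is_lift_def descend_map_cover)

lemma shift_equivariant_inverse:
  assumes "shift_equivariant P" "\<And>p. P (Q p) = p" "\<And>p. Q (P p) = p"
  shows "shift_equivariant Q"
  unfolding shift_equivariant_def
proof (intro allI)
  fix t c
  obtain s d where Q: "Q (t, c) = (s, d)" by fastforce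
  have "P (s + 1, d) = (t, c) + (1, 0)"
    using assms(1,2) Q unfolding shift_equivariant_def by metis
  then show "Q (t + 1, c) = Q (t, c) + (1, 0)"
    using assms(3)[of "(s + 1, d)"] Q by simp
qed

lemma shift_equivariant_comp:
  "shift_equivariant P \<Longrightarrow> shift_equivariant Q \<Longrightarrow> shift_equivariant (P \<circ> Q)"
  by (auto simp: shift_equivariant_def) (metis (no_types, opaque_lifting) add_Pair add.right_neutral prod.collapse)

lemma descend_map_inverse:
  assumes P: "shift_equivariant P" "\<And>p. P (Q p) = p" "\<And>p. Q (P p) = p"
  shows "descend_map P (descend_map Q x) = x" "descend_map Q (descend_map P x) = x"
proof -
  obtain p where x: "x = annulus_cover p" using surj_annulus_cover by (metis surjD)
  note Q = shift_equivariant_inverse[OF P]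
  show "descend_map P (descend_map Q x) = x" "descend_map Q (descend_map P x) = x"
    by (simp_all add: x descend_map_cover P Q)
qed

lemma homeomorphism_descend_map:
  assumes P: "shift_equivariant P" "\<And>p. P (Q p) = p" "\<And>p. Q (P p) = p"
    and cont: "continuous_on UNIV P" "continuous_on UNIV Q"
  shows "homeomorphism UNIV UNIV (descend_map P) (descend_map Q)"
proof (rule homeomorphismI)
  note Q = shift_equivariant_inverse[OF P]
  have "continuous_on UNIV (descend_map R)" if "shift_equivariant R" "continuous_on UNIV R" for R
  proof -
    have "descend_map R \<circ> annulus_cover = annulus_cover \<circ> R"
      by (auto simp: descend_map_cover that)
    then show ?thesis
      unfolding continuous_on_annulus_iff
      using continuous_on_compose[OF that(2) continuous_on_subset[OF continuous_annulus_cover]] by simp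
  qed
  then show "continuous_on UNIV (descend_map P)" "continuous_on UNIV (descend_map Q)"
    using P Q cont by auto
qed (auto simp: descend_map_inverse[OF P])

section \<open>Generating functions on the universal cover\<close>

locale lifted_function =
  fixes W W1 W2 :: "real \<times> real \<Rightarrow> real"
  assumes der: "(W has_derivative (\<lambda>v. W1 p * fst v + W2 p * snd v)) (at p)"
    and cont1: "continuous_on UNIV W1" and cont2: "continuous_on UNIV W2"
    and per: "W (t + 1, c) = W (t, c)"
begin

lemma der_fst: "((\<lambda>t. W (t, c)) has_real_derivative W1 (t, c)) (at t)"
proof -
  have "((\<lambda>t. (t, c)) has_derivative (\<lambda>h. (h, 0))) (at t)"
    by (auto intro!: derivative_eq_intros)
  from has_derivative_compose[OF this der] show ?thesis
    by (simp add: has_field_derivative_def)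
qed

lemma der_snd: "((\<lambda>c. W (t, c)) has_real_derivative W2 (t, c)) (at c)"
proof -
  have "((\<lambda>c. (t, c)) has_derivative (\<lambda>h. (0, h))) (at c)"
    by (auto intro!: derivative_eq_intros)
  from has_derivative_compose[OF this der] show ?thesis
    by (simp add: has_field_derivative_def)
qed

lemma per1: "W1 (t + 1, c) = W1 (t, c)"
proof -
  have "((\<lambda>s. W (s + 1, c)) has_real_derivative W1 (t + 1, c)) (at t)"
    using der_fst[where t = "t + 1" and c = c] DERIV_shift[of "\<lambda>s. W (s, c)" _ t 1] by simp
  then have "((\<lambda>s. W (s, c)) has_real_derivative W1 (t + 1, c)) (at t)" by (simp only: per)
  then show ?thesis using der_fst DERIV_unique by blast
qed

lemma per2: "W2 (t + 1, c) = W2 (t, c)"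
proof -
  have "((\<lambda>d. W (t, d)) has_real_derivative W2 (t + 1, c)) (at c)"
    using der_snd[of "t + 1" c] by (simp only: per)
  then show ?thesis using der_snd DERIV_unique by blast
qed

text \<open>A generating function determines its map \<open>(x, c) \<mapsto> (t, r)\<close> implicitly, in the mixed coordinates
  \<open>(t, c)\<close>. The two maps below recover \<open>(x, c)\<close> and \<open>(t, r)\<close> from these.\<close>

definition angle_map :: "real \<times> real \<Rightarrow> real \<times> real"
  where "angle_map p = (fst p + W2 p, snd p)"

definition action_map :: "real \<times> real \<Rightarrow> real \<times> real"
  where "action_map p = (fst p, snd p + W1 p)"

lemma shift_equivariant_maps: "shift_equivariant angle_map" "shift_equivariant action_map"
  by (auto simp: shift_equivariant_def angle_map_def action_map_def per1 per2)

lemma continuous_maps: "continuous_on UNIV angle_map" "continuous_on UNIV action_map"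
  unfolding angle_map_def action_map_def by (intro continuous_intros cont1 cont2)+

lemma d_theta_descend: "d_theta (descend W) (annulus_cover p) = W1 p"
proof -
  have *: "(fst (annulus_cover p) + to_circle t, snd (annulus_cover p)) = annulus_cover (fst p + t, snd p)" for t
    by (simp add: annulus_cover_def to_circle_add)
  have "((\<lambda>t. W (fst p + t, snd p)) has_real_derivative W1 p) (at 0)"
    using der_fst[where t = "fst p + 0" and c = "snd p"] DERIV_shift[of "\<lambda>t. W (t, snd p)" "W1 p" 0 "fst p"]
    by (simp add: add.commute)
  then show ?thesis
    unfolding d_theta_def * by (simp add: descend_cover per DERIV_imp_deriv)
qed

lemma d_c_descend: "d_c (descend W) (annulus_cover p) = W2 p"
proof -
  have *: "(fst (annulus_cover p), c) = annulus_cover (fst p, c)" for c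
    by (simp add: annulus_cover_def)
  have **: "snd (annulus_cover p) = snd p" by (simp add: annulus_cover_def)
  show ?thesis
    unfolding d_c_def * ** using der_snd[of "fst p" "snd p"] by (simp add: descend_cover per DERIV_imp_deriv)
qed

lemma annulus_C1_descend: "annulus_C1 (descend W)"
proof -
  have "descend W \<circ> annulus_cover = W" by (auto simp: descend_cover per)
  moreover have "continuous_on UNIV (\<lambda>p. W1 p * fst v + W2 p * snd v)" for v
    by (intro continuous_intros cont1 cont2)
  ultimately show ?thesis
    unfolding annulus_C1_def One_nat_def C_k.simps
    by (intro exI[of _ "\<lambda>p v. W1 p * fst v + W2 p * snd v"]) (simp add: der)
qed

end

text \<open>Being periodic, \<open>f\<close> is bounded, so that \<open>t + f t\<close> takes values on both sides of \<open>x\<close>.\<close>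

lemma periodic_displacement_surj:
  fixes f :: "real \<Rightarrow> real"
  assumes cont: "continuous_on UNIV f" and per: "\<And>t. f (t + 1) = f t"
  shows "\<exists>t. t + f t = x"
proof -
  obtain B where B: "\<And>t. \<bar>f t\<bar> \<le> B"
  proof -
    have "compact (f ` {0..1})" by (intro compact_continuous_image continuous_on_subset[OF cont]) auto
    then obtain B where "\<forall>y\<in>f ` {0..1}. norm y \<le> B"
      using compact_imp_bounded bounded_iff by metis
    moreover have "f t = f (frac t)" for t
      using periodic_add_int[of f "frac t" "floor t", OF per] by (simp add: frac_def)
    moreover have "frac t \<in> {0..1}" for t using frac_lt_1[of t] by auto
    ultimately show ?thesis using that by (metis imageI real_norm_def)
  qed
  have "x - B + f (x - B) \<le> x" "x \<le> x + B + f (x + B)" "x - B \<le> x + B"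
    using B[of "x - B"] B[of "x + B"] by auto
  then show ?thesis
    using IVT'[of "\<lambda>t. t + f t" "x - B" x "x + B"]
      continuous_on_subset[OF continuous_on_add[OF continuous_on_id cont], of "{x-B..x+B}"] by auto
qed

text \<open>Under these conditions both maps are homeomorphisms of the plane, so that the generated map is
  \<open>action_map\<close> after the inverse of \<open>angle_map\<close>.\<close>

locale lifted_twist = lifted_function +
  assumes mono1: "c < c' \<Longrightarrow> c + W1 (t, c) < c' + W1 (t, c')"
    and mono2: "t < t' \<Longrightarrow> t + W2 (t, c) < t' + W2 (t', c)"
    and surj1: "\<exists>c. c + W1 (t, c) = r"
begin

lemma bij_angle_map: "bij angle_map"
  unfolding bij_def
proof
  show "inj angle_map"
    using mono2 by (auto simp: inj_def angle_map_def) (metis less_irrefl linorder_neqE_linordered_idom)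
  have "\<exists>p. angle_map p = (x, c)" for x c
  proof -
    have "continuous_on UNIV (\<lambda>t. W2 (t, c))"
      by (rule continuous_on_compose2[OF cont2]) (auto intro!: continuous_intros)
    then obtain t where "t + W2 (t, c) = x"
      using periodic_displacement_surj[of "\<lambda>t. W2 (t, c)" x] per2 by auto
    then show ?thesis by (intro exI[of _ "(t, c)"]) (simp add: angle_map_def)
  qed
  then show "surj angle_map" by (metis surj_def surj_pair)
qed

lemma bij_action_map: "bij action_map"
  unfolding bij_def
proof
  show "inj action_map"
    using mono1 by (auto simp: inj_def action_map_def) (metis less_irrefl linorder_neqE_linordered_idom)
  have "\<exists>p. action_map p = (t, r)" for t r
    using surj1[of t r] by (auto simp: action_map_def)
  then show "surj action_map" by (metis surj_def surj_pair)
qed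

abbreviation "angle_inv \<equiv> inv angle_map"
abbreviation "action_inv \<equiv> inv action_map"

lemma angle_inv [simp]: "angle_map (angle_inv p) = p" "angle_inv (angle_map p) = p"
  using bij_angle_map by (auto simp: bij_is_surj surj_f_inv_f bij_is_inj)

lemma action_inv [simp]: "action_map (action_inv p) = p" "action_inv (action_map p) = p"
  using bij_action_map by (auto simp: bij_is_surj surj_f_inv_f bij_is_inj)

lemma continuous_inverses: "continuous_on UNIV angle_inv" "continuous_on UNIV action_inv"
proof -
  have "continuous_on UNIV (inv f)" if cont: "continuous_on UNIV f" and bij: "bij f" for f :: "real \<times> real \<Rightarrow> real \<times> real"
  proof -
    obtain g where g: "homeomorphism UNIV (range f) f g"
      by (rule invariance_of_domain_homeomorphism[OF open_UNIV cont order_refl bij_is_inj[OF bij]])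
    then have "g = inv f"
      using bij by (metis UNIV_I bij_inv_eq_iff ext homeomorphism_def bij_is_surj)
    then show ?thesis using g bij by (auto simp: homeomorphism_def bij_def)
  qed
  then show "continuous_on UNIV angle_inv" "continuous_on UNIV action_inv"
    using continuous_maps bij_angle_map bij_action_map by auto
qed

definition generated_lift :: "real \<times> real \<Rightarrow> real \<times> real"
  where "generated_lift = action_map \<circ> angle_inv"

definition generated_lift_inv :: "real \<times> real \<Rightarrow> real \<times> real"
  where "generated_lift_inv = angle_map \<circ> action_inv"

definition generated_map :: "annulus \<Rightarrow> annulus"
  where "generated_map = descend_map generated_lift"

lemma generated_lift_inverse:
  "generated_lift (generated_lift_inv p) = p" "generated_lift_inv (generated_lift p) = p"
  by (auto simp: generated_lift_def generated_lift_inv_def)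

lemma shift_equivariant_generated_lift:
  "shift_equivariant generated_lift" "shift_equivariant generated_lift_inv"
proof -
  show *: "shift_equivariant generated_lift"
    unfolding generated_lift_def
    by (intro shift_equivariant_comp shift_equivariant_maps shift_equivariant_inverse[of angle_map]) auto
  show "shift_equivariant generated_lift_inv"
    by (rule shift_equivariant_inverse[OF *]) (auto simp: generated_lift_inverse)
qed

lemma homeomorphism_generated_map:
  "homeomorphism UNIV UNIV generated_map (descend_map generated_lift_inv)"
  unfolding generated_map_def
proof (rule homeomorphism_descend_map)
  show "continuous_on UNIV generated_lift" "continuous_on UNIV generated_lift_inv"
    unfolding generated_lift_def generated_lift_inv_def
    by (rule continuous_on_compose continuous_inverses continuous_on_subset[OF continuous_maps(1)]
        continuous_on_subset[OF continuous_maps(2)] subset_UNIV)+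
qed (auto simp: generated_lift_inverse shift_equivariant_generated_lift)

lemma generated_map_angle: "generated_map (annulus_cover (angle_map p)) = annulus_cover (action_map p)"
proof -
  have "generated_map (annulus_cover (angle_map p)) = annulus_cover (generated_lift (angle_map p))"
    unfolding generated_map_def by (rule descend_map_cover[OF shift_equivariant_generated_lift(1)])
  then show ?thesis by (simp add: generated_lift_def)
qed

lemma map_generating_function_generated_map: "map_generating_function (descend W) generated_map"
  unfolding map_generating_function_def
proof (intro conjI allI annulus_C1_descend)
  fix x c \<theta> r
  obtain t where t: "to_circle t = \<theta>" using surj_to_circle by (metis surjD)
  have d: "d_c (descend W) (\<theta>, d) = W2 (t, d)" "d_theta (descend W) (\<theta>, d) = W1 (t, d)" for d
    using d_c_descend[of "(t, d)"] d_theta_descend[of "(t, d)"] t by (auto simp: annulus_cover_simp)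
  show "generated_map (x, c) = (\<theta>, r) \<longleftrightarrow>
    x = \<theta> + to_circle (d_c (descend W) (\<theta>, c)) \<and> r = c + d_theta (descend W) (\<theta>, c)"
  proof
    assume R: "x = \<theta> + to_circle (d_c (descend W) (\<theta>, c)) \<and> r = c + d_theta (descend W) (\<theta>, c)"
    have "(x, c) = annulus_cover (angle_map (t, c))" "(\<theta>, r) = annulus_cover (action_map (t, c))"
      using R t by (auto simp: angle_map_def action_map_def d to_circle_add annulus_cover_simp)
    then show "generated_map (x, c) = (\<theta>, r)" by (simp add: generated_map_angle)
  next
    assume L: "generated_map (x, c) = (\<theta>, r)"
    obtain q where "annulus_cover q = (x, c)" using surj_annulus_cover by (metis surjD)
    then obtain p where p: "annulus_cover (angle_map p) = (x, c)" by (metis angle_inv(1))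
    then have "annulus_cover (action_map p) = (\<theta>, r)" using L generated_map_angle by metis
    then have p2: "to_circle (fst p) = to_circle t" "r = snd p + W1 p"
      by (auto simp: action_map_def annulus_cover_def t)
    have p3: "x = to_circle (fst p) + to_circle (W2 p)" "c = snd p"
      using p by (auto simp: angle_map_def annulus_cover_def to_circle_add)
    have "d_c (descend W) (\<theta>, c) = W2 p" "d_theta (descend W) (\<theta>, c) = W1 p"
      using d_c_descend[of p] d_theta_descend[of p] p2 p3 t by (auto simp: annulus_cover_def)
    then show "x = \<theta> + to_circle (d_c (descend W) (\<theta>, c)) \<and> r = c + d_theta (descend W) (\<theta>, c)"
      using p2 p3 t by simp
  qed
qed

end

section \<open>Smooth generating functions\<close>

text \<open>The derivatives are parameters, so that sums, products and reparametrisations of jets come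
  with explicit second derivatives and the equality of the two mixed ones.\<close>

locale periodic_jet =
  fixes W W1 W2 W11 W12 W22 :: "real \<times> real \<Rightarrow> real"
  assumes der0: "(W has_derivative (\<lambda>v. W1 p * fst v + W2 p * snd v)) (at p)"
    and der1: "(W1 has_derivative (\<lambda>v. W11 p * fst v + W12 p * snd v)) (at p)"
    and der2: "(W2 has_derivative (\<lambda>v. W12 p * fst v + W22 p * snd v)) (at p)"
    and smooth: "C_k k W11" "C_k k W12" "C_k k W22"
    and per0: "W (t + 1, c) = W (t, c)"
begin

lemma smooth_W12: "C_k k W1" "C_k k W2"
proof -
  have "C_k (Suc k) W1" "C_k (Suc k) W2"
    by (rule C_k_SucI[OF der1] C_k_SucI[OF der2];
        intro C_k_add C_k_mult smooth C_k_const)+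
  then show "C_k k W1" "C_k k W2" by (auto simp only: C_k_Suc_imp)
qed

lemma lifted_function: "lifted_function W W1 W2"
  by unfold_locales (fact der0 per0 C_k_imp_continuous[OF smooth_W12(1)[of 0]]
    C_k_imp_continuous[OF smooth_W12(2)[of 0]])+

lemma der_mixed_snd: "((\<lambda>c. W1 (t, c)) has_real_derivative W12 (t, c)) (at c)"
proof -
  have "((\<lambda>c. (t, c)) has_derivative (\<lambda>h. (0, h))) (at c)"
    by (auto intro!: derivative_eq_intros)
  from has_derivative_compose[OF this der1] show ?thesis
    by (simp add: has_field_derivative_def)
qed

lemma der_mixed_fst: "((\<lambda>t. W2 (t, c)) has_real_derivative W12 (t, c)) (at t)"
proof -
  have "((\<lambda>t. (t, c)) has_derivative (\<lambda>h. (h, 0))) (at t)"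
    by (auto intro!: derivative_eq_intros)
  from has_derivative_compose[OF this der2] show ?thesis
    by (simp add: has_field_derivative_def)
qed

end

locale smooth_twist = periodic_jet +
  fixes B :: real
  assumes pos: "1 + W12 p > 0"
    and bdd: "\<bar>W1 p\<bar> \<le> B"
begin

sublocale lifted_twist W W1 W2
proof
  fix p :: "real \<times> real" and t t' c c' r :: real
  show "(W has_derivative (\<lambda>v. W1 p * fst v + W2 p * snd v)) (at p)" by (rule der0)
  show "continuous_on UNIV W1" "continuous_on UNIV W2" using smooth_W12 C_k_imp_continuous by auto
  show "W (t + 1, c) = W (t, c)" by (rule per0)
  have d1: "((\<lambda>c. c + W1 (t, c)) has_real_derivative 1 + W12 (t, c)) (at c)" for c
    by (auto intro!: derivative_eq_intros der_mixed_snd)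
  have d2: "((\<lambda>t. t + W2 (t, c)) has_real_derivative 1 + W12 (t, c)) (at t)" for t
    by (auto intro!: derivative_eq_intros der_mixed_fst)
  show "c + W1 (t, c) < c' + W1 (t, c')" if "c < c'"
    by (rule DERIV_pos_imp_increasing[OF that]) (use d1 pos in blast)
  show "t + W2 (t, c) < t' + W2 (t', c)" if "t < t'"
    by (rule DERIV_pos_imp_increasing[OF that]) (use d2 pos in blast)
  have "isCont (\<lambda>c. c + W1 (t, c)) c" for c using d1 DERIV_isCont by blast
  moreover have "r - B + W1 (t, r - B) \<le> r" "r \<le> r + B + W1 (t, r + B)"
    using bdd[of "(t, r - B)"] bdd[of "(t, r + B)"] by auto
  moreover have "0 \<le> B" using bdd[of 0] by linarith
  ultimately show "\<exists>c. c + W1 (t, c) = r"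
    using IVT'[of "\<lambda>c. c + W1 (t, c)" "r - B" r "r + B"]
    by (auto intro!: continuous_at_imp_continuous_on)
qed

lemma smooth_maps: "C_k k angle_map" "C_k k action_map"
  unfolding angle_map_def action_map_def
  by (intro C_k_Pair C_k_add C_k_fst C_k_snd C_k_id smooth_W12)+

lemma smooth_angle_inv: "C_k k angle_inv" "\<exists>g'. \<forall>p. (angle_inv has_derivative g' p) (at p)"
proof -
  define h where "h p = fst p + W2 p" for p
  have "fibre_map h = angle_map" by (auto simp: fibre_map_def angle_map_def h_def)
  moreover have "(h has_derivative (\<lambda>v. (1 + W12 p) * fst v + W22 p * snd v)) (at p)" for p
    unfolding h_def by (auto intro!: derivative_eq_intros der2 simp: algebra_simps)
  ultimately show "C_k k angle_inv" "\<exists>g'. \<forall>p. (angle_inv has_derivative g' p) (at p)"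
    using fibre_map_inverse_smooth[of h "\<lambda>p. 1 + W12 p" W22 angle_inv, OF _ _ smooth(3) pos]
      C_k_add[OF C_k_const smooth(2)] by simp_all
qed

lemma smooth_action_inv: "C_k k action_inv"
proof -
  define h where "h p = fst p + W1 (prod.swap p)" for p
  have lswap: "bounded_linear (prod.swap :: real \<times> real \<Rightarrow> _)"
    unfolding prod.swap_def by (intro bounded_linear_Pair bounded_linear_fst bounded_linear_snd)
  have eq: "fibre_map h p = prod.swap (action_map (prod.swap p))" for p
    by (simp add: fibre_map_def action_map_def h_def)
  have comp: "C_k k (\<lambda>p. f (prod.swap p))" if "C_k k f" for f :: "real \<times> real \<Rightarrow> 'b::real_normed_vector" and k
    by (rule C_k_compose[OF that C_k_bounded_linear[OF lswap]])
  have dW: "((\<lambda>p. W1 (prod.swap p)) has_derivative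
      (\<lambda>v. W11 (prod.swap p) * fst (prod.swap v) + W12 (prod.swap p) * snd (prod.swap v))) (at p)" for p
    by (rule has_derivative_compose[OF bounded_linear_imp_has_derivative[OF lswap] der1])
  have "C_k k (\<lambda>p. prod.swap (action_inv (prod.swap p)))"
  proof (rule fibre_map_inverse_smooth)
    show "(h has_derivative (\<lambda>v. (1 + W12 (prod.swap p)) * fst v + W11 (prod.swap p) * snd v)) (at p)" for p
      unfolding h_def by (auto intro!: derivative_eq_intros dW simp: algebra_simps)
    show "C_k k (\<lambda>p. 1 + W12 (prod.swap p))" "C_k k (\<lambda>p. W11 (prod.swap p))" for k
      by (intro C_k_add C_k_const comp smooth)+
  qed (auto simp: eq pos)
  from C_k_bounded_linear_compose[OF lswap comp[OF this]] show ?thesis by simp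
qed

text \<open>Since \<open>(c + W1) dt - c dx = W1 dt - c d W2 = d (W - c W2)\<close> for \<open>x = t + W2\<close>, the function
  \<open>W - c W2\<close> is a primitive. It is periodic in \<open>t\<close>, which gives exactness on the annulus.\<close>

lemma exact_symplectic_generated_map: "exact_symplectic_diffeomorphism generated_map"
  unfolding exact_symplectic_diffeomorphism_def annulus_diffeomorphism_def
proof (intro conjI)
  have inv: "generated_map (descend_map generated_lift_inv x) = x"
     "descend_map generated_lift_inv (generated_map x) = x" for x
    unfolding generated_map_def
    using descend_map_inverse shift_equivariant_generated_lift generated_lift_inverse by auto
  then show bij: "bij generated_map" by (metis bijI')
  have invm: "inv generated_map = descend_map generated_lift_inv"
    by (rule inv_equality) (auto simp: inv)
  have lifts: "is_lift generated_lift generated_map"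
     "is_lift generated_lift_inv (inv generated_map)"
    unfolding invm unfolding generated_map_def
    by (intro is_lift_descend_map shift_equivariant_generated_lift)+
  have "C_k k generated_lift" "C_k k generated_lift_inv" for k
    unfolding generated_lift_def generated_lift_inv_def o_def
    by (intro C_k_compose[OF smooth_maps(2) smooth_angle_inv(1)] C_k_compose[OF smooth_maps(1) smooth_action_inv])+
  then show "annulus_smooth generated_map" "annulus_smooth (inv generated_map)"
    unfolding annulus_smooth_def using lifts by blast+
  obtain g' where g': "\<And>p. (angle_inv has_derivative g' p) (at p)" using smooth_angle_inv(2) by blast
  define F' where "F' p v = (fst (g' p v), snd (g' p v) + (W11 (angle_inv p) * fst (g' p v) + W12 (angle_inv p) * snd (g' p v)))" for p v
  have dF: "(generated_lift has_derivative F' p) (at p)" for p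
  proof -
    have "(action_map has_derivative (\<lambda>v. (fst v, snd v + (W11 q * fst v + W12 q * snd v)))) (at q)" for q
      unfolding action_map_def by (auto intro!: derivative_eq_intros der1)
    from has_derivative_compose[OF g' this] show ?thesis
      by (simp add: generated_lift_def o_def F'_def[abs_def])
  qed
  define D where "D p v = W12 (angle_inv p) * fst (g' p v) + W22 (angle_inv p) * snd (g' p v)" for p v
  (* differentiating angle_map (angle_inv p) = p *)
  have gid: "v = (fst (g' p v) + D p v, snd (g' p v))" for p v
  proof -
    have "(angle_map has_derivative (\<lambda>v. (fst v + (W12 q * fst v + W22 q * snd v), snd v))) (at q)" for q
      unfolding angle_map_def by (auto intro!: derivative_eq_intros der2)
    from has_derivative_compose[OF g' this]
    have "((\<lambda>x. x) has_derivative (\<lambda>v. (fst (g' p v) + D p v, snd (g' p v)))) (at p)"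
      by (simp add: D_def)
    from has_derivative_unique[OF this has_derivative_ident] show ?thesis by metis
  qed
  define T where "T p = W (angle_inv p) - snd (angle_inv p) * W2 (angle_inv p)" for p
  have "shift_equivariant angle_inv"
    by (rule shift_equivariant_inverse[of angle_map]) (auto simp: shift_equivariant_maps)
  then have perT: "T (t + 1, c) = T (t, c)" for t c
    unfolding shift_equivariant_def T_def
    by (metis (no_types, opaque_lifting) add_Pair add.right_neutral per per2 prod.collapse snd_conv)
  have "(T has_derivative (\<lambda>v. r_dtheta (generated_lift p) (F' p v) - r_dtheta p v)) (at p)" for p
  proof -
    let ?q = "angle_inv p"
    have "(T has_derivative (\<lambda>v. (W1 ?q * fst (g' p v) + W2 ?q * snd (g' p v)) -
        (snd ?q * D p v + snd (g' p v) * W2 ?q))) (at p)"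
      unfolding T_def D_def
      by (intro has_derivative_diff has_derivative_mult has_derivative_compose[OF g' der0]
          has_derivative_compose[OF g' der2] has_derivative_snd g')
    moreover have "(W1 ?q * fst (g' p v) + W2 ?q * snd (g' p v)) -
        (snd ?q * D p v + snd (g' p v) * W2 ?q) = r_dtheta (generated_lift p) (F' p v) - r_dtheta p v" for v
    proof -
      have "snd ?q = snd p" using angle_inv(1)[of p] by (metis angle_map_def snd_conv)
      moreover have "fst v = fst (g' p v) + D p v" using gid[of v p] by (metis fst_conv)
      ultimately show ?thesis
        by (simp add: r_dtheta_def generated_lift_def action_map_def F'_def algebra_simps)
    qed
    ultimately show ?thesis by simp
  qed
  moreover have "descend T \<circ> annulus_cover = T" by (auto simp: descend_cover perT)
  ultimately show "\<exists>F F' S. is_lift F generated_map \<and> (\<forall>p. (F has_derivative F' p) (at p)) \<and>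
      (\<forall>p. (S \<circ> annulus_cover has_derivative (\<lambda>v. r_dtheta (F p) (F' p v) - r_dtheta p v)) (at p))"
    using lifts(1) dF by (intro exI[of _ generated_lift] exI[of _ F'] exI[of _ "descend T"]) simp
qed

end

section \<open>The lifted generating function of a foliation\<close>

lemma descend_comp_cover: "descend (u \<circ> annulus_cover) = u"
proof
  fix q
  have "annulus_cover (SOME p. annulus_cover p = q) = q"
    by (rule someI_ex) (metis surj_annulus_cover surjD)
  then show "descend (u \<circ> annulus_cover) q = u q" by (simp add: descend_def)
qed

lemma annulus_C1_lifted_function:
  assumes "annulus_C1 u"
  shows "lifted_function (u \<circ> annulus_cover) (d_theta u \<circ> annulus_cover) (d_c u \<circ> annulus_cover)"
proof -
  let ?W = "u \<circ> annulus_cover"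
  obtain D where D: "\<And>p. (?W has_derivative D p) (at p)" "\<And>v. continuous_on UNIV (\<lambda>p. D p v)"
    using assms unfolding annulus_C1_def One_nat_def C_k.simps by blast
  have lin: "D p v = D p (1, 0) * fst v + D p (0, 1) * snd v" for p v
  proof -
    have l: "linear (D p)" using D(1) has_derivative_linear by blast
    have "v = fst v *\<^sub>R (1, 0) + snd v *\<^sub>R (0, 1)" by (cases v) auto
    from arg_cong[OF this, of "D p"] show ?thesis
      by (simp only: linear_add[OF l] linear_cmul[OF l] real_scaleR_def mult.commute)
  qed
  interpret lifted_function ?W "\<lambda>p. D p (1, 0)" "\<lambda>p. D p (0, 1)"
  proof
    show "(?W has_derivative (\<lambda>v. D p (1, 0) * fst v + D p (0, 1) * snd v)) (at p)" for p
      by (rule has_derivative_eq_rhs[OF D(1)]) (rule ext, rule lin)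
    show "?W (t + 1, c) = ?W (t, c)" for t c
      using to_circle_add_int[of t 1] by (simp add: annulus_cover_simp)
  qed (fact D)+
  have "(d_theta u \<circ> annulus_cover) = (\<lambda>p. D p (1, 0))" "(d_c u \<circ> annulus_cover) = (\<lambda>p. D p (0, 1))"
    using d_theta_descend d_c_descend by (auto simp: descend_comp_cover simp del: split_paired_All)
  then show ?thesis using lifted_function_axioms by simp
qed

lemma integral_circle_periodic_derivative:
  fixes f :: "circle \<Rightarrow> real"
  assumes cont: "continuous_on UNIV f"
    and der: "\<And>t. (A has_real_derivative f (to_circle t)) (at t)"
  shows "(\<integral>\<theta>. f \<theta> \<partial>circle_lebesgue) = A 1 - A 0"
proof -
  have ft: "continuous_on S (\<lambda>t. f (to_circle t))" for S
    using continuous_on_compose2[OF cont continuous_on_to_circle] continuous_on_subset by blast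
  have m: "f \<in> borel_measurable borel" using cont by (rule borel_measurable_continuous_onI)
  have int: "set_integrable lborel {0..1} (\<lambda>t. f (to_circle t))"
    by (rule borel_integrable_atLeastAtMost') (rule ft)
  then have int': "set_integrable lborel {0..<1} (\<lambda>t. f (to_circle t))"
    by (rule set_integrable_subset) auto
  have "((\<lambda>t. f (to_circle t)) has_integral (A 1 - A 0)) {0..1}"
    by (rule fundamental_theorem_of_calculus)
      (use der in \<open>auto simp: has_real_derivative_iff_has_vector_derivative[symmetric]
         intro: has_field_derivative_at_within\<close>)
  moreover have "{0..<1} - {0..1} = ({}::real set)" "{0..1} - {0..<1} = {1::real}" by auto
  ultimately have "((\<lambda>t. f (to_circle t)) has_integral (A 1 - A 0)) {0..<1}"
    by (subst has_integral_spike_set_eq[of _ "{0..1}"]) (auto intro: negligible_subset[of "{1}"])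
  then have "(LINT t:{0..<1}|lborel. f (to_circle t)) = A 1 - A 0"
    using set_borel_integral_eq_integral(2)[OF int'] by (simp add: integral_unique)
  then show ?thesis by (simp add: integral_circle_lebesgue[OF m])
qed

section \<open>Slopes in the two variables\<close>

text \<open>Both conditions in the equivalence bound the mixed increments
  \<open>f b d - f a d - f b c + f a c\<close>, seen as increments in one variable or in the other. The mean
  value theorem passes from one partial derivative to such an increment, a limit to the other
  partial derivative.\<close>

lemma mixed_slope_lower_bound:
  fixes f :: "real \<Rightarrow> real \<Rightarrow> real"
  assumes f1: "\<And>x y. ((\<lambda>x. f x y) has_real_derivative f1 x y) (at x)"
    and f2: "\<And>x. ((\<lambda>y. f x y) has_real_derivative f2 x y) (at y)"
    and ab: "a \<le> b" and \<delta>: "\<delta> > 0"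
    and slope: "\<And>x h. x \<in> {a..b} \<Longrightarrow> 0 < h \<Longrightarrow> h < \<delta> \<Longrightarrow> m * h \<le> f1 x (y + h) - f1 x y"
  shows "m * (b - a) \<le> f2 b y - f2 a y"
proof -
  have inc: "m * (b - a) \<le> (f b (y + h) - f b y) / h - (f a (y + h) - f a y) / h" if h: "0 < h" "h < \<delta>" for h
  proof -
    have "f a (y + h) - f a y - m * h * a \<le> f b (y + h) - f b y - m * h * b"
    proof (rule DERIV_nonneg_imp_nondecreasing[OF ab])
      fix x assume "a \<le> x" "x \<le> b"
      then show "\<exists>d. ((\<lambda>x. f x (y + h) - f x y - m * h * x) has_real_derivative d) (at x) \<and> 0 \<le> d"
        using slope[OF _ h, of x] by (intro exI conjI) (auto intro!: derivative_eq_intros f1)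
    qed
    then have "m * (b - a) * h \<le> (f b (y + h) - f b y) - (f a (y + h) - f a y)"
      by (simp add: algebra_simps)
    then have "m * (b - a) \<le> ((f b (y + h) - f b y) - (f a (y + h) - f a y)) / h"
      using h(1) by (simp add: pos_le_divide_eq)
    then show ?thesis by (simp add: diff_divide_distrib)
  qed
  have lim: "((\<lambda>h. (f x (y + h) - f x y) / h) \<longlongrightarrow> f2 x y) (at_right 0)" for x
    using f2[of x] unfolding DERIV_def by (rule filterlim_mono) (auto simp: at_le)
  show ?thesis
  proof (rule tendsto_lowerbound)
    show "((\<lambda>h. (f b (y + h) - f b y) / h - (f a (y + h) - f a y) / h) \<longlongrightarrow> f2 b y - f2 a y) (at_right 0)"
      by (intro tendsto_intros lim)
    show "\<forall>\<^sub>F h in at_right 0. m * (b - a) \<le> (f b (y + h) - f b y) / h - (f a (y + h) - f a y) / h"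
      unfolding eventually_at_right_field using inc \<delta> by auto
  qed simp
qed

locale generated_foliation =
  fixes \<eta> :: "real \<Rightarrow> circle \<Rightarrow> real" and u :: "annulus \<Rightarrow> real"
  assumes foliation: "continuous_foliation \<eta>"
    and generating: "foliation_generating_function \<eta> u"
    and C1: "annulus_C1 u"
begin

abbreviation "W \<equiv> u \<circ> annulus_cover"
abbreviation "W1 \<equiv> d_theta u \<circ> annulus_cover"
abbreviation "W2 \<equiv> d_c u \<circ> annulus_cover"

sublocale lifted_function W W1 W2
  by (rule annulus_C1_lifted_function[OF C1])

lemma continuous_partials: "continuous_on UNIV (d_theta u)" "continuous_on UNIV (d_c u)"
  using cont1 cont2 continuous_on_annulus_iff by blast+

lemma leaf_function: "\<eta> c \<theta> = c + d_theta u (\<theta>, c)"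
proof -
  have "fun_graph (\<lambda>\<theta>. c + d_theta u (\<theta>, c)) \<in> leaves \<eta>"
    using generating by (simp add: foliation_generating_function_def)
  then obtain c' where "fun_graph (\<lambda>\<theta>. c + d_theta u (\<theta>, c)) = fun_graph (\<eta> c')"
    by (auto simp: leaves_def)
  then have eq: "\<eta> c' \<theta> = c + d_theta u (\<theta>, c)" for \<theta>
    unfolding fun_graph_def by (auto simp: set_eq_iff image_iff)
  have "c' = (\<integral>\<theta>. c + d_theta u (\<theta>, c) \<partial>circle_lebesgue)"
    using foliation unfolding continuous_foliation_def by (simp add: eq[symmetric])
  also have "\<dots> = (c * 1 + W (1, c)) - (c * 0 + W (0, c))"
  proof (rule integral_circle_periodic_derivative)
    show "continuous_on UNIV (\<lambda>\<theta>. c + d_theta u (\<theta>, c))"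
      by (intro continuous_intros continuous_on_compose2[OF continuous_partials(1)]) auto
    show "((\<lambda>t. c * t + W (t, c)) has_real_derivative c + d_theta u (to_circle t, c)) (at t)" for t
      using der_fst[of c t] by (auto intro!: derivative_eq_intros simp: annulus_cover_simp)
  qed
  also have "\<dots> = c" using per[of 0 c] by simp
  finally have "c' = c" .
  then show ?thesis using eq by simp
qed

lemma foliation_map_eq: "foliation_map \<eta> (\<theta>, c) = (\<theta>, c + d_theta u (\<theta>, c))"
  by (simp add: foliation_map_def leaf_function)

lemma bij_foliation_map: "bij (foliation_map \<eta>)"
proof -
  obtain g where "homeomorphism UNIV UNIV (foliation_map \<eta>) g"
    using foliation by (auto simp: continuous_foliation_def)
  then show ?thesis by (intro o_bij[of g]) (auto simp: homeomorphism_def fun_eq_iff simp del: split_paired_All)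
qed

text \<open>Disjointness of the leaves makes the difference of two leaf functions nowhere zero, hence of
  constant sign. By Rolle's theorem for the periodic function \<open>W (t, c') - W (t, c)\<close> it takes the
  value \<open>c' - c\<close> somewhere.\<close>

lemma leaves_increasing:
  assumes "c < c'" shows "c + W1 (t, c) < c' + W1 (t, c')"
proof (rule ccontr)
  define D where "D t = (c' + W1 (t, c')) - (c + W1 (t, c))" for t
  assume "\<not> ?thesis"
  then have neg: "D t \<le> 0" by (simp add: D_def)
  have "\<exists>s>0. s < 1 \<and> (W (1, c') - W (1, c)) - (W (0, c') - W (0, c)) = (1 - 0) * (W1 (s, c') - W1 (s, c))"
    by (rule MVT2[of 0 1 "\<lambda>t. W (t, c') - W (t, c)"]) (auto intro!: DERIV_diff der_fst simp del: o_apply)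
  then obtain s where "(W (1, c') - W (1, c)) - (W (0, c') - W (0, c)) = W1 (s, c') - W1 (s, c)"
    by auto
  then have pos: "D s > 0" using per[of 0 c] per[of 0 c'] assms by (simp add: D_def)
  have "continuous_on UNIV D"
    unfolding D_def by (intro continuous_intros continuous_on_compose2[OF cont1]) auto
  then have "connected (range D)" by (intro connected_continuous_image) auto
  then have "0 \<in> range D"
    using connected_contains_Icc[of "range D" "D t" "D s"] neg pos by auto
  then obtain x where "D x = 0" by auto
  then have "foliation_map \<eta> (to_circle x, c') = foliation_map \<eta> (to_circle x, c)"
    by (simp add: D_def foliation_map_eq annulus_cover_simp)
  then show False using bij_foliation_map assms by (auto simp: bij_def inj_def)
qed

lemma leaves_exhaust: "\<exists>c. c + W1 (t, c) = r"
proof -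
  obtain \<theta> c where "foliation_map \<eta> (\<theta>, c) = (to_circle t, r)"
    using bij_foliation_map by (metis bij_pointE surj_pair)
  then show ?thesis by (auto simp: foliation_map_eq annulus_cover_simp)
qed

text \<open>The increment of \<open>W1\<close> in \<open>c\<close> is controlled on short intervals only: their length \<open>\<delta>\<close> comes from
  the neighbourhoods in the definition of a locally biLipschitz map, and short increments suffice to
  take a limit as \<open>h\<close> tends to \<open>0\<close>.\<close>

definition action_slopes :: bool
  where "action_slopes \<longleftrightarrow> (\<forall>R. \<exists>L>1. \<exists>\<delta>>0. \<forall>t c h. \<bar>c\<bar> \<le> R \<and> 0 < h \<and> h < \<delta> \<longrightarrow>
    (1 / L - 1) * h \<le> W1 (t, c + h) - W1 (t, c) \<and> W1 (t, c + h) - W1 (t, c) \<le> (L - 1) * h)"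

definition angle_slopes :: bool
  where "angle_slopes \<longleftrightarrow> (\<forall>R. \<exists>L>1. \<forall>s t c. \<bar>c\<bar> \<le> R \<and> s \<le> t \<longrightarrow>
    (1 / L - 1) * (t - s) \<le> W2 (t, c) - W2 (s, c) \<and> W2 (t, c) - W2 (s, c) \<le> (L - 1) * (t - s))"

text \<open>If no constants served a whole strip, there would be ever shorter vertical segments, stretched
  or shrunk by ever larger factors. They would accumulate at a point of the compact strip, near which
  the foliation map is biLipschitz.\<close>

lemma lipschitz_foliation_action_slopes:
  assumes "lipschitz_foliation \<eta>"
  shows action_slopes
  unfolding action_slopes_def
proof (intro allI, rule ccontr)
  fix R
  let ?bad = "\<lambda>L \<delta> \<theta> c h. \<bar>c\<bar> \<le> R \<and> 0 < h \<and> h < \<delta> \<and>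
    \<not> (h / L \<le> \<eta> (c + h) \<theta> - \<eta> c \<theta> \<and> \<eta> (c + h) \<theta> - \<eta> c \<theta> \<le> L * h)"
  assume neg: "\<not> (\<exists>L>1. \<exists>\<delta>>0. \<forall>t c h. \<bar>c\<bar> \<le> R \<and> 0 < h \<and> h < \<delta> \<longrightarrow>
    (1 / L - 1) * h \<le> W1 (t, c + h) - W1 (t, c) \<and> W1 (t, c + h) - W1 (t, c) \<le> (L - 1) * h)"
  have "\<exists>\<theta> c h. ?bad L \<delta> \<theta> c h" if L: "L > 1" and \<delta>: "\<delta> > 0" for L \<delta>
  proof -
    obtain t c h where "\<bar>c\<bar> \<le> R" "0 < h" "h < \<delta>"
      "\<not> ((1 / L - 1) * h \<le> W1 (t, c + h) - W1 (t, c) \<and> W1 (t, c + h) - W1 (t, c) \<le> (L - 1) * h)"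
      using neg L \<delta> by meson
    then show ?thesis
      by (intro exI[of _ "to_circle t"] exI[of _ c] exI[of _ h])
        (auto simp: leaf_function annulus_cover_simp algebra_simps)
  qed
  then have "\<forall>n. \<exists>\<theta> c h. ?bad (real n + 2) (1 / real (Suc n)) \<theta> c h" by auto
  then obtain \<theta> c h where bad: "\<And>n. ?bad (real n + 2) (1 / real (Suc n)) (\<theta> n) (c n) (h n)"
    by metis
  define p where "p n = (\<theta> n, c n)" for n
  have "compact ((UNIV :: circle set) \<times> {- R..R})"
    by (intro compact_Times compact_circle) auto
  moreover have "p n \<in> UNIV \<times> {- R..R}" for n using bad[of n] by (auto simp: p_def)
  ultimately obtain l r where l: "strict_mono r" "(p \<circ> r) \<longlonglongrightarrow> l"
    unfolding compact_def by metis
  obtain U L where U: "open U" "l \<in> U" "0 < L"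
    "\<And>x y. x \<in> U \<Longrightarrow> y \<in> U \<Longrightarrow> dist x y / L \<le> dist (foliation_map \<eta> x) (foliation_map \<eta> y) \<and>
      dist (foliation_map \<eta> x) (foliation_map \<eta> y) \<le> L * dist x y"
    using assms unfolding lipschitz_foliation_def locally_bilipschitz_def by meson
  have h0: "h \<longlonglongrightarrow> 0"
  proof (rule tendsto_sandwich[of "\<lambda>_. 0" _ _ "\<lambda>n. 1 / real (Suc n)"])
    show "(\<lambda>n. 1 / real (Suc n)) \<longlonglongrightarrow> 0" by (rule LIMSEQ_Suc[OF lim_1_over_n])
  qed (use bad in \<open>auto simp: less_imp_le intro!: always_eventually\<close>)
  have "(\<lambda>n. fst (p (r n))) \<longlonglongrightarrow> fst l" "(\<lambda>n. snd (p (r n))) \<longlonglongrightarrow> snd l"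
    using tendsto_fst[OF l(2)] tendsto_snd[OF l(2)] by (simp_all add: o_def)
  moreover have "(\<lambda>n. h (r n)) \<longlonglongrightarrow> 0" using LIMSEQ_subseq_LIMSEQ[OF h0 l(1)] by (simp add: o_def)
  ultimately have "(\<lambda>n. (fst (p (r n)), snd (p (r n)) + h (r n))) \<longlonglongrightarrow> (fst l, snd l + 0)"
    by (intro tendsto_Pair tendsto_add)
  then have "(\<lambda>n. (\<theta> (r n), c (r n) + h (r n))) \<longlonglongrightarrow> l" by (simp add: p_def)
  then have "\<forall>\<^sub>F n in sequentially. (\<theta> (r n), c (r n) + h (r n)) \<in> U"
    using U topological_tendstoD by blast
  moreover have "\<forall>\<^sub>F n in sequentially. p (r n) \<in> U"
    using U topological_tendstoD[OF l(2)] by (simp add: o_def)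
  moreover have "\<forall>\<^sub>F n in sequentially. real (r n) \<ge> L"
  proof -
    obtain N where "L \<le> real N" using real_arch_simple by blast
    moreover have "n \<le> r n" for n using l(1) by (rule strict_mono_imp_increasing)
    ultimately have "real (r n) \<ge> L" if "n \<ge> N" for n
      using that by (meson le_trans of_nat_le_iff order_trans)
    then show ?thesis unfolding eventually_sequentially by blast
  qed
  ultimately have "\<forall>\<^sub>F n in sequentially. False"
  proof eventually_elim
    case (elim n)
    let ?n = "r n"
    have "h ?n > 0" using bad by blast
    have d: "dist (\<theta> ?n, c ?n + h ?n) (p ?n) = h ?n"
      using \<open>h ?n > 0\<close> by (simp add: p_def dist_prod_def dist_real_def)
    have "\<eta> (c ?n) (\<theta> ?n) < \<eta> (c ?n + h ?n) (\<theta> ?n)"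
    proof -
      obtain t where "to_circle t = \<theta> ?n" using surj_to_circle by (metis surjD)
      then show ?thesis
        using leaves_increasing[of "c ?n" "c ?n + h ?n" t] \<open>h ?n > 0\<close>
        by (simp add: leaf_function annulus_cover_simp)
    qed
    then have e: "dist (foliation_map \<eta> (\<theta> ?n, c ?n + h ?n)) (foliation_map \<eta> (p ?n)) =
        \<eta> (c ?n + h ?n) (\<theta> ?n) - \<eta> (c ?n) (\<theta> ?n)"
      by (simp add: p_def foliation_map_def dist_prod_def dist_real_def)
    have "h ?n / L \<le> \<eta> (c ?n + h ?n) (\<theta> ?n) - \<eta> (c ?n) (\<theta> ?n)"
      "\<eta> (c ?n + h ?n) (\<theta> ?n) - \<eta> (c ?n) (\<theta> ?n) \<le> L * h ?n"
      using U(4)[OF elim(1,2)] unfolding d e by auto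
    moreover have "h ?n / (real ?n + 2) \<le> h ?n / L"
      using elim(3) U(3) \<open>h ?n > 0\<close> by (intro divide_left_mono) auto
    moreover have "L * h ?n \<le> (real ?n + 2) * h ?n"
      using elim(3) \<open>h ?n > 0\<close> by (intro mult_right_mono) auto
    ultimately show False using bad[of ?n] by linarith
  qed
  then show False by simp
qed

lemma action_slopes_imp_angle_slopes:
  assumes action_slopes shows angle_slopes
  unfolding angle_slopes_def
proof
  fix R
  obtain L \<delta> where L: "L > 1" "\<delta> > 0" "\<And>t c h. \<bar>c\<bar> \<le> R \<Longrightarrow> 0 < h \<Longrightarrow> h < \<delta> \<Longrightarrow>
    (1 / L - 1) * h \<le> W1 (t, c + h) - W1 (t, c) \<and> W1 (t, c + h) - W1 (t, c) \<le> (L - 1) * h"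
    using assms unfolding action_slopes_def by meson
  have "(1 / L - 1) * (t - s) \<le> W2 (t, c) - W2 (s, c)" "W2 (t, c) - W2 (s, c) \<le> (L - 1) * (t - s)"
    if "\<bar>c\<bar> \<le> R" "s \<le> t" for s t c
  proof -
    show "(1 / L - 1) * (t - s) \<le> W2 (t, c) - W2 (s, c)"
      by (rule mixed_slope_lower_bound[of "\<lambda>t c. W (t, c)" "\<lambda>t c. W1 (t, c)" "\<lambda>t c. W2 (t, c)", OF der_fst der_snd that(2) L(2)])
        (use L(3) that in auto)
    have "- (L - 1) * (t - s) \<le> - W2 (t, c) - (- W2 (s, c))"
    proof (rule mixed_slope_lower_bound[of "\<lambda>t c. - W (t, c)" "\<lambda>t c. - W1 (t, c)" "\<lambda>t c. - W2 (t, c)", OF _ _ that(2) L(2)])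
      show "- (L - 1) * h \<le> - W1 (x, c + h) - (- W1 (x, c))" if "0 < h" "h < \<delta>" for x h
        using L(3)[OF \<open>\<bar>c\<bar> \<le> R\<close> that, of x] by (simp add: algebra_simps)
    qed (intro DERIV_minus der_fst der_snd)+
    then show "W2 (t, c) - W2 (s, c) \<le> (L - 1) * (t - s)" by (simp add: algebra_simps)
  qed
  then show "\<exists>L>1. \<forall>s t c. \<bar>c\<bar> \<le> R \<and> s \<le> t \<longrightarrow>
    (1 / L - 1) * (t - s) \<le> W2 (t, c) - W2 (s, c) \<and> W2 (t, c) - W2 (s, c) \<le> (L - 1) * (t - s)"
    using L(1) by blast
qed

lemma lipschitz_foliation_d_theta:
  assumes "lipschitz_foliation \<eta>" shows "locally_lipschitz (d_theta u)"
  unfolding locally_lipschitz_def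
proof
  fix p
  obtain U L where U: "open U" "p \<in> U" "0 < L"
    "\<And>x y. x \<in> U \<Longrightarrow> y \<in> U \<Longrightarrow> dist (foliation_map \<eta> x) (foliation_map \<eta> y) \<le> L * dist x y"
    using assms unfolding lipschitz_foliation_def locally_bilipschitz_def by meson
  have "(L + 1)-lipschitz_on U (d_theta u)"
  proof (rule lipschitz_onI)
    fix x y assume "x \<in> U" "y \<in> U"
    have "d_theta u z = snd (foliation_map \<eta> z) - snd z" for z by (cases z) (simp add: foliation_map_eq)
    then have "dist (d_theta u x) (d_theta u y) \<le>
        dist (snd (foliation_map \<eta> x)) (snd (foliation_map \<eta> y)) + dist (snd x) (snd y)"
      by (simp add: dist_real_def)
    also have "\<dots> \<le> L * dist x y + dist x y"
      by (intro add_mono order_trans[OF dist_snd_le U(4)] dist_snd_le) fact+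
    finally show "dist (d_theta u x) (d_theta u y) \<le> (L + 1) * dist x y" by (simp add: algebra_simps)
  qed (use U in auto)
  then show "\<exists>U L. open U \<and> p \<in> U \<and> L-lipschitz_on U (d_theta u)" using U by blast
qed

lemma compact_reals_bound:
  fixes C :: "real set" assumes "compact C"
  obtains R where "\<And>c. c \<in> C \<Longrightarrow> \<bar>c\<bar> \<le> R"
  using compact_imp_bounded[OF assms] unfolding bounded_iff by auto

lemma angle_slopes_d_c_lipschitz:
  assumes angle_slopes "compact C"
  shows "\<exists>L. \<forall>c\<in>C. L-lipschitz_on UNIV (\<lambda>\<theta>. d_c u (\<theta>, c))"
proof -
  obtain R where R: "\<And>c. c \<in> C \<Longrightarrow> \<bar>c\<bar> \<le> R" using compact_reals_bound[OF assms(2)] by blast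
  obtain L where L: "L > 1" "\<And>s t c. \<bar>c\<bar> \<le> R \<Longrightarrow> s \<le> t \<Longrightarrow>
    (1 / L - 1) * (t - s) \<le> W2 (t, c) - W2 (s, c) \<and> W2 (t, c) - W2 (s, c) \<le> (L - 1) * (t - s)"
    using assms unfolding angle_slopes_def by meson
  have ord: "\<bar>W2 (t, c) - W2 (s, c)\<bar> \<le> L * (t - s)" if "\<bar>c\<bar> \<le> R" "s \<le> t" for s t c
  proof -
    have "(L - 1) * (t - s) \<le> L * (t - s)" using that by (intro mult_right_mono) auto
    moreover have "- L * (t - s) \<le> (1 / L - 1) * (t - s)"
    proof (intro mult_right_mono)
      have "0 < 1 / L" using L by simp
      then show "- L \<le> 1 / L - 1" using L by linarith
    qed (use that in auto)
    ultimately show ?thesis using L(2)[OF that] by (simp only: abs_le_iff) linarith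
  qed
  have "L-lipschitz_on UNIV (\<lambda>\<theta>. d_c u (\<theta>, c))" if "c \<in> C" for c
  proof (rule lipschitz_onI)
    fix x y :: circle
    obtain s where s: "to_circle s = y" using surj_to_circle by (metis surjD)
    obtain t where t: "to_circle t = x" "dist t s = dist x (to_circle s)" by (rule to_circle_lift_near)
    have "\<bar>W2 (t, c) - W2 (s, c)\<bar> \<le> L * \<bar>t - s\<bar>"
      using ord[OF R[OF that], of s t] ord[OF R[OF that], of t s] by (cases "s \<le> t") auto
    then show "dist (d_c u (x, c)) (d_c u (y, c)) \<le> L * dist x y"
      using s t by (simp add: annulus_cover_simp dist_real_def)
  qed (use L in auto)
  then show ?thesis by blast
qed

end

section \<open>Almost everywhere statements on the annulus\<close>

lemma sets_circle_lebesgue: "sets circle_lebesgue = sets borel"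
  by (simp add: circle_lebesgue_def)

lemma measurable_to_circle_restrict: "to_circle \<in> measurable (restrict_space lborel {0..<1}) borel"
  by (rule measurable_restrict_space1) simp

lemma finite_measure_circle_lebesgue: "finite_measure circle_lebesgue"
proof
  have "emeasure circle_lebesgue (space circle_lebesgue) = emeasure (restrict_space lborel {0..<1::real}) {0..<1}"
    unfolding circle_lebesgue_def using measurable_to_circle_restrict
    by (simp add: emeasure_distr space_restrict_space)
  also have "\<dots> = 1" by (simp add: emeasure_restrict_space)
  finally show "emeasure circle_lebesgue (space circle_lebesgue) \<noteq> \<infinity>" by simp
qed

lemma pair_sigma_finite_annulus: "pair_sigma_finite circle_lebesgue (lborel :: real measure)"
proof -
  interpret finite_measure circle_lebesgue by (rule finite_measure_circle_lebesgue)
  show ?thesis ..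
qed

lemma AE_circle_lebesgueD:
  assumes "AE \<theta> in circle_lebesgue. P \<theta>"
  shows "AE t in lborel. t \<in> {0..<1} \<longrightarrow> P (to_circle t)"
  using AE_distrD[OF measurable_to_circle_restrict assms[unfolded circle_lebesgue_def]]
  by (simp add: AE_restrict_space_iff)

lemma AE_circle_lebesgueI:
  assumes "{\<theta>. P \<theta>} \<in> sets borel" "AE t in lborel. t \<in> {0..<1} \<longrightarrow> P (to_circle t)"
  shows "AE \<theta> in circle_lebesgue. P \<theta>"
  unfolding circle_lebesgue_def
  using assms AE_distr_iff[OF measurable_to_circle_restrict, of P]
  by (simp add: AE_restrict_space_iff)

text \<open>The angle has to be the inner variable, since the conditions at hand concern derivatives in the
  angle for fixed \<open>c\<close>.\<close>

lemma AE_annulus_lebesgueD: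
  assumes "AE p in annulus_lebesgue. P p"
  shows "AE c in lborel. AE t in lborel. t \<in> {0..<1} \<longrightarrow> P (to_circle t, c)"
proof -
  interpret pair_sigma_finite circle_lebesgue "lborel :: real measure"
    by (rule pair_sigma_finite_annulus)
  interpret Q: pair_sigma_finite "lborel :: real measure" circle_lebesgue ..
  have "AE p in distr (lborel \<Otimes>\<^sub>M circle_lebesgue) (circle_lebesgue \<Otimes>\<^sub>M lborel) (\<lambda>(x, y). (y, x)). P p"
    using assms unfolding annulus_lebesgue_def by (subst distr_pair_swap[symmetric])
  from AE_distrD[OF measurable_pair_swap' this]
  have "AE p in lborel \<Otimes>\<^sub>M circle_lebesgue. P (snd p, fst p)"
    by (simp add: case_prod_beta')
  from Q.AE_pair[OF this] have "AE c in lborel. AE \<theta> in circle_lebesgue. P (\<theta>, c)" by simp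
  then show ?thesis by (rule eventually_mono) (rule AE_circle_lebesgueD)
qed

lemma AE_annulus_lebesgueI:
  assumes meas: "{p. P p} \<in> sets borel"
    and ae: "\<And>c. AE t in lborel. t \<in> {0..<1} \<longrightarrow> P (to_circle t, c)"
  shows "AE p in annulus_lebesgue. P p"
proof -
  interpret pair_sigma_finite circle_lebesgue "lborel :: real measure"
    by (rule pair_sigma_finite_annulus)
  have s: "sets (circle_lebesgue \<Otimes>\<^sub>M (lborel :: real measure)) = sets borel"
    by (metis borel_prod sets_circle_lebesgue sets_lborel sets_pair_measure_cong)
  have sp: "space (circle_lebesgue \<Otimes>\<^sub>M (lborel :: real measure)) = UNIV"
    by (simp add: space_pair_measure circle_lebesgue_def)
  have section_meas: "{\<theta>. P (\<theta>, c)} \<in> sets borel" for c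
  proof -
    have "(\<lambda>\<theta>. (\<theta>, c)) \<in> borel_measurable borel"
      by (intro borel_measurable_continuous_onI continuous_intros)
    from measurable_sets[OF this meas] show ?thesis by (simp add: vimage_def)
  qed
  have "AE c in lborel. AE \<theta> in circle_lebesgue. P (\<theta>, c)"
    by (rule AE_I2, rule AE_circle_lebesgueI[OF section_meas ae])
  then have "AE \<theta> in circle_lebesgue. AE c in lborel. P (\<theta>, c)"
    using AE_commute[of "\<lambda>\<theta> c. P (\<theta>, c)"] meas s sp by simp
  then show ?thesis
    unfolding annulus_lebesgue_def using meas s sp by (intro AE_pair_measure) auto
qed

lemma sets_oscillating_slopes:
  assumes [measurable]: "\<And>t. (\<lambda>p. f p t) \<in> borel_measurable M"
  shows "{p \<in> space M. oscillating_slopes (f p) x} \<in> sets M"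
  unfolding oscillating_slopes_def lower_slopes_below_def upper_slopes_above_def
  using countable_rat by measurable

section \<open>The almost everywhere bound and the Lipschitz condition\<close>

context generated_foliation
begin

text \<open>On each circle \<open>t + W2 (t, c)\<close> is biLipschitz, hence differentiable almost everywhere. The
  exceptional set is described by rational increments and so is a Borel set of the annulus, to which
  Fubini's theorem applies.\<close>

lemma angle_slopes_ae_bounds:
  assumes angle_slopes "compact K"
  shows "\<exists>k_plus k_minus. k_plus > k_minus \<and> k_minus > -1 \<and>
    (AE p in annulus_lebesgue. p \<in> K \<longrightarrow>
      (\<exists>d. ((\<lambda>t. d_c u (fst p + to_circle t, snd p)) has_real_derivative d) (at 0) \<and>
        k_plus \<ge> d \<and> d \<ge> k_minus))"
proof -
  have "compact (snd ` K)" by (intro compact_continuous_image continuous_intros assms)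
  then obtain R where R: "\<And>p. p \<in> K \<Longrightarrow> \<bar>snd p\<bar> \<le> R" by (rule compact_reals_bound) auto
  obtain L where L: "L > 1" "\<And>s t c. \<bar>c\<bar> \<le> R \<Longrightarrow> s \<le> t \<Longrightarrow>
    (1 / L - 1) * (t - s) \<le> W2 (t, c) - W2 (s, c) \<and> W2 (t, c) - W2 (s, c) \<le> (L - 1) * (t - s)"
    using assms unfolding angle_slopes_def by meson
  define f where "f p t = t + d_c u (fst p + to_circle t, snd p)" for p t
  define P where "P p \<longleftrightarrow> \<bar>snd p\<bar> \<le> R \<longrightarrow> \<not> oscillating_slopes (f p) 0" for p
  have f_lift: "f (to_circle s, c) t = (s + t + W2 (s + t, c)) - s" for s c t
    by (simp add: f_def annulus_cover_simp to_circle_add)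
  have cW: "continuous_on UNIV (\<lambda>t. t + W2 (t, c))" for c
    by (intro continuous_intros continuous_on_compose2[OF cont2]) auto
  have lo: "1 / L * (y - x) \<le> (y + W2 (y, c)) - (x + W2 (x, c))"
    and up: "(y + W2 (y, c)) - (x + W2 (x, c)) \<le> L * (y - x)" if "\<bar>c\<bar> \<le> R" "x < y" for x y c
  proof -
    have "(1 / L - 1) * (y - x) \<le> W2 (y, c) - W2 (x, c)" "W2 (y, c) - W2 (x, c) \<le> (L - 1) * (y - x)"
      using L(2)[of c x y] that by auto
    then show "1 / L * (y - x) \<le> (y + W2 (y, c)) - (x + W2 (x, c))"
      "(y + W2 (y, c)) - (x + W2 (x, c)) \<le> L * (y - x)" by (simp_all only: left_diff_distrib) auto
  qed
  have osc: "oscillating_slopes (f (to_circle s, c)) 0 \<longleftrightarrow> oscillating_slopes (\<lambda>t. t + W2 (t, c)) s" for s c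
  proof -
    have "f (to_circle s, c) (0 + h) - f (to_circle s, c) 0 = (s + h + W2 (s + h, c)) - (s + W2 (s, c))" for h
      by (simp add: f_lift)
    then show ?thesis
      unfolding oscillating_slopes_def lower_slopes_below_def upper_slopes_above_def by (simp only:)
  qed
  have "continuous_on UNIV (\<lambda>p. f p t)" for t
    unfolding continuous_on_annulus_iff f_def
  proof -
    have "(\<lambda>p. t + d_c u (fst p + to_circle t, snd p)) \<circ> annulus_cover = (\<lambda>p. t + W2 (fst p + t, snd p))"
      by (auto simp: annulus_cover_def to_circle_add)
    moreover have "continuous_on UNIV (\<lambda>p. t + W2 (fst p + t, snd p))"
      by (intro continuous_intros continuous_on_compose2[OF cont2]) auto
    ultimately show "continuous_on UNIV ((\<lambda>p. t + d_c u (fst p + to_circle t, snd p)) \<circ> annulus_cover)"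
      by simp
  qed
  then have fm: "(\<lambda>p. f p t) \<in> borel_measurable borel" for t by (rule borel_measurable_continuous_onI)
  have "{p. oscillating_slopes (f p) 0} \<in> sets borel"
    using sets_oscillating_slopes[of f borel 0, OF fm] by simp
  moreover have "{p :: annulus. \<bar>snd p\<bar> \<le> R} \<in> sets borel"
    by (intro borel_closed closed_Collect_le continuous_intros)
  moreover have "{p. P p} = - ({p. \<bar>snd p\<bar> \<le> R} \<inter> {p. oscillating_slopes (f p) 0})"
    by (auto simp: P_def simp del: split_paired_All)
  ultimately have "{p. P p} \<in> sets borel" by simp
  moreover have "AE t in lborel. t \<in> {0..<1} \<longrightarrow> P (to_circle t, c)" for c
  proof (cases "\<bar>c\<bar> \<le> R")
    case True
    have "negligible {t. oscillating_slopes (\<lambda>t. t + W2 (t, c)) t}"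
      by (rule oscillating_slopes_negligible[of "1 / L" _ L]) (use L(1) lo[OF True] up[OF True] in auto)
    then have "{t. oscillating_slopes (f (to_circle t, c)) 0} \<in> null_sets lebesgue"
      by (simp add: osc negligible_iff_null_sets)
    then have "AE t in lborel. t \<notin> {t. oscillating_slopes (f (to_circle t, c)) 0}"
      using AE_not_in AE_completion_iff by blast
    then show ?thesis by (rule eventually_mono) (auto simp: P_def)
  qed (simp add: P_def)
  ultimately have "AE p in annulus_lebesgue. P p" by (rule AE_annulus_lebesgueI)
  moreover have "\<exists>d. ((\<lambda>t. d_c u (fst p + to_circle t, snd p)) has_real_derivative d) (at 0) \<and> L - 1 \<ge> d \<and> d \<ge> 1 / L - 1"
    if "P p" "p \<in> K" for p
  proof -
    obtain s c where p: "p = annulus_cover (s, c)" using surj_annulus_cover by (metis surj_pair surjD)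
    have c: "\<bar>c\<bar> \<le> R" using R[OF that(2)] by (simp add: p annulus_cover_def)
    then have "\<not> oscillating_slopes (\<lambda>t. t + W2 (t, c)) s"
      using that(1) osc by (simp add: P_def p annulus_cover_simp)
    then obtain d where d: "((\<lambda>t. t + W2 (t, c)) has_real_derivative d) (at s)" "1 / L \<le> d" "d \<le> L"
      using differentiable_if_not_oscillating[OF cW, of "1 / L" c L s] lo[OF c] up[OF c] L(1) by auto
    have "((\<lambda>t. s + t + W2 (s + t, c)) has_real_derivative d) (at 0)"
      using d(1) DERIV_shift[of "\<lambda>t. t + W2 (t, c)" d 0 s] by (simp add: add.commute)
    then have "((\<lambda>t. (s + t + W2 (s + t, c)) - s - t) has_real_derivative d - 0 - 1) (at 0)"
      by (intro DERIV_diff DERIV_const DERIV_ident)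
    then have "((\<lambda>t. d_c u (fst p + to_circle t, snd p)) has_real_derivative d - 1) (at 0)"
      by (simp add: p annulus_cover_def to_circle_add)
    then show ?thesis using d(2,3) by (intro exI[of _ "d - 1"]) auto
  qed
  ultimately have "AE p in annulus_lebesgue. p \<in> K \<longrightarrow>
      (\<exists>d. ((\<lambda>t. d_c u (fst p + to_circle t, snd p)) has_real_derivative d) (at 0) \<and>
        L - 1 \<ge> d \<and> d \<ge> 1 / L - 1)"
    by (auto elim!: eventually_mono simp del: split_paired_All)
  moreover have "1 / L < 1" "0 < 1 / L" using L(1) by auto
  ultimately show ?thesis
    using L(1) by (intro exI[of _ "L - 1"] exI[of _ "1 / L - 1"] conjI) linarith+
qed

text \<open>The almost everywhere bound integrates to a bound on the increments of \<open>W2\<close> in \<open>t\<close> for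
  almost every \<open>c\<close>, by continuity for every \<open>c\<close>. Exchanging the two variables, this bounds the
  increments of \<open>W1\<close> in \<open>c\<close>.\<close>

lemma ae_bound_action_slope:
  assumes lip: "\<And>c. \<bar>c\<bar> < R \<Longrightarrow> L-lipschitz_on UNIV (\<lambda>\<theta>. d_c u (\<theta>, c))"
    and ae: "AE p in annulus_lebesgue. p \<in> UNIV \<times> {-R..R} \<longrightarrow>
      (\<exists>d. ((\<lambda>t. d_c u (fst p + to_circle t, snd p)) has_real_derivative d) (at 0) \<and> d \<ge> k)"
    and c: "c \<le> c'" "-R < c" "c' < R"
  shows "k * (c' - c) \<le> d_theta u (\<theta>, c') - d_theta u (\<theta>, c)"
proof -
  have slope_ae: "AE c in lborel. \<bar>c\<bar> < R \<longrightarrow> (\<forall>s t. 0 \<le> s \<and> s \<le> t \<and> t < 1 \<longrightarrow> k * (t - s) \<le> W2 (t, c) - W2 (s, c))"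
    using AE_annulus_lebesgueD[OF ae]
  proof (rule AE_mp, intro AE_I2 impI allI)
    fix c s t :: real
    assume A: "AE t in lborel. t \<in> {0..<1} \<longrightarrow> (to_circle t, c) \<in> UNIV \<times> {-R..R} \<longrightarrow>
      (\<exists>d. ((\<lambda>h. d_c u (fst (to_circle t, c) + to_circle h, snd (to_circle t, c))) has_real_derivative d) (at 0) \<and> d \<ge> k)"
      and c: "\<bar>c\<bar> < R" and st: "0 \<le> s \<and> s \<le> t \<and> t < 1"
    have "c \<in> {-R..R}" using c by auto
    then have A': "AE t in lborel. t \<in> {0..<1} \<longrightarrow>
      (\<exists>d. ((\<lambda>h. d_c u (to_circle t + to_circle h, c)) has_real_derivative d) (at 0) \<and> d \<ge> k)"
      using A by simp
    then obtain N where N: "N \<in> null_sets lborel" 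
      "{t. \<not> (t \<in> {0..<1} \<longrightarrow> (\<exists>d. ((\<lambda>h. d_c u (to_circle t + to_circle h, c)) has_real_derivative d) (at 0) \<and> d \<ge> k))} \<subseteq> N"
      by (auto simp: eventually_ae_filter)
    then have "negligible N"
      by (simp add: negligible_iff_null_sets null_sets_completionI)
    then show "k * (t - s) \<le> W2 (t, c) - W2 (s, c)"
    proof (rule slope_ge_of_ae_derivative_ge[where f = "\<lambda>t. W2 (t, c)"])
      show "s \<le> t" using st by simp
      show "\<bar>W2 (x, c) - W2 (y, c)\<bar> \<le> L * \<bar>x - y\<bar>" for x y
      proof -
        have "\<bar>W2 (x, c) - W2 (y, c)\<bar> \<le> L * dist (to_circle x) (to_circle y)"
          using lipschitz_onD[OF lip[OF c], of "to_circle x" "to_circle y"]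
          by (simp add: dist_real_def annulus_cover_simp)
        also have "\<dots> \<le> L * \<bar>x - y\<bar>"
          using dist_to_circle_le[of x y] lipschitz_on_nonneg[OF lip[OF c]]
          by (intro mult_left_mono) (auto simp: dist_real_def)
        finally show ?thesis .
      qed
      fix x assume "x \<in> {s..<t}" "x \<notin> N"
      then have "x \<in> {0..<1}" using st by auto
      then obtain d where d: "((\<lambda>h. d_c u (to_circle x + to_circle h, c)) has_real_derivative d) (at 0)" "d \<ge> k"
        using N(2) \<open>x \<notin> N\<close> by blast
      have "((\<lambda>h. W2 (h + x, c)) has_real_derivative d) (at 0)"
        using d(1) by (simp add: annulus_cover_simp to_circle_add add.commute)
      then have "((\<lambda>h. W2 (h, c)) has_real_derivative d) (at x)"
        using DERIV_shift[of "\<lambda>h. W2 (h, c)" d 0 x] by simp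
      then show "\<exists>d\<ge>k. ((\<lambda>t. W2 (t, c)) has_real_derivative d) (at x)" using d(2) by blast
    qed
  qed
  have slope: "k * (t - s) \<le> W2 (t, c) - W2 (s, c)" if st: "0 \<le> s" "s \<le> t" "t < 1" and c: "\<bar>c\<bar> < R" for s t c
  proof (rule ccontr)
    assume neg: "\<not> ?thesis"
    define D where "D c = W2 (t, c) - W2 (s, c)" for c
    have "continuous_on UNIV D"
      unfolding D_def by (intro continuous_intros continuous_on_compose2[OF cont2]) auto
    then have "open ({c. D c < k * (t - s)} \<inter> {-R<..<R})" (is "open ?O")
      by (intro open_Int open_Collect_less continuous_intros) auto
    moreover have "c \<in> ?O" using neg c by (auto simp: D_def)
    ultimately have "\<not> negligible ?O" using open_not_negligible by blast
    moreover have "AE c in lborel. c \<notin> ?O"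
      using slope_ae
    proof (rule eventually_mono)
      fix c assume *: "\<bar>c\<bar> < R \<longrightarrow> (\<forall>s t. 0 \<le> s \<and> s \<le> t \<and> t < 1 \<longrightarrow> k * (t - s) \<le> W2 (t, c) - W2 (s, c))"
      show "c \<notin> ?O"
      proof
        assume O: "c \<in> ?O"
        then have "k * (t - s) \<le> W2 (t, c) - W2 (s, c)" using * st by (simp add: abs_less_iff)
        then show False using O by (simp add: D_def)
      qed
    qed
    then have "?O \<in> null_sets lborel"
      using \<open>open ?O\<close> by (subst AE_iff_null_sets) auto
    then have "negligible ?O" by (simp add: negligible_iff_null_sets null_sets_completionI)
    ultimately show False by simp
  qed
  obtain s where s: "to_circle s = \<theta>" "0 \<le> s" "s < 1" by (rule to_circle_lift_unit)
  have "k * (c' - c) \<le> W1 (s, c') - W1 (s, c)"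
  proof (rule mixed_slope_lower_bound[of "\<lambda>c t. W (t, c)" "\<lambda>c t. W2 (t, c)" "\<lambda>c t. W1 (t, c)", OF der_snd der_fst c(1)])
    show "0 < 1 - s" using s by simp
    show "k * h \<le> W2 (s + h, x) - W2 (s, x)" if "x \<in> {c..c'}" "0 < h" "h < 1 - s" for x h
      using slope[of s "s + h" x] that s c by auto
  qed
  then show ?thesis by (simp add: annulus_cover_simp s)
qed

text \<open>The lower bound says that the leaves separate at a definite rate in the vertical direction;
  together with the Lipschitz bound of the leaves this makes the inverse of the foliation map
  Lipschitz.\<close>

lemma lipschitz_foliationI:
  assumes d_theta: "locally_lipschitz (d_theta u)"
    and d_c: "\<And>C. compact C \<Longrightarrow> \<exists>L. \<forall>c\<in>C. L-lipschitz_on UNIV (\<lambda>\<theta>. d_c u (\<theta>, c))"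
    and ae: "\<And>K. compact K \<Longrightarrow> \<exists>k_plus k_minus. k_plus > k_minus \<and> k_minus > -1 \<and>
      (AE p in annulus_lebesgue. p \<in> K \<longrightarrow>
        (\<exists>d. ((\<lambda>t. d_c u (fst p + to_circle t, snd p)) has_real_derivative d) (at 0) \<and>
          k_plus \<ge> d \<and> d \<ge> k_minus))"
  shows "lipschitz_foliation \<eta>"
  unfolding lipschitz_foliation_def locally_bilipschitz_def
proof (intro conjI foliation allI)
  fix p :: annulus
  obtain \<theta>0 c0 where p: "p = (\<theta>0, c0)" by fastforce
  define R where "R = \<bar>c0\<bar> + 1"
  have "compact {-R..R}" by simp
  from d_c[OF this] obtain L where "\<forall>c\<in>{-R..R}. L-lipschitz_on UNIV (\<lambda>\<theta>. d_c u (\<theta>, c))"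
    by blast
  then have L: "L-lipschitz_on UNIV (\<lambda>\<theta>. d_c u (\<theta>, c))" if "\<bar>c\<bar> < R" for c
    using that by (auto simp: abs_less_iff)
  have "compact ((UNIV :: circle set) \<times> {-R..R})" by (intro compact_Times compact_circle) auto
  from ae[OF this] obtain k k' where k: "k > -1"
    and aek: "AE p in annulus_lebesgue. p \<in> UNIV \<times> {-R..R} \<longrightarrow>
        (\<exists>d. ((\<lambda>t. d_c u (fst p + to_circle t, snd p)) has_real_derivative d) (at 0) \<and>
          k' \<ge> d \<and> d \<ge> k)" by auto
  have ae': "AE p in annulus_lebesgue. p \<in> UNIV \<times> {-R..R} \<longrightarrow>
        (\<exists>d. ((\<lambda>t. d_c u (fst p + to_circle t, snd p)) has_real_derivative d) (at 0) \<and> d \<ge> k)"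
    using aek by (rule eventually_mono) blast
  obtain V M where V: "open V" "p \<in> V" "M-lipschitz_on V (d_theta u)"
    using d_theta unfolding locally_lipschitz_def by blast
  have "open (V \<inter> UNIV \<times> {-R<..<R})" "p \<in> V \<inter> UNIV \<times> {-R<..<R}"
    using V by (auto simp: p R_def abs_less_iff intro!: open_Int open_Times)
  then obtain A B where AB: "open A" "open B" "p \<in> A \<times> B" "A \<times> B \<subseteq> V \<inter> UNIV \<times> {-R<..<R}"
    by (rule open_prod_elim)
  have M: "0 \<le> M" using V(3) by (rule lipschitz_on_nonneg)
  have lipV: "\<bar>d_theta u x - d_theta u y\<bar> \<le> M * dist x y" if "x \<in> V" "y \<in> V" for x y
    using lipschitz_onD[OF V(3) that] by (simp add: dist_real_def)
  define m where "m = 1 + k"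
  have "m > 0" using k by (simp add: m_def)
  define N where "N = max (M + 2) (1 + (1 + M) / m)"
  have "N > 0" using M by (simp add: N_def)
  have sep: "m * \<bar>c - c'\<bar> \<le> \<bar>(c + d_theta u (\<theta>, c)) - (c' + d_theta u (\<theta>, c'))\<bar>" if "\<bar>c\<bar> < R" "\<bar>c'\<bar> < R" for c c' \<theta>
  proof -
    have *: "m * (b - a) \<le> (b + d_theta u (\<theta>, b)) - (a + d_theta u (\<theta>, a))"
      if "a \<le> b" "\<bar>a\<bar> < R" "\<bar>b\<bar> < R" for a b
      using ae_bound_action_slope[OF L ae' that(1), of \<theta>] that(2,3)
      by (simp add: m_def distrib_right abs_less_iff)
    show ?thesis
      using *[of c c'] *[of c' c] that by (cases "c \<le> c'") (simp_all add: abs_if)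
  qed
  show "\<exists>U L. open U \<and> p \<in> U \<and> 0 < L \<and> (\<forall>x\<in>U. \<forall>y\<in>U.
    dist x y / L \<le> dist (foliation_map \<eta> x) (foliation_map \<eta> y) \<and>
    dist (foliation_map \<eta> x) (foliation_map \<eta> y) \<le> L * dist x y)"
  proof (intro exI[of _ "A \<times> B"] exI[of _ N] conjI ballI)
    show "open (A \<times> B)" "p \<in> A \<times> B" "0 < N" using AB \<open>N > 0\<close> by (auto intro: open_Times)
    fix x y assume xy: "x \<in> A \<times> B" "y \<in> A \<times> B"
    obtain \<theta> c \<theta>' c' where x: "x = (\<theta>, c)" and y: "y = (\<theta>', c')" by fastforce
    let ?a = "c + d_theta u (\<theta>, c)" and ?b = "c' + d_theta u (\<theta>', c')"
    have Fx: "foliation_map \<eta> x = (\<theta>, ?a)" and Fy: "foliation_map \<eta> y = (\<theta>', ?b)"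
      by (simp_all add: x y foliation_map_eq)
    have xyV: "x \<in> V" "y \<in> V" "(\<theta>, c') \<in> V" "\<bar>c\<bar> < R" "\<bar>c'\<bar> < R"
      using xy AB(4) by (auto simp: x y abs_less_iff)
    have dd: "dist (q :: annulus) q' \<le> dist (fst q) (fst q') + \<bar>snd q - snd q'\<bar>" for q q'
      unfolding dist_prod_def by (rule order_trans[OF sqrt_sum_squares_le_sum]) (auto simp: dist_real_def)
    have ds: "\<bar>snd q - snd q'\<bar> \<le> dist q q'" for q q' :: annulus
      using dist_snd_le[of q q'] by (simp add: dist_real_def)
    have "dist (foliation_map \<eta> x) (foliation_map \<eta> y) \<le> dist \<theta> \<theta>' + \<bar>?a - ?b\<bar>"
      using dd[of "(\<theta>, ?a)" "(\<theta>', ?b)"] by (simp add: Fx Fy)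
    also have "\<dots> \<le> dist x y + (dist x y + M * dist x y)"
      using dist_fst_le[of x y] ds[of x y] lipV[OF xyV(1,2)] by (simp add: x y)
    also have "\<dots> = (M + 2) * dist x y" by (simp add: algebra_simps)
    also have "\<dots> \<le> N * dist x y" by (intro mult_right_mono) (auto simp: N_def)
    finally show "dist (foliation_map \<eta> x) (foliation_map \<eta> y) \<le> N * dist x y" .
    let ?D = "dist (foliation_map \<eta> x) (foliation_map \<eta> y)"
    have 1: "dist \<theta> \<theta>' \<le> ?D" "\<bar>?a - ?b\<bar> \<le> ?D"
      using dist_fst_le[of "foliation_map \<eta> x" "foliation_map \<eta> y"] ds[of "foliation_map \<eta> x" "foliation_map \<eta> y"]
      by (simp_all add: Fx Fy)
    have "m * \<bar>c - c'\<bar> \<le> \<bar>?a - (c' + d_theta u (\<theta>, c'))\<bar>" by (rule sep[OF xyV(4,5)])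
    also have "\<dots> \<le> \<bar>?a - ?b\<bar> + \<bar>d_theta u (\<theta>, c') - d_theta u (\<theta>', c')\<bar>" by linarith
    also have "\<dots> \<le> ?D + M * dist \<theta> \<theta>'"
      using 1(2) lipV[OF xyV(3,2)] by (intro add_mono) (auto simp: y dist_prod_def)
    also have "\<dots> \<le> ?D + M * ?D" using 1(1) M by (intro add_mono mult_left_mono) auto
    finally have "\<bar>c - c'\<bar> \<le> (1 + M) / m * ?D"
      using \<open>m > 0\<close> by (simp add: pos_le_divide_eq algebra_simps)
    then have "dist x y \<le> ?D + (1 + M) / m * ?D"
      using dd[of x y] 1(1) by (simp add: x y)
    also have "\<dots> = (1 + (1 + M) / m) * ?D" by (simp add: algebra_simps)
    also have "\<dots> \<le> N * ?D" by (intro mult_right_mono) (auto simp: N_def)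
    finally show "dist x y / N \<le> ?D" using \<open>N > 0\<close> by (simp add: pos_divide_le_eq mult.commute)
  qed
qed

end

section \<open>Smooth approximation of the mixed derivative\<close>

lemma periodic_jet_add:
  assumes "periodic_jet V V1 V2 V11 V12 V22" "periodic_jet W W1 W2 W11 W12 W22"
  shows "periodic_jet (\<lambda>p. V p + W p) (\<lambda>p. V1 p + W1 p) (\<lambda>p. V2 p + W2 p)
    (\<lambda>p. V11 p + W11 p) (\<lambda>p. V12 p + W12 p) (\<lambda>p. V22 p + W22 p)"
proof -
  interpret V: periodic_jet V V1 V2 V11 V12 V22 by fact
  interpret W: periodic_jet W W1 W2 W11 W12 W22 by fact
  show ?thesis
  proof
    fix p :: "real \<times> real" and k t c
    show "((\<lambda>p. V p + W p) has_derivative (\<lambda>v. (V1 p + W1 p) * fst v + (V2 p + W2 p) * snd v)) (at p)"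
      by (rule has_derivative_eq_rhs[OF has_derivative_add[OF V.der0 W.der0]]) (auto simp: algebra_simps)
    show "((\<lambda>p. V1 p + W1 p) has_derivative (\<lambda>v. (V11 p + W11 p) * fst v + (V12 p + W12 p) * snd v)) (at p)"
      by (rule has_derivative_eq_rhs[OF has_derivative_add[OF V.der1 W.der1]]) (auto simp: algebra_simps)
    show "((\<lambda>p. V2 p + W2 p) has_derivative (\<lambda>v. (V12 p + W12 p) * fst v + (V22 p + W22 p) * snd v)) (at p)"
      by (rule has_derivative_eq_rhs[OF has_derivative_add[OF V.der2 W.der2]]) (auto simp: algebra_simps)
    show "C_k k (\<lambda>p. V11 p + W11 p)" "C_k k (\<lambda>p. V12 p + W12 p)" "C_k k (\<lambda>p. V22 p + W22 p)"
      by (intro C_k_add V.smooth W.smooth)+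
    show "V (t + 1, c) + W (t + 1, c) = V (t, c) + W (t, c)" by (simp only: V.per0 W.per0)
  qed
qed

lemma has_derivative_fst_snd:
  assumes "(a has_real_derivative a') (at (fst p))" "(b has_real_derivative b') (at (snd p))"
  shows "((\<lambda>p. a (fst p) * b (snd p)) has_derivative
    (\<lambda>v. a' * b (snd p) * fst v + a (fst p) * b' * snd v)) (at p)"
proof -
  have "((\<lambda>p. a (fst p)) has_derivative (\<lambda>v. a' * fst v)) (at p)"
    using has_derivative_compose[OF has_derivative_fst[OF has_derivative_ident], of a "\<lambda>v. a' * v" p UNIV] assms(1)
    by (simp add: has_field_derivative_def)
  moreover have "((\<lambda>p. b (snd p)) has_derivative (\<lambda>v. b' * snd v)) (at p)"
    using has_derivative_compose[OF has_derivative_snd[OF has_derivative_ident], of b "\<lambda>v. b' * v" p UNIV] assms(2)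
    by (simp add: has_field_derivative_def)
  ultimately show ?thesis
    by (rule has_derivative_eq_rhs[OF has_derivative_mult]) (auto simp: algebra_simps)
qed

lemma C_k_of_fst: "C_k k f \<Longrightarrow> C_k k (\<lambda>p::real \<times> real. f (fst p))" for f :: "real \<Rightarrow> real"
  by (rule C_k_compose[where g = fst]) (assumption, rule C_k_bounded_linear[OF bounded_linear_fst])

lemma C_k_of_snd: "C_k k f \<Longrightarrow> C_k k (\<lambda>p::real \<times> real. f (snd p))" for f :: "real \<Rightarrow> real"
  by (rule C_k_compose[where g = snd]) (assumption, rule C_k_bounded_linear[OF bounded_linear_snd])

lemma periodic_jet_product:
  fixes a b :: "real \<Rightarrow> real"
  assumes a: "\<And>t. (a has_real_derivative a1 t) (at t)" "\<And>t. (a1 has_real_derivative a2 t) (at t)"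
    and b: "\<And>c. (b has_real_derivative b1 c) (at c)" "\<And>c. (b1 has_real_derivative b2 c) (at c)"
    and smooth: "\<And>k. C_k k a2" "\<And>k. C_k k b2"
    and per: "\<And>t. a (t + 1) = a t"
  shows "periodic_jet (\<lambda>p. a (fst p) * b (snd p)) (\<lambda>p. a1 (fst p) * b (snd p)) (\<lambda>p. a (fst p) * b1 (snd p))
    (\<lambda>p. a2 (fst p) * b (snd p)) (\<lambda>p. a1 (fst p) * b1 (snd p)) (\<lambda>p. a (fst p) * b2 (snd p))"
proof
  have s: "C_k k a1" "C_k k b1" for k
    using C_k_antiderivative[OF a(2) smooth(1)] C_k_antiderivative[OF b(2) smooth(2)] C_k_Suc_imp by blast+
  have s': "C_k k a" "C_k k b" for k
    using C_k_antiderivative[OF a(1) s(1)] C_k_antiderivative[OF b(1) s(2)] C_k_Suc_imp by blast+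
  show "C_k k (\<lambda>p. a2 (fst p) * b (snd p))" "C_k k (\<lambda>p. a1 (fst p) * b1 (snd p))"
    "C_k k (\<lambda>p. a (fst p) * b2 (snd p))" for k
    by (rule C_k_mult C_k_of_fst[OF smooth(1)] C_k_of_fst[OF s(1)] C_k_of_fst[OF s'(1)]
        C_k_of_snd[OF smooth(2)] C_k_of_snd[OF s(2)] C_k_of_snd[OF s'(2)])+
qed (use a b per in \<open>auto intro!: has_derivative_fst_snd\<close>)

text \<open>Reparametrising the second variable by a function with values in a compact interval
  globalises a function that is only controlled there.\<close>

lemma periodic_jet_reparametrize:
  assumes "periodic_jet V V1 V2 V11 V12 V22"
    and s: "\<And>c. (s has_real_derivative s1 c) (at c)" "\<And>c. (s1 has_real_derivative s2 c) (at c)"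
    and smooth_s: "\<And>k. C_k k s2"
  shows "periodic_jet (\<lambda>p. V (fst p, s (snd p))) (\<lambda>p. V1 (fst p, s (snd p))) (\<lambda>p. V2 (fst p, s (snd p)) * s1 (snd p))
    (\<lambda>p. V11 (fst p, s (snd p))) (\<lambda>p. V12 (fst p, s (snd p)) * s1 (snd p))
    (\<lambda>p. V22 (fst p, s (snd p)) * s1 (snd p) * s1 (snd p) + V2 (fst p, s (snd p)) * s2 (snd p))"
proof -
  interpret V: periodic_jet V V1 V2 V11 V12 V22 by fact
  have ss: "C_k k s1" for k
    using C_k_antiderivative[OF s(2) smooth_s] C_k_Suc_imp by blast
  have ss': "C_k k s" for k
    using C_k_antiderivative[OF s(1) ss] C_k_Suc_imp by blast

  have comp: "C_k k (\<lambda>p. f (fst p, s (snd p)))" if "C_k k f" for f :: "real \<times> real \<Rightarrow> real" and k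
    by (rule C_k_compose[OF that]) (intro C_k_Pair C_k_of_snd[OF ss'] C_k_fst C_k_id)
  have ds: "((\<lambda>p. f (snd p)) has_derivative (\<lambda>v. f' * snd v)) (at p)"
    if "(f has_real_derivative f') (at (snd p))" for f f' and p :: "real \<times> real"
    using has_derivative_compose[OF has_derivative_snd[OF has_derivative_ident], of f "\<lambda>v. f' * v" p UNIV] that
    by (simp add: has_field_derivative_def)
  have dc: "((\<lambda>p. f (fst p, s (snd p))) has_derivative (\<lambda>v. x * fst v + y * (s1 (snd p) * snd v))) (at p)"
    if "(f has_derivative (\<lambda>v. x * fst v + y * snd v)) (at (fst p, s (snd p)))" for f :: "real \<times> real \<Rightarrow> real" and x y p
    using has_derivative_compose[OF has_derivative_Pair[OF has_derivative_fst[OF has_derivative_ident] ds[OF s(1)]] that]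
    by simp
  show ?thesis
  proof
    fix p :: "real \<times> real" and k t c
    show "((\<lambda>p. V (fst p, s (snd p))) has_derivative
      (\<lambda>v. V1 (fst p, s (snd p)) * fst v + V2 (fst p, s (snd p)) * s1 (snd p) * snd v)) (at p)"
      using dc[OF V.der0] by (simp only: mult.assoc)
    show "((\<lambda>p. V1 (fst p, s (snd p))) has_derivative
      (\<lambda>v. V11 (fst p, s (snd p)) * fst v + V12 (fst p, s (snd p)) * s1 (snd p) * snd v)) (at p)"
      using dc[OF V.der1] by (simp only: mult.assoc)
    show "((\<lambda>p. V2 (fst p, s (snd p)) * s1 (snd p)) has_derivative
      (\<lambda>v. V12 (fst p, s (snd p)) * s1 (snd p) * fst v +
        (V22 (fst p, s (snd p)) * s1 (snd p) * s1 (snd p) + V2 (fst p, s (snd p)) * s2 (snd p)) * snd v)) (at p)"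
      by (rule has_derivative_eq_rhs[OF has_derivative_mult[OF dc[OF V.der2] ds[OF s(2)]]])
        (auto simp: algebra_simps)
    show "C_k k (\<lambda>p. V11 (fst p, s (snd p)))" "C_k k (\<lambda>p. V12 (fst p, s (snd p)) * s1 (snd p))"
      "C_k k (\<lambda>p. V22 (fst p, s (snd p)) * s1 (snd p) * s1 (snd p) + V2 (fst p, s (snd p)) * s2 (snd p))"
      by (rule C_k_add C_k_mult comp[OF V.smooth(1)] comp[OF V.smooth(2)] comp[OF V.smooth(3)]
          comp[OF V.smooth_W12(2)] C_k_of_snd[OF ss] C_k_of_snd[OF smooth_s])+
    show "V (fst (t + 1, c), s (snd (t + 1, c))) = V (fst (t, c), s (snd (t, c)))"
      by (simp add: V.per0)
  qed
qed

lemma antiderivative_exists: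
  fixes f :: "real \<Rightarrow> real"
  assumes "continuous_on UNIV f"
  obtains F where "\<And>x. (F has_real_derivative f x) (at x)"
proof -
  have "\<exists>F. \<forall>x::real. -\<infinity> < ereal x \<longrightarrow> ereal x < \<infinity> \<longrightarrow> (F has_vector_derivative f x) (at x)"
    using assms by (intro einterval_antiderivative) (auto simp: continuous_on_eq_continuous_at)
  then show ?thesis using that by (auto simp: has_real_derivative_iff_has_vector_derivative)
qed

text \<open>The class of smooth functions on the annulus that are polynomial in the second variable is a
  ring separating points, and its members can be integrated explicitly in both variables.\<close>

inductive smooth_fibre_polynomial :: "(annulus \<Rightarrow> real) \<Rightarrow> bool" where
  monomial: "(\<And>k. C_k k (\<alpha> \<circ> to_circle)) \<Longrightarrow> smooth_fibre_polynomial (\<lambda>p. \<alpha> (fst p) * snd p ^ i)"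
| add: "smooth_fibre_polynomial f \<Longrightarrow> smooth_fibre_polynomial g \<Longrightarrow> smooth_fibre_polynomial (\<lambda>p. f p + g p)"

lemma smooth_fibre_polynomial_mult:
  assumes "smooth_fibre_polynomial f" "smooth_fibre_polynomial g"
  shows "smooth_fibre_polynomial (\<lambda>p. f p * g p)"
  using assms
proof (induction arbitrary: g)
  case (monomial \<alpha> i)
  from monomial.prems show ?case
  proof induction
    case (monomial \<beta> j)
    have "C_k k ((\<lambda>\<theta>. \<alpha> \<theta> * \<beta> \<theta>) \<circ> to_circle)" for k
      using C_k_mult[OF \<open>C_k k (\<alpha> \<circ> to_circle)\<close> \<open>C_k k (\<beta> \<circ> to_circle)\<close>] by (simp add: o_def)
    from smooth_fibre_polynomial.monomial[OF this, of "i + j"] show ?case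
      by (simp add: power_add mult_ac)
  next
    case (add f g)
    from smooth_fibre_polynomial.add[OF add.IH] show ?case by (simp add: distrib_left)
  qed
next
  case (add f h)
  from smooth_fibre_polynomial.add[OF add.IH(1,2)[OF add.prems]] show ?case by (simp add: distrib_right)
qed

lemma smooth_fibre_polynomial_continuous:
  assumes "smooth_fibre_polynomial f" shows "continuous_on UNIV f"
  using assms
proof induction
  case (monomial \<alpha> i)
  have "(\<lambda>p. \<alpha> (fst p) * snd p ^ i) \<circ> annulus_cover = (\<lambda>p. (\<alpha> \<circ> to_circle) (fst p) * snd p ^ i)"
    by (auto simp: annulus_cover_def)
  moreover have "continuous_on UNIV (\<alpha> \<circ> to_circle)" using C_k_imp_continuous monomial by blast
  then have "continuous_on UNIV (\<lambda>p::real\<times>real. (\<alpha> \<circ> to_circle) (fst p) * snd p ^ i)"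
    by (intro continuous_on_mult continuous_on_power continuous_on_snd continuous_on_id
        continuous_on_compose2[OF _ continuous_on_fst[OF continuous_on_id]]) auto
  ultimately show ?case unfolding continuous_on_annulus_iff by simp
qed (rule continuous_on_add)

lemma smooth_fibre_polynomial_separates:
  fixes x y :: annulus
  assumes "x \<noteq> y" shows "\<exists>f. smooth_fibre_polynomial f \<and> f x \<noteq> f y"
proof (cases "snd x = snd y")
  case False
  have "smooth_fibre_polynomial (\<lambda>p. (\<lambda>_. 1) (fst p) * snd p ^ 1)"
    by (rule smooth_fibre_polynomial.monomial) (simp add: o_def C_k_const)
  then show ?thesis using False by (intro exI[of _ "\<lambda>p. (\<lambda>_. 1) (fst p) * snd p ^ 1"]) simp
next
  case True
  then have ne: "fst x \<noteq> fst y" using assms by (simp add: prod_eq_iff)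
  obtain s t where st: "fst x = to_circle s" "fst y = to_circle t"
    using surj_to_circle by (metis surjD)
  have *: "\<exists>\<alpha>. \<alpha> \<circ> to_circle = f" if "\<And>t. f (t + 1) = f t" for f :: "real \<Rightarrow> real"
  proof (intro exI ext)
    fix t
    have "(\<lambda>\<theta>. descend (\<lambda>p. f (fst p)) (\<theta>, 0)) (to_circle t) = descend (\<lambda>p. f (fst p)) (annulus_cover (t, 0))"
      by (simp add: annulus_cover_simp)
    also have "\<dots> = f t" using descend_cover[of "\<lambda>p. f (fst p)" "(t, 0)"] that by simp
    finally show "((\<lambda>\<theta>. descend (\<lambda>p. f (fst p)) (\<theta>, 0)) \<circ> to_circle) t = f t" by simp
  qed
  have mono: ?thesis if f: "\<And>t. f (t + 1) = f t" "\<And>k. C_k k f" "f s \<noteq> f t" for f :: "real \<Rightarrow> real"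
  proof -
    obtain \<alpha> where \<alpha>: "\<alpha> \<circ> to_circle = f" using *[of f] f(1) by blast
    have "smooth_fibre_polynomial (\<lambda>p. \<alpha> (fst p) * snd p ^ 0)"
      by (rule smooth_fibre_polynomial.monomial) (simp add: \<alpha> f(2))
    moreover have "\<alpha> (fst x) \<noteq> \<alpha> (fst y)"
      using f(3) st fun_cong[OF \<alpha>, of s] fun_cong[OF \<alpha>, of t] by simp
    ultimately show ?thesis by (intro exI[of _ "\<lambda>p. \<alpha> (fst p) * snd p ^ 0"]) simp
  qed
  have per: "2 * pi * (t + 1) = 2 * pi * t + 2 * pi" for t :: real by (simp add: algebra_simps)
  have lin: "C_k k (\<lambda>t::real. 2 * pi * t)" for k
    by (rule C_k_bounded_linear) (rule bounded_linear_mult_right)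
  have "\<not> (sin (2 * pi * s) = sin (2 * pi * t) \<and> cos (2 * pi * s) = cos (2 * pi * t))"
  proof
    assume "sin (2 * pi * s) = sin (2 * pi * t) \<and> cos (2 * pi * s) = cos (2 * pi * t)"
    then obtain n :: int where "2 * pi * s = 2 * pi * t + 2 * pi * n" by (auto simp: sin_cos_eq_iff)
    then have "2 * pi * s = 2 * pi * (t + n)" by (simp add: distrib_left)
    then have "s = t + n" by simp
    then show False using ne st to_circle_add_int by simp
  qed
  then show ?thesis
    using mono[of "\<lambda>t. sin (2 * pi * t)"] mono[of "\<lambda>t. cos (2 * pi * t)"]
      C_k_compose[OF conjunct1[OF C_k_sin_cos] lin] C_k_compose[OF conjunct2[OF C_k_sin_cos] lin]
    by (auto simp: per)
qed

lemma smooth_fibre_polynomial_dense: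
  assumes "continuous_on UNIV g" "0 < e"
  obtains f where "smooth_fibre_polynomial f" "\<And>\<theta> c. \<bar>c\<bar> \<le> M \<Longrightarrow> \<bar>g (\<theta>, c) - f (\<theta>, c)\<bar> < e"
proof -
  have "\<exists>f. smooth_fibre_polynomial f \<and> (\<forall>p\<in>UNIV \<times> {-M..M}. \<bar>g p - f p\<bar> < e)"
  proof (rule Stone_Weierstrass_HOL)
    show "compact ((UNIV :: circle set) \<times> {-M..M})" by (intro compact_Times compact_circle) auto
    show "smooth_fibre_polynomial (\<lambda>_. c)" for c
      using smooth_fibre_polynomial.monomial[of "\<lambda>_. c" 0] by (simp add: o_def C_k_const)
    show "continuous_on (UNIV \<times> {-M..M}) f" if "smooth_fibre_polynomial f" for f
      using smooth_fibre_polynomial_continuous[OF that] continuous_on_subset by blast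
    show "continuous_on (UNIV \<times> {-M..M}) g" using assms(1) continuous_on_subset by blast
  qed (use assms smooth_fibre_polynomial.add smooth_fibre_polynomial_mult smooth_fibre_polynomial_separates in auto)
  then show ?thesis using that by (auto simp: abs_le_iff)
qed

text \<open>Subtracting the mean value makes the primitive periodic.\<close>

lemma smooth_circle_antiderivative:
  assumes "\<And>k. C_k k (\<alpha> \<circ> to_circle)"
  shows "\<exists>a a2 \<mu>. (\<forall>t. (a has_real_derivative \<alpha> (to_circle t) - \<mu>) (at t)) \<and>
    (\<forall>t. ((\<lambda>t. \<alpha> (to_circle t) - \<mu>) has_real_derivative a2 t) (at t)) \<and>
    (\<forall>k. C_k k a2) \<and> (\<forall>t. a (t + 1) = a t) \<and> a (0 :: real) = 0"
proof -
  let ?\<alpha> = "\<alpha> \<circ> to_circle"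
  have "continuous_on UNIV ?\<alpha>" using C_k_imp_continuous assms by blast
  then obtain A where A: "\<And>t. (A has_real_derivative ?\<alpha> t) (at t)" by (rule antiderivative_exists) blast
  define \<mu> where "\<mu> = A 1 - A 0"
  define a where "a t = A t - A 0 - \<mu> * t" for t
  have da: "(a has_real_derivative \<alpha> (to_circle t) - \<mu>) (at t)" for t
    unfolding a_def using A[of t] by (auto intro!: derivative_eq_intros)
  have per: "a (t + 1) = a t" for t
  proof -
    have "((\<lambda>t. a (t + 1) - a t) has_real_derivative 0) (at t)" for t
    proof -
      have "((\<lambda>t. a (t + 1)) has_real_derivative \<alpha> (to_circle t) - \<mu>) (at t)"
        using da[of "t + 1"] to_circle_add_int[of t 1] DERIV_shift[of a _ t 1] by simp
      from DERIV_diff[OF this da[of t]] show ?thesis by simp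
    qed
    then have "a (t + 1) - a t = a (0 + 1) - a 0" by (rule DERIV_isconst_all[of "\<lambda>t. a (t + 1) - a t", rule_format])
    also have "\<dots> = 0" by (simp add: a_def \<mu>_def)
    finally show ?thesis by simp
  qed
  obtain D where D: "\<And>t. (?\<alpha> has_derivative D t) (at t)"
    using assms[of 1] by auto
  define a2 where "a2 t = D t 1" for t
  have da2: "(?\<alpha> has_real_derivative a2 t) (at t)" for t
  proof -
    have "D t v = a2 t * v" for v
      using linear_cmul[OF has_derivative_linear[OF D], of t v 1] by (simp add: a2_def mult.commute)
    then show ?thesis using D[of t] by (metis ext has_field_derivative_def)
  qed
  have sm: "C_k k a2" for k
  proof -
    obtain D' where D': "\<And>t. (?\<alpha> has_derivative D' t) (at t)" "\<And>v. C_k k (\<lambda>t. D' t v)"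
      using assms[of "Suc k"] by auto
    have "D' t = D t" for t using has_derivative_unique[OF D'(1) D] .
    then show ?thesis using D'(2)[of 1] by (simp add: a2_def[abs_def])
  qed
  show ?thesis
  proof (rule exI[of _ a], rule exI[of _ a2], rule exI[of _ \<mu>], intro conjI allI)
    show "((\<lambda>t. \<alpha> (to_circle t) - \<mu>) has_real_derivative a2 t) (at t)" for t
      using DERIV_diff[OF da2 DERIV_const, of \<mu> t] by (simp only: o_def diff_0_right)
  qed (use da sm per in \<open>auto simp: a_def\<close>)
qed

lemma smooth_fibre_polynomial_integral:
  assumes "smooth_fibre_polynomial f"
  shows "\<exists>Q Q1 Q2 Q11 Q12 Q22 \<mu>. periodic_jet Q Q1 Q2 Q11 Q12 Q22 \<and>
    (\<forall>t c. Q12 (t, c) = f (to_circle t, c) - \<mu> c) \<and> (\<forall>t. Q1 (t, 0) = 0) \<and> (\<forall>c. Q2 (0, c) = 0)"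
  using assms
proof induction
  case (monomial \<alpha> i)
  obtain a a2 \<mu> where a: "\<And>t. (a has_real_derivative \<alpha> (to_circle t) - \<mu>) (at t)"
    "\<And>t. ((\<lambda>t. \<alpha> (to_circle t) - \<mu>) has_real_derivative a2 t) (at t)"
    "\<And>k. C_k k a2" "\<And>t. a (t + 1) = a t" "a 0 = 0"
    using smooth_circle_antiderivative[OF monomial] by metis
  have b: "((\<lambda>c. c ^ Suc i / real (Suc i)) has_real_derivative c ^ i) (at c)" for c :: real
    by (auto intro!: derivative_eq_intros simp del: power_Suc)
  have b1: "((\<lambda>c. c ^ i) has_real_derivative real i * c ^ (i - 1)) (at c)" for c :: real
    by (auto intro!: derivative_eq_intros)
  have smooth: "C_k k (\<lambda>c::real. real i * c ^ (i - 1))" for k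
    by (intro C_k_mult C_k_const C_k_power C_k_id)
  let ?b = "\<lambda>c :: real. c ^ Suc i / real (Suc i)" and ?a1 = "\<lambda>t. \<alpha> (to_circle t) - \<mu>"
  show ?case
  proof (intro exI conjI allI)
    show "periodic_jet (\<lambda>p. a (fst p) * ?b (snd p)) (\<lambda>p. ?a1 (fst p) * ?b (snd p)) (\<lambda>p. a (fst p) * snd p ^ i)
      (\<lambda>p. a2 (fst p) * ?b (snd p)) (\<lambda>p. ?a1 (fst p) * snd p ^ i)
      (\<lambda>p. a (fst p) * (real i * snd p ^ (i - 1)))"
      by (rule periodic_jet_product[OF a(1,2) b b1 a(3) smooth a(4)])
    show "?a1 (fst (t, c)) * snd (t, c) ^ i = \<alpha> (fst (to_circle t, c)) * snd (to_circle t, c) ^ i - \<mu> * c ^ i" for t c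
      by (simp add: algebra_simps)
  qed (simp_all add: a(5))
next
  case (add f g)
  from add.IH(1) obtain Q Q1 Q2 Q11 Q12 Q22 \<mu> where Q: "periodic_jet Q Q1 Q2 Q11 Q12 Q22"
    "\<And>t c. Q12 (t, c) = f (to_circle t, c) - \<mu> c" "\<And>t. Q1 (t, 0) = 0" "\<And>c. Q2 (0, c) = 0" by blast
  from add.IH(2) obtain P P1 P2 P11 P12 P22 \<nu> where P: "periodic_jet P P1 P2 P11 P12 P22"
    "\<And>t c. P12 (t, c) = g (to_circle t, c) - \<nu> c" "\<And>t. P1 (t, 0) = 0" "\<And>c. P2 (0, c) = 0" by blast
  show ?case
  proof (intro exI conjI allI)
    show "periodic_jet (\<lambda>p. Q p + P p) (\<lambda>p. Q1 p + P1 p) (\<lambda>p. Q2 p + P2 p)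
      (\<lambda>p. Q11 p + P11 p) (\<lambda>p. Q12 p + P12 p) (\<lambda>p. Q22 p + P22 p)"
      by (rule periodic_jet_add[OF Q(1) P(1)])
    show "Q12 (t, c) + P12 (t, c) = f (to_circle t, c) + g (to_circle t, c) - (\<mu> c + \<nu> c)" for t c
      by (simp add: Q P)
  qed (simp_all add: Q P)
qed

text \<open>To be integrated periodically, a smooth approximation of \<open>g\<close> has to be corrected by its mean \<open>\<mu>\<close> on
  each circle. This correction is small: by Rolle's theorem the difference of the two periodic
  primitives has a critical point, and there \<open>\<mu>\<close> is the error of the approximation.\<close>

lemma mixed_derivative_approximation:
  fixes g :: "annulus \<Rightarrow> real"
  assumes cont: "continuous_on UNIV g" and e: "0 < e"
    and G: "\<And>t c. ((\<lambda>t. G t c) has_real_derivative g (to_circle t, c)) (at t)"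
    and per: "\<And>t c. G (t + 1) c = G t c"
  obtains Q Q1 Q2 Q11 Q12 Q22 where "periodic_jet Q Q1 Q2 Q11 Q12 Q22"
    "\<And>t c. \<bar>c\<bar> \<le> M \<Longrightarrow> \<bar>Q12 (t, c) - g (to_circle t, c)\<bar> \<le> e"
    "\<And>t. Q1 (t, 0) = 0" "\<And>c. Q2 (0, c) = 0"
proof -
  obtain f where f: "smooth_fibre_polynomial f" "\<And>\<theta> c. \<bar>c\<bar> \<le> M \<Longrightarrow> \<bar>g (\<theta>, c) - f (\<theta>, c)\<bar> < e / 2"
    using smooth_fibre_polynomial_dense[OF cont, of "e / 2" M] e by auto
  obtain Q Q1 Q2 Q11 Q12 Q22 \<mu> where Q: "periodic_jet Q Q1 Q2 Q11 Q12 Q22"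
    "\<And>t c. Q12 (t, c) = f (to_circle t, c) - \<mu> c" "\<And>t. Q1 (t, 0) = 0" "\<And>c. Q2 (0, c) = 0"
    using smooth_fibre_polynomial_integral[OF f(1)] by blast
  interpret Q: periodic_jet Q Q1 Q2 Q11 Q12 Q22 by (rule Q(1))
  interpret Q': lifted_function Q Q1 Q2 by (rule Q.lifted_function)
  have "\<bar>Q12 (t, c) - g (to_circle t, c)\<bar> \<le> e" if c: "\<bar>c\<bar> \<le> M" for t c
  proof -
    have "\<exists>s>0. s < 1 \<and> (Q2 (1, c) - G 1 c) - (Q2 (0, c) - G 0 c) = (1 - 0) * (Q12 (s, c) - g (to_circle s, c))"
      by (rule MVT2[of 0 1 "\<lambda>t. Q2 (t, c) - G t c"]) (auto intro!: DERIV_diff Q.der_mixed_fst G)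
    then obtain s where "(Q2 (1, c) - G 1 c) - (Q2 (0, c) - G 0 c) = Q12 (s, c) - g (to_circle s, c)"
      by auto
    then have "Q12 (s, c) = g (to_circle s, c)"
      using Q'.per2[of 0 c] per[of 0 c] by simp
    then have "\<mu> c = f (to_circle s, c) - g (to_circle s, c)" by (simp add: Q(2))
    then have "\<bar>\<mu> c\<bar> < e / 2" using f(2)[OF c, of "to_circle s"] by (simp only: abs_minus_commute)
    then show ?thesis using f(2)[OF c, of "to_circle t"] by (simp only: Q(2))
  qed
  then show ?thesis using that Q by blast
qed

section \<open>Smooth twists approximating a foliation\<close>

lemma uniformly_continuous_on_annulus:
  fixes h :: "annulus \<Rightarrow> real"
  assumes "continuous_on UNIV h" "0 < e"
  obtains \<delta> where "\<delta> > 0" "\<And>x y. \<bar>snd x\<bar> \<le> M \<Longrightarrow> \<bar>snd y\<bar> \<le> M \<Longrightarrow> dist x y < \<delta> \<Longrightarrow> \<bar>h x - h y\<bar> < e"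
proof -
  have "uniformly_continuous_on (UNIV \<times> {-M..M}) h"
    using assms(1) by (intro compact_uniformly_continuous compact_Times compact_circle)
      (auto elim: continuous_on_subset)
  then obtain \<delta> where \<delta>: "\<delta> > 0"
    "\<And>x y. x \<in> UNIV \<times> {-M..M} \<Longrightarrow> y \<in> UNIV \<times> {-M..M} \<Longrightarrow> dist y x < \<delta> \<Longrightarrow> dist (h y) (h x) < e"
    unfolding uniformly_continuous_on_def using assms(2) by meson
  have "\<bar>h x - h y\<bar> < e" if "\<bar>snd x\<bar> \<le> M" "\<bar>snd y\<bar> \<le> M" "dist x y < \<delta>" for x y
    using \<delta>(2)[of y x] that by (auto simp: mem_Times_iff abs_le_iff dist_real_def)
  then show ?thesis using \<delta>(1) that by blast
qed

lemma real_increment_bound: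
  fixes f :: "real \<Rightarrow> real"
  assumes "\<And>z. (f has_real_derivative f' z) (at z)" "\<And>z. z \<in> {a..b} \<Longrightarrow> \<bar>f' z\<bar> \<le> B"
    and "x \<in> {a..b}" "y \<in> {a..b}"
  shows "\<bar>f x - f y\<bar> \<le> B * \<bar>x - y\<bar>"
  using field_differentiable_bound[of "{a..b}" f f' B x y] assms
  by (auto intro: has_field_derivative_at_within)

context generated_foliation
begin

lemma W_0: "W (0, c) = 0"
  using generating by (simp add: foliation_generating_function_def annulus_cover_simp to_circle_0)

text \<open>Although \<open>W\<close> need not have second derivatives, the quotient
  \<open>(W1 (t, c + \<delta>) - W1 (t, c)) / \<delta>\<close> is continuous, and larger than \<open>-1\<close> since the leaves are
  strictly ordered. It is the mixed derivative of the average of \<open>W\<close> over \<open>{c..c + \<delta>}\<close>. Integrating a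
  smooth approximation of it gives a smooth approximation of \<open>W\<close> that keeps the twist condition.\<close>

lemma smooth_approximation_on_strip:
  assumes M: "0 \<le> M" and e: "0 < e"
  shows "\<exists>V V1 V2 V11 V12 V22. periodic_jet V V1 V2 V11 V12 V22 \<and>
    (\<forall>t c. \<bar>c\<bar> \<le> M \<longrightarrow> V12 (t, c) > -1 \<and> \<bar>V1 (t, c) - W1 (t, c)\<bar> \<le> e \<and> \<bar>V2 (t, c) - W2 (t, c)\<bar> \<le> e)"
proof -
  have "0 < e / 4" using e by simp
  obtain \<delta>1 where \<delta>1: "\<delta>1 > 0" "\<And>x y. \<bar>snd x\<bar> \<le> M + 1 \<Longrightarrow> \<bar>snd y\<bar> \<le> M + 1 \<Longrightarrow> dist x y < \<delta>1 \<Longrightarrow>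
      \<bar>d_theta u x - d_theta u y\<bar> < e / 4"
    by (rule uniformly_continuous_on_annulus[OF continuous_partials(1) \<open>0 < e / 4\<close>]) blast
  obtain \<delta>2 where \<delta>2: "\<delta>2 > 0" "\<And>x y. \<bar>snd x\<bar> \<le> M + 1 \<Longrightarrow> \<bar>snd y\<bar> \<le> M + 1 \<Longrightarrow> dist x y < \<delta>2 \<Longrightarrow>
      \<bar>d_c u x - d_c u y\<bar> < e / 4"
    by (rule uniformly_continuous_on_annulus[OF continuous_partials(2) \<open>0 < e / 4\<close>]) blast
  define \<delta> where "\<delta> = min 1 (min \<delta>1 \<delta>2 / 2)"
  have \<delta>: "0 < \<delta>" "\<delta> \<le> 1" "\<delta> < \<delta>1" "\<delta> < \<delta>2" using \<delta>1 \<delta>2 by (auto simp: \<delta>_def)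
  have near1: "\<bar>W1 (t, z) - W1 (t, c)\<bar> < e / 4" and near2: "\<bar>W2 (t, z) - W2 (t, c)\<bar> < e / 4"
    if "\<bar>c\<bar> \<le> M" "c < z" "z < c + \<delta>" for t c z
  proof -
    have "dist (to_circle t, z) (to_circle t, c) = \<bar>z - c\<bar>" by (simp add: dist_prod_def dist_real_def)
    then have "dist (to_circle t, z) (to_circle t, c) < \<delta>1" "dist (to_circle t, z) (to_circle t, c) < \<delta>2"
      using that \<delta> by auto
    moreover have "\<bar>z\<bar> \<le> M + 1" "\<bar>c\<bar> \<le> M + 1" using that \<delta>(2) by auto
    ultimately show "\<bar>W1 (t, z) - W1 (t, c)\<bar> < e / 4" "\<bar>W2 (t, z) - W2 (t, c)\<bar> < e / 4"
      using \<delta>1(2)[of "(to_circle t, z)" "(to_circle t, c)"] \<delta>2(2)[of "(to_circle t, z)" "(to_circle t, c)"]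
      by (simp_all add: annulus_cover_simp)
  qed
  define m where "m p = (d_theta u (fst p, snd p + \<delta>) - d_theta u p) / \<delta>" for p
  have m_lift: "m (to_circle t, c) = (W1 (t, c + \<delta>) - W1 (t, c)) / \<delta>" for t c
    by (simp add: m_def annulus_cover_simp)
  have m_cont: "continuous_on UNIV m"
    unfolding m_def using \<delta>(1)
    by (intro continuous_on_divide continuous_on_diff continuous_on_const continuous_partials
        continuous_on_compose2[OF continuous_partials(1)] continuous_intros) auto
  have m_gt: "m p > -1" for p
  proof -
    obtain t where t: "to_circle t = fst p" using surj_to_circle by (metis surjD)
    have "W1 (t, snd p + \<delta>) - W1 (t, snd p) > - \<delta>"
      using leaves_increasing[of "snd p" "snd p + \<delta>" t] \<delta>(1) by simp
    then have "m (to_circle t, snd p) > -1"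
      unfolding m_lift using \<delta>(1) by (simp add: pos_less_divide_eq)
    then show ?thesis by (simp add: t)
  qed
  have "compact ((UNIV :: circle set) \<times> {-M..M})" by (intro compact_Times compact_circle) auto
  moreover have "(UNIV :: circle set) \<times> {-M..M} \<noteq> {}" using M by auto
  ultimately obtain p0 where p0: "\<And>p. p \<in> UNIV \<times> {-M..M} \<Longrightarrow> m p0 \<le> m p"
    using continuous_attains_inf[of "UNIV \<times> {-M..M}" m] continuous_on_subset[OF m_cont] by (metis subset_UNIV)
  define e' where "e' = min (e / 4 / (M + 1)) ((1 + m p0) / 2)"
  have e': "0 < e'" "e' * M \<le> e / 4" "e' \<le> e / 4" "e' < 1 + m p0"
  proof -
    have "0 < 1 + m p0" using m_gt[of p0] by simp
    then show d0: "0 < e'" using e M by (simp add: e'_def)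
    have "e' \<le> (1 + m p0) / 2" unfolding e'_def by (rule min.cobounded2)
    also have "\<dots> < 1 + m p0" using \<open>0 < 1 + m p0\<close> by simp
    finally show "e' < 1 + m p0" .
    have "e' \<le> e / 4 / (M + 1)" unfolding e'_def by (rule min.cobounded1)
    moreover have "0 < M + 1" using M by simp
    ultimately have "e' * (M + 1) \<le> e / 4" using pos_le_divide_eq by blast
    then have "e' * M + e' \<le> e / 4" by (simp only: distrib_left mult_1_right)
    moreover have "0 \<le> e' * M" using d0 M by simp
    ultimately show "e' * M \<le> e / 4" "e' \<le> e / 4" using d0 by simp_all
  qed
  define G where "G t c = (W (t, c + \<delta>) - W (t, c)) / \<delta>" for t c
  obtain Q Q1 Q2 Q11 Q12 Q22 where Q: "periodic_jet Q Q1 Q2 Q11 Q12 Q22"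
    "\<And>t c. \<bar>c\<bar> \<le> M \<Longrightarrow> \<bar>Q12 (t, c) - m (to_circle t, c)\<bar> \<le> e'"
    "\<And>t. Q1 (t, 0) = 0" "\<And>c. Q2 (0, c) = 0"
  proof (rule mixed_derivative_approximation[OF m_cont e'(1), of G M])
    show "((\<lambda>t. G t c) has_real_derivative m (to_circle t, c)) (at t)" for t c
      unfolding G_def m_lift by (intro DERIV_cdivide DERIV_diff der_fst)
    show "G (t + 1) c = G t c" for t c by (simp only: G_def per)
  qed blast
  interpret Q: periodic_jet Q Q1 Q2 Q11 Q12 Q22 by (rule Q(1))
  interpret Q': lifted_function Q Q1 Q2 by (rule Q.lifted_function)
  (* Q accounts for the change of W1 from c = 0 to c only. The initial value W1 (t, 0) is approximated
     by the same means: as a function constant in c it is the mixed derivative of c * W (t, 0), and it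
     is recovered from the approximation P of the latter at c = 1. *)
  have b_cont: "continuous_on UNIV (\<lambda>p :: annulus. d_theta u (fst p, 0))"
    by (intro continuous_on_compose2[OF continuous_partials(1)] continuous_intros) auto
  obtain P P1 P2 P11 P12 P22 where P: "periodic_jet P P1 P2 P11 P12 P22"
    "\<And>t c. \<bar>c\<bar> \<le> 1 \<Longrightarrow> \<bar>P12 (t, c) - d_theta u (fst (to_circle t, c), 0)\<bar> \<le> e / 4"
    "\<And>t. P1 (t, 0) = 0"
  proof (rule mixed_derivative_approximation[OF b_cont \<open>0 < e / 4\<close>, of "\<lambda>t c. W (t, 0)" 1])
    show "((\<lambda>t. W (t, 0)) has_real_derivative d_theta u (fst (to_circle t, c), 0)) (at t)" for t c
      using der_fst[of 0 t] by (simp add: annulus_cover_simp)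
    show "W (t + 1, 0) = W (t, 0)" for t by (rule per)
  qed blast
  interpret P: periodic_jet P P1 P2 P11 P12 P22 by (rule P(1))
  have base: "\<bar>P1 (t, 1) - W1 (t, 0)\<bar> \<le> e / 4" for t
  proof -
    have "\<bar>(P1 (t, 1) - W1 (t, 0) * 1) - (P1 (t, 0) - W1 (t, 0) * 0)\<bar> \<le> e / 4 * \<bar>1 - 0\<bar>"
    proof (rule real_increment_bound[where f = "\<lambda>c. P1 (t, c) - W1 (t, 0) * c" and a = 0 and b = 1])
      show "((\<lambda>c. P1 (t, c) - W1 (t, 0) * c) has_real_derivative P12 (t, c) - W1 (t, 0)) (at c)" for c
        by (auto intro!: derivative_eq_intros P.der_mixed_snd)
      show "\<bar>P12 (t, c) - W1 (t, 0)\<bar> \<le> e / 4" if "c \<in> {0..1}" for c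
        using P(2)[of c t] that by (simp add: annulus_cover_simp)
    qed auto
    then show ?thesis by (simp add: P(3))
  qed
  have "periodic_jet (\<lambda>p. P (fst p, 1)) (\<lambda>p. P1 (fst p, 1)) (\<lambda>p. P2 (fst p, 1) * 0)
    (\<lambda>p. P11 (fst p, 1)) (\<lambda>p. P12 (fst p, 1) * 0) (\<lambda>p. P22 (fst p, 1) * 0 * 0 + P2 (fst p, 1) * 0)"
    by (rule periodic_jet_reparametrize[OF P(1), of "\<lambda>_. 1" "\<lambda>_. 0" "\<lambda>_. 0"]) (auto simp: C_k_const)
  from periodic_jet_add[OF Q(1) this]
  have jet: "periodic_jet (\<lambda>p. Q p + P (fst p, 1)) (\<lambda>p. Q1 p + P1 (fst p, 1)) (\<lambda>p. Q2 p)
    (\<lambda>p. Q11 p + P11 (fst p, 1)) (\<lambda>p. Q12 p) (\<lambda>p. Q22 p)" by simp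
  have est12: "Q12 (t, c) > -1" if "\<bar>c\<bar> \<le> M" for t c
    using Q(2)[OF that, of t] p0[of "(to_circle t, c)"] that e'(4) by (auto simp: abs_le_iff)
  have est1: "\<bar>Q1 (t, c) + P1 (t, 1) - W1 (t, c)\<bar> \<le> e" if c: "\<bar>c\<bar> \<le> M" for t c
  proof -
    have "continuous_on UNIV (\<lambda>c. W1 (t, c))" by (intro continuous_on_compose2[OF cont1] continuous_intros) auto
    then obtain H where H: "\<And>c. (H has_real_derivative W1 (t, c)) (at c)"
      by (rule antiderivative_exists) blast
    (* the mean value of W1 (t, _) over {c..c + \<delta>} *)
    define k where "k c = (H (c + \<delta>) - H c) / \<delta>" for c
    have dk: "(k has_real_derivative m (to_circle t, c)) (at c)" for c
    proof -
      have "((\<lambda>c. H (c + \<delta>)) has_real_derivative W1 (t, c + \<delta>)) (at c)"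
        using H[of "c + \<delta>"] DERIV_shift[of H _ c \<delta>] by simp
      then show ?thesis unfolding k_def[abs_def] m_lift by (intro DERIV_cdivide DERIV_diff H)
    qed
    have k_near: "\<bar>k c - W1 (t, c)\<bar> \<le> e / 4" if c: "\<bar>c\<bar> \<le> M" for c
    proof -
      obtain z where z: "c < z" "z < c + \<delta>" "H (c + \<delta>) - H c = (c + \<delta> - c) * W1 (t, z)"
        using MVT2[of c "c + \<delta>" H "\<lambda>c. W1 (t, c)"] H \<delta>(1) by auto
      then have "k c = W1 (t, z)" using \<delta>(1) by (simp add: k_def)
      then show ?thesis using near1[OF c z(1,2), of t] by simp
    qed
    have "\<bar>(Q1 (t, c) - k c) - (Q1 (t, 0) - k 0)\<bar> \<le> e' * \<bar>c - 0\<bar>"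
    proof (rule real_increment_bound[where f = "\<lambda>c. Q1 (t, c) - k c" and a = "- M" and b = M])
      show "((\<lambda>c. Q1 (t, c) - k c) has_real_derivative Q12 (t, c) - m (to_circle t, c)) (at c)" for c
        by (intro DERIV_diff Q.der_mixed_snd dk)
      show "\<bar>Q12 (t, c) - m (to_circle t, c)\<bar> \<le> e'" if "c \<in> {-M..M}" for c
        using Q(2)[of c t] that by auto
    qed (use c M in auto)
    also have "\<dots> \<le> e' * M" using c e'(1) by (intro mult_left_mono) auto
    finally have "\<bar>(Q1 (t, c) - k c) + k 0\<bar> \<le> e / 4" using e'(2) by (simp add: Q(3))
    moreover have "\<bar>k c - W1 (t, c)\<bar> \<le> e / 4" "\<bar>k 0 - W1 (t, 0)\<bar> \<le> e / 4"
      using k_near[of c] k_near[of 0] c M by auto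
    ultimately show ?thesis using base[of t] by linarith
  qed
  have est2: "\<bar>Q2 (t, c) - W2 (t, c)\<bar> \<le> e" if c: "\<bar>c\<bar> \<le> M" for t c
  proof -
    have unit: "\<bar>Q2 (t, c) - W2 (t, c)\<bar> \<le> e" if t: "0 \<le> t" "t \<le> 1" for t
    proof -
      have "\<bar>(Q2 (t, c) - G t c) - (Q2 (0, c) - G 0 c)\<bar> \<le> e' * \<bar>t - 0\<bar>"
      proof (rule real_increment_bound[where f = "\<lambda>t. Q2 (t, c) - G t c" and a = 0 and b = 1])
        show "((\<lambda>t. Q2 (t, c) - G t c) has_real_derivative Q12 (t, c) - m (to_circle t, c)) (at t)" for t
          unfolding G_def m_lift by (intro DERIV_cdivide DERIV_diff der_fst Q.der_mixed_fst)
        show "\<bar>Q12 (t, c) - m (to_circle t, c)\<bar> \<le> e'" for t by (rule Q(2)[OF c])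
      qed (use t in auto)
      also have "\<dots> \<le> e' * 1" using t e'(1) by (intro mult_left_mono) auto
      finally have "\<bar>Q2 (t, c) - G t c\<bar> \<le> e / 4" using e'(3) W_0 by (simp add: Q(4) G_def)
      moreover obtain z where z: "c < z" "z < c + \<delta>" "W (t, c + \<delta>) - W (t, c) = (c + \<delta> - c) * W2 (t, z)"
        using MVT2[of c "c + \<delta>" "\<lambda>c. W (t, c)" "\<lambda>c. W2 (t, c)"] der_snd \<delta>(1) by auto
      then have "G t c = W2 (t, z)" using \<delta>(1) by (simp add: G_def)
      moreover have "\<bar>W2 (t, z) - W2 (t, c)\<bar> < e / 4" by (rule near2[OF c z(1,2)])
      ultimately show ?thesis by linarith
    qed
    have "Q2 (t, c) - W2 (t, c) = Q2 (frac t, c) - W2 (frac t, c)"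
      using periodic_add_int[of "\<lambda>t. Q2 (t, c) - W2 (t, c)" "frac t" "\<lfloor>t\<rfloor>"]
      by (simp only: Q'.per2 per2 frac_def diff_add_cancel simp_thms)
    then show ?thesis using unit[of "frac t"] frac_lt_1[of t] by simp
  qed
  show ?thesis
    by (intro exI conjI allI impI, rule jet) (use est12 est1 est2 in auto)
qed

text \<open>Composing with \<open>N arctan (c / N)\<close>, which is bounded, almost the identity on \<open>{-R..R}\<close> for large
  \<open>N\<close>, and of derivative in \<open>{0<..1}\<close>, turns an approximation on a large strip into a twist of the whole
  annulus: the mixed derivative is multiplied by a number in \<open>{0<..1}\<close> and so stays above \<open>-1\<close>.\<close>

lemma smooth_twist_approximation:
  assumes R: "0 \<le> R" and e: "0 < e"
  shows "\<exists>V V1 V2 V11 V12 V22 B. smooth_twist V V1 V2 V11 V12 V22 B \<and>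
    (\<forall>t c. \<bar>c\<bar> \<le> R \<longrightarrow> \<bar>V1 (t, c) - W1 (t, c)\<bar> \<le> e \<and> \<bar>V2 (t, c) - W2 (t, c)\<bar> \<le> e)"
proof -
  have "0 < e / 4" using e by simp
  obtain \<delta>1 where \<delta>1: "\<delta>1 > 0" "\<And>x y. \<bar>snd x\<bar> \<le> R \<Longrightarrow> \<bar>snd y\<bar> \<le> R \<Longrightarrow> dist x y < \<delta>1 \<Longrightarrow>
      \<bar>d_theta u x - d_theta u y\<bar> < e / 4"
    by (rule uniformly_continuous_on_annulus[OF continuous_partials(1) \<open>0 < e / 4\<close>]) blast
  obtain \<delta>2 where \<delta>2: "\<delta>2 > 0" "\<And>x y. \<bar>snd x\<bar> \<le> R \<Longrightarrow> \<bar>snd y\<bar> \<le> R \<Longrightarrow> dist x y < \<delta>2 \<Longrightarrow>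
      \<bar>d_c u x - d_c u y\<bar> < e / 4"
    by (rule uniformly_continuous_on_annulus[OF continuous_partials(2) \<open>0 < e / 4\<close>]) blast
  have "compact (d_c u ` (UNIV \<times> {-R..R}))"
    by (intro compact_continuous_image compact_Times compact_circle continuous_on_subset[OF continuous_partials(2)]) auto
  then obtain D where D: "\<And>x. x \<in> d_c u ` (UNIV \<times> {-R..R}) \<Longrightarrow> \<bar>x\<bar> \<le> D" by (rule compact_reals_bound) blast
  have D2: "\<bar>W2 (t, c)\<bar> \<le> D" if "\<bar>c\<bar> \<le> R" for t c
    using that by (intro D) (auto simp: annulus_cover_simp abs_le_iff)
  have "0 \<le> D" using D2[of 0 0] R by linarith
  define d where "d = min (e / 4 / (D + 1)) (min \<delta>1 \<delta>2 / 2)"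
  have d: "0 < d" "d < \<delta>1" "d < \<delta>2" "D * d \<le> e / 4"
  proof -
    show d0: "0 < d" using e \<open>0 \<le> D\<close> \<delta>1 \<delta>2 by (simp add: d_def)
    show "d < \<delta>1" "d < \<delta>2" using \<delta>1 \<delta>2 by (auto simp: d_def)
    have "d \<le> e / 4 / (D + 1)" unfolding d_def by (rule min.cobounded1)
    moreover have "0 < D + 1" using \<open>0 \<le> D\<close> by simp
    ultimately have "d * (D + 1) \<le> e / 4" using pos_le_divide_eq by blast
    then have "D * d + d \<le> e / 4" by (simp only: distrib_left mult_1_right mult.commute)
    then show "D * d \<le> e / 4" using d0 by simp
  qed
  define N where "N = max 1 (R ^ 2 * (R + 1) / d)"
  have N: "N \<ge> 1" "R ^ 2 * (R + 1) \<le> d * N"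
  proof -
    show "N \<ge> 1" unfolding N_def by (rule max.cobounded1)
    have "R ^ 2 * (R + 1) / d \<le> N" unfolding N_def by (rule max.cobounded2)
    then show "R ^ 2 * (R + 1) \<le> d * N" using d(1) by (simp only: pos_divide_le_eq mult.commute)
  qed
  have N2: "R ^ 2 / N ^ 2 * (R + 1) \<le> d"
  proof -
    have "N \<le> N ^ 2" using N(1) by (simp add: power2_eq_square)
    then have "d * N \<le> d * N ^ 2" using d(1) by simp
    then have "R ^ 2 * (R + 1) \<le> d * N ^ 2" using N(2) by linarith
    moreover have "0 < N ^ 2" using N(1) by simp
    ultimately have "R ^ 2 * (R + 1) / N ^ 2 \<le> d" using pos_divide_le_eq by blast
    then show ?thesis by simp
  qed
  define s where "s c = N * arctan (c / N)" for c
  define s1 where "s1 c = inverse (1 + (c / N) ^ 2)" for c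
  define s2 where "s2 c = - (2 * c / N ^ 2) * s1 c ^ 2" for c
  have pos: "1 + (c / N) ^ 2 > 0" for c by (smt (verit) zero_le_power2)
  have ds: "(s has_real_derivative s1 c) (at c)" for c
    unfolding s_def[abs_def] s1_def using N(1)
    by (auto intro!: derivative_eq_intros)
  have ds1: "(s1 has_real_derivative s2 c) (at c)" for c
  proof -
    have "((\<lambda>c. 1 + (c / N) ^ 2) has_real_derivative 2 * c / N ^ 2) (at c)"
      using N(1) by (auto intro!: derivative_eq_intros simp: power2_eq_square)
    from DERIV_inverse_fun[OF this] pos[of c] show ?thesis
      unfolding s1_def[abs_def] s2_def by (simp add: power2_eq_square mult_ac)
  qed
  have smooth1: "C_k k s1" for k
    unfolding s1_def[abs_def]
  proof (intro C_k_inverse C_k_add C_k_const C_k_power)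
    show "C_k k (\<lambda>c. c / N)" by (rule C_k_bounded_linear) (rule bounded_linear_divide)
    show "1 + (c / N) ^ 2 \<noteq> 0" for c using pos[of c] by simp
  qed
  have smooth2: "C_k k s2" for k
    unfolding s2_def[abs_def]
  proof (intro C_k_mult C_k_power smooth1 C_k_minus)
    show "C_k k (\<lambda>c. 2 * c / N ^ 2)"
      using C_k_bounded_linear[OF bounded_linear_mult_right[of "2 / N ^ 2"], of k] by simp
  qed
  have s1: "0 < s1 c" "s1 c \<le> 1" for c
  proof -
    show "0 < s1 c" using pos[of c] by (simp add: s1_def)
    have "inverse (1 + (c / N) ^ 2) \<le> inverse 1" by (rule le_imp_inverse_le) auto
    then show "s1 c \<le> 1" by (simp add: s1_def)
  qed
  have s1_near: "\<bar>s1 c - 1\<bar> \<le> R ^ 2 / N ^ 2" if "\<bar>c\<bar> \<le> R" for c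
  proof -
    have "1 - s1 c = (c / N) ^ 2 * s1 c"
      using pos[of c] by (simp add: s1_def field_simps)
    also have "\<dots> \<le> (c / N) ^ 2 * 1" using s1[of c] by (intro mult_left_mono) auto
    also have "\<dots> \<le> R ^ 2 / N ^ 2"
      using power_mono[OF that, of 2] by (simp add: power_divide divide_right_mono)
    finally show ?thesis using s1[of c] by simp
  qed
  have s0: "s 0 = 0" by (simp add: s_def)
  have s_le: "\<bar>s c\<bar> \<le> R" if "\<bar>c\<bar> \<le> R" for c
    using real_increment_bound[of s s1 "-R" R 1 c 0, OF ds] s1 that R
    by (auto simp: s0 abs_le_iff abs_of_pos less_imp_le)
  have s_near: "\<bar>s c - c\<bar> \<le> d" if c: "\<bar>c\<bar> \<le> R" for c
  proof -
    have "\<bar>(s c - c) - (s 0 - 0)\<bar> \<le> R ^ 2 / N ^ 2 * \<bar>c - 0\<bar>"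
    proof (rule real_increment_bound[where f = "\<lambda>c. s c - c" and a = "- R" and b = R])
      show "((\<lambda>c. s c - c) has_real_derivative s1 c - 1) (at c)" for c
        by (intro DERIV_diff ds DERIV_ident)
      show "\<bar>s1 c - 1\<bar> \<le> R ^ 2 / N ^ 2" if "c \<in> {-R..R}" for c
        using that by (intro s1_near) auto
    qed (use c R in auto)
    also have "\<dots> \<le> R ^ 2 / N ^ 2 * (R + 1)" using c by (intro mult_left_mono) auto
    finally show ?thesis using N2 by (simp add: s0)
  qed
  have s1_near': "\<bar>s1 c - 1\<bar> \<le> d" if "\<bar>c\<bar> \<le> R" for c
  proof -
    have "R ^ 2 / N ^ 2 * 1 \<le> R ^ 2 / N ^ 2 * (R + 1)" using R by (intro mult_left_mono) auto
    then show ?thesis using s1_near[OF that] N2 by simp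
  qed
  have s_strip: "\<bar>s c\<bar> \<le> 2 * N + R" for c
  proof -
    have "\<bar>arctan (c / N)\<bar> \<le> 2"
      using arctan_bounded[of "c / N"] pi_less_4 by (auto simp: abs_le_iff)
    then have "\<bar>s c\<bar> \<le> N * 2" using N(1) by (simp add: s_def abs_mult)
    then show ?thesis using R by simp
  qed
  have "0 \<le> 2 * N + R" using N(1) R by simp
  then obtain V V1 V2 V11 V12 V22 where V: "periodic_jet V V1 V2 V11 V12 V22"
    "\<And>t c. \<bar>c\<bar> \<le> 2 * N + R \<Longrightarrow> V12 (t, c) > -1 \<and> \<bar>V1 (t, c) - W1 (t, c)\<bar> \<le> e / 4 \<and> \<bar>V2 (t, c) - W2 (t, c)\<bar> \<le> e / 4"
    using smooth_approximation_on_strip[OF _ \<open>0 < e / 4\<close>] by blast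
  interpret V: periodic_jet V V1 V2 V11 V12 V22 by (rule V(1))
  interpret V': lifted_function V V1 V2 by (rule V.lifted_function)
  have "compact (V1 ` ({0..1} \<times> {- (2 * N + R)..2 * N + R}))"
    by (intro compact_continuous_image compact_Times continuous_on_subset[OF V'.cont1]) auto
  then obtain B where B: "\<And>x. x \<in> V1 ` ({0..1} \<times> {- (2 * N + R)..2 * N + R}) \<Longrightarrow> \<bar>x\<bar> \<le> B"
    by (rule compact_reals_bound) blast
  have jet: "periodic_jet (\<lambda>p. V (fst p, s (snd p))) (\<lambda>p. V1 (fst p, s (snd p))) (\<lambda>p. V2 (fst p, s (snd p)) * s1 (snd p))
    (\<lambda>p. V11 (fst p, s (snd p))) (\<lambda>p. V12 (fst p, s (snd p)) * s1 (snd p))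
    (\<lambda>p. V22 (fst p, s (snd p)) * s1 (snd p) * s1 (snd p) + V2 (fst p, s (snd p)) * s2 (snd p))"
    by (rule periodic_jet_reparametrize[OF V(1) ds ds1 smooth2])
  have "smooth_twist (\<lambda>p. V (fst p, s (snd p))) (\<lambda>p. V1 (fst p, s (snd p))) (\<lambda>p. V2 (fst p, s (snd p)) * s1 (snd p))
    (\<lambda>p. V11 (fst p, s (snd p))) (\<lambda>p. V12 (fst p, s (snd p)) * s1 (snd p))
    (\<lambda>p. V22 (fst p, s (snd p)) * s1 (snd p) * s1 (snd p) + V2 (fst p, s (snd p)) * s2 (snd p)) B"
  proof (rule smooth_twist.intro[OF jet], unfold_locales)
    fix p :: "real \<times> real"
    have "V12 (fst p, s (snd p)) > -1" using V(2)[OF s_strip] by blast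
    then show "0 < 1 + V12 (fst p, s (snd p)) * s1 (snd p)"
      using s1[of "snd p"] mult_strict_right_mono[of "-1" "V12 (fst p, s (snd p))" "s1 (snd p)"] by simp
    have "V1 (fst p, s (snd p)) = V1 (frac (fst p), s (snd p))"
      using periodic_add_int[of "\<lambda>t. V1 (t, s (snd p))" "frac (fst p)" "\<lfloor>fst p\<rfloor>"]
      by (simp only: V'.per1 frac_def diff_add_cancel simp_thms)
    moreover have "(frac (fst p), s (snd p)) \<in> {0..1} \<times> {- (2 * N + R)..2 * N + R}"
      using s_strip[of "snd p"] frac_lt_1[of "fst p"] by (simp add: abs_le_iff less_imp_le)
    ultimately show "\<bar>V1 (fst p, s (snd p))\<bar> \<le> B" using B by (metis imageI)
  qed
  moreover have "\<bar>V1 (t, s c) - W1 (t, c)\<bar> \<le> e \<and> \<bar>V2 (t, s c) * s1 c - W2 (t, c)\<bar> \<le> e" if c: "\<bar>c\<bar> \<le> R" for t c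
  proof -
    have "dist (to_circle t, s c) (to_circle t, c) \<le> d"
      using s_near[OF c] by (simp add: dist_prod_def dist_real_def)
    then have near: "\<bar>W1 (t, s c) - W1 (t, c)\<bar> < e / 4" "\<bar>W2 (t, s c) - W2 (t, c)\<bar> < e / 4"
      using \<delta>1(2)[of "(to_circle t, s c)" "(to_circle t, c)"] \<delta>2(2)[of "(to_circle t, s c)" "(to_circle t, c)"]
        s_le[OF c] c d by (simp_all add: annulus_cover_simp)
    have v: "\<bar>V1 (t, s c) - W1 (t, s c)\<bar> \<le> e / 4" "\<bar>V2 (t, s c) - W2 (t, s c)\<bar> \<le> e / 4"
      using V(2)[OF s_strip] by blast+
    have "\<bar>(V2 (t, s c) - W2 (t, s c)) * s1 c\<bar> \<le> e / 4 * 1"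
      unfolding abs_mult using s1[of c] v(2) e by (intro mult_mono) auto
    moreover have "\<bar>W2 (t, s c) * (s1 c - 1)\<bar> \<le> D * d"
      unfolding abs_mult using D2[OF s_le[OF c]] s1_near'[OF c] \<open>0 \<le> D\<close> by (intro mult_mono) auto
    moreover have "V2 (t, s c) * s1 c - W2 (t, c) =
      (V2 (t, s c) - W2 (t, s c)) * s1 c + W2 (t, s c) * (s1 c - 1) + (W2 (t, s c) - W2 (t, c))"
      by (simp only: left_diff_distrib right_diff_distrib)
    ultimately have "\<bar>V2 (t, s c) * s1 c - W2 (t, c)\<bar> \<le> e" using near(2) d(4) by linarith
    then show ?thesis using near(1) v(1) by linarith
  qed
  ultimately show ?thesis
    by (intro exI conjI) (assumption, simp)
qed

end

section \<open>The exact symplectic homeomorphism generated by a Lipschitz foliation\<close>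

context generated_foliation
begin

lemma angle_slopes_lifted_twist:
  assumes angle_slopes shows "lifted_twist W W1 W2"
proof
  fix t t' c c' r :: real
  show "c + W1 (t, c) < c' + W1 (t, c')" if "c < c'" by (rule leaves_increasing[OF that])
  show "\<exists>c. c + W1 (t, c) = r" by (rule leaves_exhaust)
  show "t + W2 (t, c) < t' + W2 (t', c)" if "t < t'"
  proof -
    obtain L where L: "L > 1" "\<And>s t d. \<bar>d\<bar> \<le> \<bar>c\<bar> \<Longrightarrow> s \<le> t \<Longrightarrow> (1 / L - 1) * (t - s) \<le> W2 (t, d) - W2 (s, d)"
      using assms unfolding angle_slopes_def by meson
    have "(1 / L - 1) * (t' - t) \<le> W2 (t', c) - W2 (t, c)" using L(2)[of c t t'] that by simp
    moreover have "0 < 1 / L * (t' - t)" using L(1) that by simp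
    ultimately show ?thesis by (simp add: left_diff_distrib)
  qed
qed

text \<open>A point \<open>(x, c)\<close> has mixed coordinates \<open>(t, c)\<close> for the one map and \<open>(s, c)\<close> for the other.
  As \<open>t + W2 (t, c)\<close> multiplies distances in \<open>t\<close> by at least \<open>1 / L\<close>, closeness of the partial
  derivatives in \<open>c\<close> bounds \<open>s - t\<close>; uniform continuity of \<open>W1\<close> then compares the images.\<close>

lemma generated_map_approximation:
  assumes slopes: angle_slopes and R: "0 \<le> R" and e: "0 < e"
  shows "\<exists>\<phi>. exact_symplectic_diffeomorphism \<phi> \<and>
    (\<forall>x c. \<bar>c\<bar> \<le> R \<longrightarrow> dist (\<phi> (x, c)) (lifted_twist.generated_map W1 W2 (x, c)) \<le> e)"
proof -
  interpret T: lifted_twist W W1 W2 by (rule angle_slopes_lifted_twist[OF slopes])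
  obtain L where L: "L > 1" "\<And>s t c. \<bar>c\<bar> \<le> R \<Longrightarrow> s \<le> t \<Longrightarrow> (1 / L - 1) * (t - s) \<le> W2 (t, c) - W2 (s, c)"
    using slopes unfolding angle_slopes_def by meson
  have expand_le: "t - s \<le> L * ((t + W2 (t, c)) - (s + W2 (s, c)))" if "\<bar>c\<bar> \<le> R" "s \<le> t" for s t c
  proof -
    have "1 / L * (t - s) \<le> (t + W2 (t, c)) - (s + W2 (s, c))"
      using L(2)[OF that] by (simp add: left_diff_distrib)
    then have "L * (1 / L * (t - s)) \<le> L * ((t + W2 (t, c)) - (s + W2 (s, c)))"
      using L(1) by (intro mult_left_mono) auto
    then show ?thesis using L(1) by simp
  qed
  have expand: "\<bar>t - s\<bar> \<le> L * \<bar>(t + W2 (t, c)) - (s + W2 (s, c))\<bar>" if c: "\<bar>c\<bar> \<le> R" for s t c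
  proof -
    have *: "L * x \<le> L * \<bar>x\<bar>" for x using L(1) by (intro mult_left_mono) auto
    show ?thesis
      using expand_le[OF c, of s t] expand_le[OF c, of t s]
        *[of "(t + W2 (t, c)) - (s + W2 (s, c))"] *[of "(s + W2 (s, c)) - (t + W2 (t, c))"]
      by (cases "s \<le> t") (auto simp: abs_minus_commute)
  qed
  have "0 < e / 3" using e by simp
  then obtain \<delta> where \<delta>: "\<delta> > 0" "\<And>x y. \<bar>snd x\<bar> \<le> R \<Longrightarrow> \<bar>snd y\<bar> \<le> R \<Longrightarrow> dist x y < \<delta> \<Longrightarrow>
      \<bar>d_theta u x - d_theta u y\<bar> < e / 3"
    by (rule uniformly_continuous_on_annulus[OF continuous_partials(1)]) blast
  define d where "d = min (\<delta> / 2) (e / 3)"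
  have d: "0 < d" "d < \<delta>" "d \<le> e / 3" using \<delta> e by (auto simp: d_def)
  define e1 where "e1 = min (e / 3) (d / L)"
  have e1: "0 < e1" "e1 \<le> e / 3" "L * e1 \<le> d"
  proof -
    show "0 < e1" using d L(1) e by (simp add: e1_def)
    show "e1 \<le> e / 3" unfolding e1_def by (rule min.cobounded1)
    have "e1 \<le> d / L" unfolding e1_def by (rule min.cobounded2)
    then show "L * e1 \<le> d" using L(1) by (simp only: pos_le_divide_eq mult.commute)
  qed
  obtain V V1 V2 V11 V12 V22 B where V: "smooth_twist V V1 V2 V11 V12 V22 B"
    "\<And>t c. \<bar>c\<bar> \<le> R \<Longrightarrow> \<bar>V1 (t, c) - W1 (t, c)\<bar> \<le> e1 \<and> \<bar>V2 (t, c) - W2 (t, c)\<bar> \<le> e1"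
    using smooth_twist_approximation[OF R e1(1)] by blast
  interpret V: smooth_twist V V1 V2 V11 V12 V22 B by (rule V(1))
  have "dist (V.generated_map (x, c)) (T.generated_map (x, c)) \<le> e" if c: "\<bar>c\<bar> \<le> R" for x c
  proof -
    obtain y where y: "to_circle y = x" using surj_to_circle by (metis surjD)
    obtain s b where s: "V.angle_inv (y, c) = (s, b)" by fastforce
    obtain t a where t: "T.angle_inv (y, c) = (t, a)" by fastforce
    have sy: "V.angle_map (s, b) = (y, c)" using V.angle_inv(1)[of "(y, c)"] by (simp only: s)
    have ty: "angle_map (t, a) = (y, c)" using T.angle_inv(1)[of "(y, c)"] by (simp only: t)
    have s': "b = c" "s + V2 (s, c) = y" using sy by (auto simp: V.angle_map_def)
    have t': "a = c" "t + W2 (t, c) = y" using ty by (auto simp: angle_map_def simp del: o_apply)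
    have "\<bar>(s + W2 (s, c)) - (t + W2 (t, c))\<bar> \<le> e1"
      using V(2)[OF c, of s] s'(2) t'(2) by (simp only: abs_le_iff) linarith
    then have "L * \<bar>(s + W2 (s, c)) - (t + W2 (t, c))\<bar> \<le> L * e1" using L(1) by (intro mult_left_mono) auto
    then have st: "\<bar>s - t\<bar> \<le> d" using expand[OF c, of s t] e1(3) by linarith
    have "V.generated_map (x, c) = annulus_cover (V.action_map (s, b))"
      using V.generated_map_angle[of "(s, b)"] by (simp only: sy) (simp add: annulus_cover_simp y)
    then have 1: "V.generated_map (x, c) = annulus_cover (s, c + V1 (s, c))"
      by (simp add: s'(1) V.action_map_def)
    have "T.generated_map (x, c) = annulus_cover (action_map (t, a))"
      using T.generated_map_angle[of "(t, a)"] by (simp only: ty) (simp add: annulus_cover_simp y)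
    then have 2: "T.generated_map (x, c) = annulus_cover (t, c + W1 (t, c))"
      by (simp add: t'(1) action_map_def)
    have "dist (to_circle s, c) (to_circle t, c) \<le> \<bar>s - t\<bar>"
      using dist_to_circle_le[of s t] by (simp add: dist_prod_def dist_real_def)
    then have "dist (to_circle s, c) (to_circle t, c) < \<delta>" using st d(2) by linarith
    then have "\<bar>W1 (s, c) - W1 (t, c)\<bar> < e / 3"
      using \<delta>(2)[of "(to_circle s, c)" "(to_circle t, c)"] c by (simp add: annulus_cover_simp)
    moreover have "\<bar>V1 (s, c) - W1 (s, c)\<bar> \<le> e / 3" using V(2)[OF c, of s] e1(2) by linarith
    ultimately have 3: "\<bar>V1 (s, c) - W1 (t, c)\<bar> \<le> e / 3 + e / 3" by linarith
    have "dist (V.generated_map (x, c)) (T.generated_map (x, c)) \<le> dist (s, c + V1 (s, c)) (t, c + W1 (t, c))"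
      unfolding 1 2 by (rule dist_annulus_cover_le)
    also have "\<dots> \<le> \<bar>s - t\<bar> + \<bar>V1 (s, c) - W1 (t, c)\<bar>"
      unfolding dist_prod_def
      by (rule order_trans[OF sqrt_sum_squares_le_sum]) (auto simp: dist_real_def)
    also have "\<dots> \<le> e" using st d(3) 3 by linarith
    finally show ?thesis .
  qed
  then show ?thesis using V.exact_symplectic_generated_map by blast
qed

lemma angle_slopes_exact_symplectic:
  assumes angle_slopes
  shows "\<exists>\<Phi>. exact_symplectic_homeomorphism \<Phi> \<and> map_generating_function u \<Phi> \<and>
    (\<lambda>l. \<Phi> ` l) ` standard_foliation = leaves \<eta>"
proof -
  interpret T: lifted_twist W W1 W2 by (rule angle_slopes_lifted_twist[OF assms])
  have gen: "map_generating_function u T.generated_map"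
    using T.map_generating_function_generated_map by (simp add: descend_comp_cover)
  have "\<forall>n. \<exists>\<phi>. exact_symplectic_diffeomorphism \<phi> \<and>
    (\<forall>x c. \<bar>c\<bar> \<le> real n \<longrightarrow> dist (\<phi> (x, c)) (T.generated_map (x, c)) \<le> 1 / real (Suc n))"
    using generated_map_approximation[OF assms] by simp
  then obtain \<phi> where \<phi>: "\<And>n. exact_symplectic_diffeomorphism (\<phi> n)"
    "\<And>n x c. \<bar>c\<bar> \<le> real n \<Longrightarrow> dist (\<phi> n (x, c)) (T.generated_map (x, c)) \<le> 1 / real (Suc n)"
    by metis
  have "uniform_limit K \<phi> T.generated_map sequentially" if K: "compact K" for K
    unfolding uniform_limit_iff
  proof (intro allI impI)
    fix e :: real assume "0 < e"
    have "compact (snd ` K)" by (intro compact_continuous_image continuous_intros K)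
    then obtain R where R: "\<And>c. c \<in> snd ` K \<Longrightarrow> \<bar>c\<bar> \<le> R" by (rule compact_reals_bound) blast
    obtain N1 where N1: "R \<le> real N1" using real_arch_simple by blast
    obtain N2 where N2: "1 / real (Suc N2) < e" using \<open>0 < e\<close> nat_approx_posE by blast
    show "\<forall>\<^sub>F n in sequentially. \<forall>p\<in>K. dist (\<phi> n p) (T.generated_map p) < e"
      unfolding eventually_sequentially
    proof (intro exI[of _ "max N1 N2"] allI impI ballI)
      fix n p assume n: "max N1 N2 \<le> n" and p: "p \<in> K"
      have "\<bar>snd p\<bar> \<le> real n" using R[of "snd p"] p N1 n by simp
      then have "dist (\<phi> n p) (T.generated_map p) \<le> 1 / real (Suc n)"
        using \<phi>(2)[of "snd p" n "fst p"] by simp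
      also have "\<dots> \<le> 1 / real (Suc N2)" using n by (intro divide_left_mono) auto
      finally show "dist (\<phi> n p) (T.generated_map p) < e" using N2 by linarith
    qed
  qed
  then have "exact_symplectic_homeomorphism T.generated_map"
    unfolding exact_symplectic_homeomorphism_def
    using T.homeomorphism_generated_map \<phi>(1) by blast
  moreover have "T.generated_map ` (UNIV \<times> {c}) = fun_graph (\<eta> c)" for c
  proof -
    have iff: "T.generated_map (x, d) = (\<theta>, r) \<longleftrightarrow>
        x = \<theta> + to_circle (d_c u (\<theta>, d)) \<and> r = \<eta> d \<theta>" for x d \<theta> r
      using gen unfolding map_generating_function_def leaf_function by blast
    have "(\<theta>, r) \<in> T.generated_map ` (UNIV \<times> {c}) \<longleftrightarrow> (\<theta>, r) \<in> fun_graph (\<eta> c)" for \<theta> r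
    proof -
      have "(\<theta>, r) \<in> T.generated_map ` (UNIV \<times> {c}) \<longleftrightarrow> (\<exists>x. T.generated_map (x, c) = (\<theta>, r))"
        by (auto simp: image_iff) metis+
      also have "\<dots> \<longleftrightarrow> r = \<eta> c \<theta>" unfolding iff by blast
      also have "\<dots> \<longleftrightarrow> (\<theta>, r) \<in> fun_graph (\<eta> c)" by (auto simp: fun_graph_def)
      finally show ?thesis .
    qed
    then show ?thesis by auto
  qed
  then have "(\<lambda>l. T.generated_map ` l) ` standard_foliation = leaves \<eta>"
    unfolding standard_foliation_def leaves_def image_image by simp
  ultimately show ?thesis using gen by blast
qed

end

theorem proposition1p1:
  fixes \<eta> :: "real \<Rightarrow> circle \<Rightarrow> real" and u :: "annulus \<Rightarrow> real"
  assumes "continuous_foliation \<eta>"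
    and "foliation_generating_function \<eta> u"
    and "annulus_C1 u"
  shows "(lipschitz_foliation \<eta> \<longleftrightarrow>
      locally_lipschitz (d_theta u) \<and>
      (\<forall>C. compact C \<longrightarrow> (\<exists>L. \<forall>c\<in>C. L-lipschitz_on UNIV (\<lambda>\<theta>. d_c u (\<theta>, c)))) \<and>
      (\<forall>K. compact K \<longrightarrow>
        (\<exists>k_plus k_minus. k_plus > k_minus \<and> k_minus > -1 \<and>
          (AE p in annulus_lebesgue. p \<in> K \<longrightarrow>
            (\<exists>d. ((\<lambda>t. d_c u (fst p + to_circle t, snd p)) has_real_derivative d) (at 0) \<and>
              k_plus \<ge> d \<and> d \<ge> k_minus))))) \<and>
    (lipschitz_foliation \<eta> \<longrightarrow>
      (\<exists>\<Phi>. exact_symplectic_homeomorphism \<Phi> \<and>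
        map_generating_function u \<Phi> \<and>
        (\<lambda>l. \<Phi> ` l) ` standard_foliation = leaves \<eta>))"
proof -
  interpret generated_foliation \<eta> u
    by unfold_locales (fact assms)+
  have slopes: angle_slopes if "lipschitz_foliation \<eta>"
    using action_slopes_imp_angle_slopes lipschitz_foliation_action_slopes[OF that] by blast
  show ?thesis
  proof (intro conjI impI iffI allI)
    show "lipschitz_foliation \<eta> \<Longrightarrow> locally_lipschitz (d_theta u)"
      by (rule lipschitz_foliation_d_theta)
    show "lipschitz_foliation \<eta> \<Longrightarrow> compact C \<Longrightarrow> \<exists>L. \<forall>c\<in>C. L-lipschitz_on UNIV (\<lambda>\<theta>. d_c u (\<theta>, c))" for C
      by (rule angle_slopes_d_c_lipschitz[OF slopes])
    show "lipschitz_foliation \<eta> \<Longrightarrow> compact K \<Longrightarrow>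
      \<exists>k_plus k_minus. k_plus > k_minus \<and> k_minus > -1 \<and>
          (AE p in annulus_lebesgue. p \<in> K \<longrightarrow>
            (\<exists>d. ((\<lambda>t. d_c u (fst p + to_circle t, snd p)) has_real_derivative d) (at 0) \<and>
              k_plus \<ge> d \<and> d \<ge> k_minus))" for K
      by (rule angle_slopes_ae_bounds[OF slopes])
    show "lipschitz_foliation \<eta> \<Longrightarrow> \<exists>\<Phi>. exact_symplectic_homeomorphism \<Phi> \<and>
        map_generating_function u \<Phi> \<and> (\<lambda>l. \<Phi> ` l) ` standard_foliation = leaves \<eta>"
      by (rule angle_slopes_exact_symplectic[OF slopes])
  qed (auto intro!: lipschitz_foliationI)
qed

end
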